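(* Let $k \ge 3$. For $n \in \mathbb{N}$ and $p \in (0,1]$, let $[n]_p$ be the random subset of $[n]$ in which each element is included independently with probability $p$, and let $X=X_{k,n,p}$ be the number of arithmetic progressions of length $k$ contained in $[n]_p$. Set $\mu=\mathbb{E} X$ and $\varphi(x)=(1+x)\log(1+x)-x$. Given $\gamma\in(0,1)$, there are $n_0>0$ and $\alpha>1/(6k)$ (depending only on $k$) and $c,C>0$ (depending only on $\gamma,k$) such that for all $n \ge n_0$, $p \in (0,1-\gamma]$ and $\varepsilon \ge n^{-\alpha}$ satisfying $\Phi(\varepsilon)\ge 1$ we have \[ \mathbf{1}\{1 \le (1+\varepsilon)\mu \le X_{k,n,1}\}\exp\bigl(-C\Phi(\varepsilon)\bigr) \le \Pr(X \ge (1+\varepsilon)\mu) \le \exp\bigl(-c\Phi(\varepsilon)\bigr), \] where $\Phi(\varepsilon)=\min\{\varphi(\varepsilon)\mu^2/\mathrm{Var}\, X,\ \sqrt{\varepsilon\mu}\log(1/p)\}$.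
   Context: An arithmetic progression of length $k$ in $[n]$ is a $k$-element subset of $[n]$ whose elements form an arithmetic progression. $X_{k,n,1}$ is the total number of such progressions in $[n]$. $\mathbf{1}\{\cdot\}$ denotes the indicator; $\log$ is the natural logarithm. *)

theory Defs
  imports "HOL-Probability.Probability"
begin

text \<open>Progressions are counted as sets, not as parametrised sequences. For \<open>k \<ge> 2\<close> the
  condition \<open>card A = k\<close> forces the common difference \<open>d\<close> to be nonzero.\<close>

definition arith_progs :: "nat \<Rightarrow> nat set \<Rightarrow> nat set set" where
  "arith_progs k S = {A. A \<subseteq> S \<and> card A = k \<and> (\<exists>a d. A = (\<lambda>i. a + i * d) ` {..<k})}"

definition num_AP :: "nat \<Rightarrow> nat set \<Rightarrow> real" where
  "num_AP k S = real (card (arith_progs k S))"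

text \<open>The law of the binomial random subset \<open>[n]\<^sub>p\<close> of \<open>[n] = {1..n}\<close>. The random variable
  \<open>X\<close> is \<open>num_AP k\<close> on this probability space.\<close>

definition random_subset :: "nat \<Rightarrow> real \<Rightarrow> nat set pmf" where
  "random_subset n p =
     map_pmf (\<lambda>f. {i \<in> {1..n}. f i}) (Pi_pmf {1..n} False (\<lambda>_. bernoulli_pmf p))"

definition mu_AP :: "nat \<Rightarrow> nat \<Rightarrow> real \<Rightarrow> real" where
  "mu_AP k n p = measure_pmf.expectation (random_subset n p) (num_AP k)"

definition var_AP :: "nat \<Rightarrow> nat \<Rightarrow> real \<Rightarrow> real" where
  "var_AP k n p = measure_pmf.variance (random_subset n p) (num_AP k)"

definition phi :: "real \<Rightarrow> real" where
  "phi x = (1 + x) * ln (1 + x) - x"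

definition Phi :: "nat \<Rightarrow> nat \<Rightarrow> real \<Rightarrow> real \<Rightarrow> real" where
  "Phi k n p \<epsilon> =
     min (phi \<epsilon> * (mu_AP k n p)\<^sup>2 / var_AP k n p) (sqrt (\<epsilon> * mu_AP k n p) * ln (1 / p))"

end

theory Submission
  imports Defs
begin

text \<open>
  \<^emph>\<open>Upper bound.\<close> Suppose the random set \<open>R\<close> contains a family of \<open>z\<close> progressions in which a member
  meets at most \<open>C\<close> others on average. Then the family has at least \<open>\<Prod>\<^sub>i\<^sub><\<^sub>r (z - 2 i C)\<close> ordered
  \<open>r\<close>-tuples of disjoint members, while the expected number of disjoint \<open>r\<close>-tuples in \<open>R\<close> is at most
  \<open>\<mu>\<^sup>r\<close>. Markov's inequality with \<open>z = (1 + \<epsilon>/2) \<mu>\<close> and \<open>r \<approx> \<epsilon> \<mu> / C\<close> gives \<open>exp (- c \<phi>(\<epsilon>) \<mu> / C)\<close>,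
  which for \<open>C \<approx> max 1 (n p\<^sup>k\<^sup>-\<^sup>1)\<close> is \<open>exp (- c \<phi>(\<epsilon>) \<mu>\<^sup>2 / Var X)\<close>. To find such a family inside \<open>R\<close>, delete
  all progressions meeting the vertex set \<open>V\<close> of a maximal family of disjoint high-degree stars. A star
  of \<open>m\<close> progressions costs a factor \<open>p\<^sup>c\<^sup>m\<close>, so \<open>V\<close> has \<open>O(\<Phi> / log (1/p)) = O(\<surd>(\<epsilon> \<mu>))\<close> vertices up to probability
  \<open>exp (- c \<Phi>)\<close>. Few progressions have two vertices in \<open>V\<close> since two vertices lie in at most \<open>k\<^sup>2\<close>
  progressions, and those with exactly one are controlled by the same tuple count and a union bound
  over \<open>V\<close>. Where the remaining maximal degree is still larger than \<open>C\<close>, the tuple count applied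
  to pairs of progressions sharing one element bounds the average degree.

  \<^emph>\<open>Lower bound.\<close> Planting an interval of length \<open>O(\<surd>(\<epsilon> \<mu>))\<close> yields \<open>exp (- C \<surd>(\<epsilon> \<mu>) log (1/p))\<close>. For
  \<open>n p\<^sup>k\<^sup>-\<^sup>1 \<ge> 1\<close> and small \<open>\<epsilon>\<close>, replacing \<open>p\<close> by \<open>(1 + O(\<epsilon>)) p\<close> costs \<open>exp (- O(\<epsilon>\<^sup>2 n p))\<close>. For
  \<open>n p\<^sup>k\<^sup>-\<^sup>1 \<le> 1\<close>, planting \<open>O(\<epsilon> \<mu>)\<close> (or \<open>(1 + \<epsilon>) \<mu>\<close> if \<open>\<epsilon> \<ge> 1\<close>) uniformly random progressions costs
  \<open>exp (- O(\<phi>(\<epsilon>) \<mu>))\<close>. Both changes of measure are compared with the original law by the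
  Cauchy--Schwarz inequality. In the remaining ranges the first term of \<open>\<Phi>\<close> dominates the second.
\<close>

section \<open>Expectations over the binomial random subset\<close>

text \<open>The obstacle in the upper bound is a gap between degrees. For a star of m edges to cost
  a power p^(c m), so that log (1/p) is gained, m has to exceed n p^(k-1) by a small negative power
  of p. Deleting stars therefore leaves a maximal degree that may exceed the wanted max(1, n
  p^(k-1)) by a factor p^(-1/10). If \<epsilon> is at least p^(1/10), the clustered term of Phi is
  so far below phi(\<epsilon>) n p that this loss is harmless. If \<epsilon> is smaller, the maximal
  degree enters the tuple count only multiplied by \<epsilon>, and the average degree, controlled by
  pairs of edges, decides. For p above exp(-120 k) the trivial degree bound k^2 n is already good
  enough.

  The condition Phi >= 1 acts in two ways. Its first half gives Var X \<le> (\<epsilon> mu)^2, so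
  deviations of size \<epsilon> mu can be handled with constant probability by second moments. And a
  rate of at least 1 absorbs constant factors into the exponent, on both sides of the
  estimate.\<close>

definition Ebin :: "nat \<Rightarrow> real \<Rightarrow> (nat set \<Rightarrow> real) \<Rightarrow> real" where
  "Ebin n p f = (\<Sum>S\<in>Pow {1..n}. p ^ card S * (1 - p) ^ (n - card S) * f S)"

lemma pmf_random_subset:
  assumes p: "0 \<le> p" "p \<le> 1" and S: "S \<subseteq> {1..n}"
  shows "pmf (random_subset n p) S = p ^ card S * (1 - p) ^ (n - card S)"
proof -
  let ?P = "Pi_pmf {1..n} False (\<lambda>_. bernoulli_pmf p)"
  have "pmf (random_subset n p) S = measure ?P ({f. {i \<in> {1..n}. f i} = S} \<inter> set_pmf ?P)"
    unfolding random_subset_def pmf_map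
    by (simp add: measure_Int_set_pmf vimage_def)
  \<comment> \<open>Outside \<open>{1..n}\<close> every function in the support takes the default
    value \<open>False\<close>, so the preimage of \<open>S\<close> meets the support in at most one
    function.\<close>
  also have "{f. {i \<in> {1..n}. f i} = S} \<inter> set_pmf ?P = {\<lambda>i. i \<in> S} \<inter> set_pmf ?P"
  proof -
    have "f = (\<lambda>i. i \<in> S)" if "{i \<in> {1..n}. f i} = S" "f \<in> set_pmf ?P" for f
    proof -
      have "\<forall>x. x \<notin> {1..n} \<longrightarrow> f x = False"
        using set_Pi_pmf_subset[of "{1..n}" False "\<lambda>_. bernoulli_pmf p"] that(2) by auto
      then show ?thesis using that(1) by (auto simp: fun_eq_iff)
    qed
    moreover have "{i \<in> {1..n}. i \<in> S} = S" using S by auto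
    ultimately show ?thesis by auto
  qed
  also have "measure ?P ({\<lambda>i. i \<in> S} \<inter> set_pmf ?P) = pmf ?P (\<lambda>i. i \<in> S)"
    by (simp add: measure_Int_set_pmf measure_pmf_single)
  also have "\<dots> = (\<Prod>i\<in>{1..n}. pmf (bernoulli_pmf p) (i \<in> S))"
    using S by (subst pmf_Pi) auto
  also have "\<dots> = (\<Prod>i\<in>S \<union> ({1..n} - S). if i \<in> S then p else 1 - p)"
    using S p by (intro prod.cong) auto
  also have "\<dots> = (\<Prod>i\<in>S. p) * (\<Prod>i\<in>{1..n} - S. 1 - p)"
    using S finite_subset[OF S] by (subst prod.union_disjoint) auto
  also have "\<dots> = p ^ card S * (1 - p) ^ (n - card S)"
    using S finite_subset[OF S] by (simp add: card_Diff_subset)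
  finally show ?thesis .
qed

text \<open>The bridge from the probability space to a finite weighted sum. In that form exchanging
  sums and changing the measure are plain algebra without integrability conditions.\<close>

lemma expectation_random_subset:
  fixes f :: "nat set \<Rightarrow> real"
  assumes p: "0 \<le> p" "p \<le> 1"
  shows "measure_pmf.expectation (random_subset n p) f = Ebin n p f"
proof -
  have sub: "set_pmf (random_subset n p) \<subseteq> Pow {1..n}"
    by (auto simp: random_subset_def)
  have "measure_pmf.expectation (random_subset n p) f
      = (\<Sum>S\<in>Pow {1..n}. pmf (random_subset n p) S *\<^sub>R f S)"
    using sub by (intro integral_measure_pmf) auto
  also have "\<dots> = Ebin n p f"
    unfolding Ebin_def using p by (intro sum.cong) (auto simp: pmf_random_subset)
  finally show ?thesis .
qed

lemma prob_random_subset: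
  assumes p: "0 \<le> p" "p \<le> 1"
  shows "measure_pmf.prob (random_subset n p) {S. P S} = Ebin n p (\<lambda>S. of_bool (P S))"
proof -
  have "measure_pmf.prob (random_subset n p) {S. P S}
    = measure_pmf.expectation (random_subset n p) (indicat_real {S. P S})"
    by simp
  also have "\<dots> = Ebin n p (indicat_real {S. P S})"
    by (rule expectation_random_subset[OF p])
  also have "\<dots> = Ebin n p (\<lambda>S. of_bool (P S))"
    by (simp add: Ebin_def indicator_def)
  finally show ?thesis .
qed

lemma Ebin_add: "Ebin n p (\<lambda>S. f S + g S) = Ebin n p f + Ebin n p g"
  by (simp add: Ebin_def sum.distrib distrib_left)

lemma Ebin_diff: "Ebin n p (\<lambda>S. f S - g S) = Ebin n p f - Ebin n p g"
  by (simp add: Ebin_def sum_subtractf right_diff_distrib)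

lemma Ebin_cmult: "Ebin n p (\<lambda>S. c * f S) = c * Ebin n p f"
  by (simp add: Ebin_def sum_distrib_left mult_ac)

lemma Ebin_sum: "Ebin n p (\<lambda>S. \<Sum>i\<in>I. f i S) = (\<Sum>i\<in>I. Ebin n p (f i))"
  unfolding Ebin_def sum_distrib_left by (rule sum.swap)

lemma Ebin_mono:
  assumes "0 \<le> p" "p \<le> 1" "\<And>S. S \<subseteq> {1..n} \<Longrightarrow> f S \<le> g S"
  shows "Ebin n p f \<le> Ebin n p g"
  unfolding Ebin_def using assms by (intro sum_mono mult_left_mono) auto

lemma Ebin_cong:
  assumes "\<And>S. S \<subseteq> {1..n} \<Longrightarrow> f S = g S"
  shows "Ebin n p f = Ebin n p g"
  unfolding Ebin_def using assms by (intro sum.cong) auto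

lemma Ebin_nonneg:
  assumes "0 \<le> p" "p \<le> 1" "\<And>S. S \<subseteq> {1..n} \<Longrightarrow> 0 \<le> f S"
  shows "0 \<le> Ebin n p f"
  unfolding Ebin_def using assms by (intro sum_nonneg mult_nonneg_nonneg) auto

lemma Ebin_const:
  assumes "0 \<le> p" "p \<le> 1"
  shows "Ebin n p (\<lambda>_. c) = c"
proof -
  have "measure_pmf.expectation (random_subset n p) (\<lambda>_. c) = c" by simp
  then show ?thesis using expectation_random_subset[OF assms] by metis
qed

lemma Ebin_insert:
  assumes p: "0 < p" and x: "x \<in> {1..n}"
  shows "Ebin n p (\<lambda>S. of_bool (x \<in> S) * f S) = p * Ebin n p (\<lambda>S. f (insert x S))"
proof -
  let ?w = "\<lambda>S. p ^ card S * (1 - p) ^ (n - card S)"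
  let ?B = "Pow ({1..n} - {x})"
  have fin: "finite ?B" by simp
  have un: "Pow {1..n} = ?B \<union> insert x ` ?B"
    using x Pow_insert[of x "{1..n} - {x}"] by (simp add: insert_absorb)
  have disj: "?B \<inter> insert x ` ?B = {}" by auto
  have inj: "inj_on (insert x) ?B" by (auto simp: inj_on_def)
  \<comment> \<open>The pair \<open>S\<close>, \<open>insert x S\<close> is what remains of an
    outcome once the membership of \<open>x\<close> is forgotten; given the pair, \<open>x\<close>
    is present with probability \<open>p\<close>.\<close>
  have w: "p * ?w S + p * ?w (insert x S) = ?w (insert x S)" if "S \<in> ?B" for S
  proof -
    have S: "finite S" "x \<notin> S" "S \<subseteq> {1..n} - {x}" using that finite_subset[of S "{1..n}"] by auto
    have "card S \<le> card ({1..n} - {x})" using S(3) by (intro card_mono) auto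
    also have "\<dots> = n - 1" using x by simp
    finally have "card S < n" using x by auto
    then obtain m where m: "n = card S + Suc m" by (metis less_iff_Suc_add add_Suc_right)
    have "n - card S = Suc m" "n - Suc (card S) = m" using m by auto
    then show ?thesis using S by (simp add: algebra_simps)
  qed
  have split: "(\<Sum>S\<in>Pow {1..n}. g S) = (\<Sum>S\<in>?B. g S + g (insert x S))" for g :: "nat set \<Rightarrow> real"
    unfolding un using fin disj inj by (subst sum.union_disjoint) (auto simp: sum.reindex sum.distrib)
  have "Ebin n p (\<lambda>S. of_bool (x \<in> S) * f S) = (\<Sum>S\<in>?B. ?w (insert x S) * f (insert x S))"
    unfolding Ebin_def split by (intro sum.cong) auto
  also have "\<dots> = (\<Sum>S\<in>?B. p * (?w S * f (insert x S) + ?w (insert x S) * f (insert x (insert x S))))"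
  proof (intro sum.cong refl)
    fix S assume S: "S \<in> ?B"
    have "?w (insert x S) * f (insert x S) = (p * ?w S + p * ?w (insert x S)) * f (insert x S)"
      using w[OF S] by simp
    also have "\<dots> = p * (?w S * f (insert x S) + ?w (insert x S) * f (insert x (insert x S)))"
      by (simp add: algebra_simps)
    finally show "?w (insert x S) * f (insert x S)
      = p * (?w S * f (insert x S) + ?w (insert x S) * f (insert x (insert x S)))" .
  qed
  also have "\<dots> = p * Ebin n p (\<lambda>S. f (insert x S))"
    unfolding Ebin_def split by (simp add: sum_distrib_left)
  finally show ?thesis .
qed

text \<open>Given that \<open>V\<close> is contained in the random set, the other elements are still
  independent, so conditioning amounts to adding \<open>V\<close>. Read from right to left, this is
  planting \<open>V\<close> at the price \<open>p ^ card V\<close>, the source of all planted lower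
  bounds.\<close>

lemma Ebin_subset:
  assumes p: "0 < p" and V: "V \<subseteq> {1..n}"
  shows "Ebin n p (\<lambda>S. of_bool (V \<subseteq> S) * f S) = p ^ card V * Ebin n p (\<lambda>S. f (S \<union> V))"
proof -
  have "finite V" using V finite_subset by auto
  then show ?thesis using V
  proof (induction V arbitrary: f rule: finite_induct)
    case (insert x V)
    have "Ebin n p (\<lambda>S. of_bool (insert x V \<subseteq> S) * f S)
      = Ebin n p (\<lambda>S. of_bool (x \<in> S) * (of_bool (V \<subseteq> S) * f S))"
      by (intro Ebin_cong) auto
    also have "\<dots> = p * Ebin n p (\<lambda>S. of_bool (V \<subseteq> insert x S) * f (insert x S))"
      using insert by (subst Ebin_insert[OF p]) auto
    also have "\<dots> = p * Ebin n p (\<lambda>S. of_bool (V \<subseteq> S) * f (insert x S))"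
      using insert.hyps by (intro arg_cong[where f = "\<lambda>t. p * t"] Ebin_cong) auto
    also have "\<dots> = p * (p ^ card V * Ebin n p (\<lambda>S. f (insert x (S \<union> V))))"
      using insert by (subst insert.IH) auto
    finally show ?case using insert.hyps by simp
  qed simp
qed

lemma Ebin_of_subset:
  assumes "0 < p" "p \<le> 1" "V \<subseteq> {1..n}"
  shows "Ebin n p (\<lambda>S. of_bool (V \<subseteq> S)) = p ^ card V"
  using Ebin_subset[OF assms(1,3), of "\<lambda>_. 1"] assms by (simp add: Ebin_const)

lemma Ebin_markov:
  assumes p: "0 \<le> p" "p \<le> 1" and c: "0 < c"
    and "\<And>S. S \<subseteq> {1..n} \<Longrightarrow> P S \<Longrightarrow> c \<le> f S"
    and "\<And>S. S \<subseteq> {1..n} \<Longrightarrow> 0 \<le> f S"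
  shows "Ebin n p (\<lambda>S. of_bool (P S)) \<le> Ebin n p f / c"
proof -
  have "c * Ebin n p (\<lambda>S. of_bool (P S)) = Ebin n p (\<lambda>S. c * of_bool (P S))"
    by (simp add: Ebin_cmult)
  also have "\<dots> \<le> Ebin n p f"
    using assms by (intro Ebin_mono) auto
  finally show ?thesis using c by (simp add: field_simps)
qed

text \<open>Chebyshev at distance t with variance t^2 would only give the bound 1. Shifting the
  centred variable by t before squaring raises its second moment to at most 2 t^2 but the threshold
  to (2 t)^2, which yields 1/2.\<close>

lemma Ebin_cantelli:
  assumes p: "0 \<le> p" "p \<le> 1" and t: "0 < t"
    and var: "Ebin n p (\<lambda>S. (f S - m)\<^sup>2) \<le> t\<^sup>2" and m: "Ebin n p f = m"
  shows "Ebin n p (\<lambda>S. of_bool (f S \<ge> m + t)) \<le> 1 / 2"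
    and "Ebin n p (\<lambda>S. of_bool (f S \<le> m - t)) \<le> 1 / 2"
proof -
  have c0: "Ebin n p (\<lambda>S. f S - m) = 0" using p m by (simp add: Ebin_diff Ebin_const)
  have e: "Ebin n p (\<lambda>S. (f S - m + s)\<^sup>2) \<le> 2 * t\<^sup>2" if s: "s = t \<or> s = - t" for s
  proof -
    have "Ebin n p (\<lambda>S. (f S - m + s)\<^sup>2) = Ebin n p (\<lambda>S. (f S - m)\<^sup>2 + (2 * s * (f S - m) + s\<^sup>2))"
      by (intro Ebin_cong) (simp add: power2_eq_square algebra_simps)
    also have "\<dots> = Ebin n p (\<lambda>S. (f S - m)\<^sup>2) + (2 * s * 0 + s\<^sup>2)"
      using p by (simp add: Ebin_add Ebin_cmult c0 Ebin_const)
    also have "\<dots> \<le> 2 * t\<^sup>2" using var s by auto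
    finally show ?thesis .
  qed
  have "Ebin n p (\<lambda>S. of_bool (f S \<ge> m + t)) \<le> Ebin n p (\<lambda>S. (f S - m + t)\<^sup>2) / (2 * t)\<^sup>2"
    using p t by (intro Ebin_markov power_mono) auto
  also have "\<dots> \<le> (2 * t\<^sup>2) / (2 * t)\<^sup>2" using e[of t] by (intro divide_right_mono) auto
  also have "\<dots> = 1 / 2" using t by (simp add: power2_eq_square)
  finally show "Ebin n p (\<lambda>S. of_bool (f S \<ge> m + t)) \<le> 1 / 2" .
  have "Ebin n p (\<lambda>S. of_bool (f S \<le> m - t)) \<le> Ebin n p (\<lambda>S. (f S - m + (- t))\<^sup>2) / (2 * t)\<^sup>2"
  proof (intro Ebin_markov)
    fix S assume "f S \<le> m - t"
    then have "2 * t \<le> - (f S - m + (- t))" by simp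
    then have "(2 * t)\<^sup>2 \<le> (- (f S - m + (- t)))\<^sup>2" using t by (intro power_mono) auto
    then show "(2 * t)\<^sup>2 \<le> (f S - m + (- t))\<^sup>2" by (simp add: power2_commute)
  qed (use p t in auto)
  also have "\<dots> \<le> (2 * t\<^sup>2) / (2 * t)\<^sup>2" using e[of "- t"] by (intro divide_right_mono) auto
  also have "\<dots> = 1 / 2" using t by (simp add: power2_eq_square)
  finally show "Ebin n p (\<lambda>S. of_bool (f S \<le> m - t)) \<le> 1 / 2" .
qed

lemma Ebin_of_bool_le_1:
  assumes "0 \<le> p" "p \<le> 1"
  shows "Ebin n p (\<lambda>S. of_bool (P S)) \<le> 1"
proof -
  have "Ebin n p (\<lambda>S. of_bool (P S)) \<le> Ebin n p (\<lambda>S. 1)"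
    using assms by (intro Ebin_mono) auto
  then show ?thesis using assms by (simp add: Ebin_const)
qed

lemma Ebin_union_bound:
  assumes "0 \<le> p" "p \<le> 1" "finite I" "\<And>S. S \<subseteq> {1..n} \<Longrightarrow> P S \<Longrightarrow> \<exists>i\<in>I. Q i S"
  shows "Ebin n p (\<lambda>S. of_bool (P S)) \<le> (\<Sum>i\<in>I. Ebin n p (\<lambda>S. of_bool (Q i S)))"
proof -
  have "Ebin n p (\<lambda>S. of_bool (P S)) \<le> Ebin n p (\<lambda>S. \<Sum>i\<in>I. of_bool (Q i S))"
  proof (intro Ebin_mono)
    fix S assume S: "S \<subseteq> {1..n}"
    show "of_bool (P S) \<le> (\<Sum>i\<in>I. of_bool (Q i S) :: real)"
    proof (cases "P S")
      case True
      then obtain i where i: "i \<in> I" "Q i S" using assms(4) S by blast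
      have "(1::real) = (\<Sum>j\<in>{i}. of_bool (Q j S))" using i by simp
      also have "\<dots> \<le> (\<Sum>j\<in>I. of_bool (Q j S))" using i assms(3) by (intro sum_mono2) auto
      finally show ?thesis using True by simp
    qed (auto intro: sum_nonneg)
  qed (use assms in auto)
  then show ?thesis by (simp add: Ebin_sum)
qed

lemma Ebin_le_add:
  assumes "0 \<le> p" "p \<le> 1" "\<And>S. S \<subseteq> {1..n} \<Longrightarrow> P S \<Longrightarrow> Q S \<or> R S"
  shows "Ebin n p (\<lambda>S. of_bool (P S)) \<le> Ebin n p (\<lambda>S. of_bool (Q S)) + Ebin n p (\<lambda>S. of_bool (R S))"
proof -
  have "Ebin n p (\<lambda>S. of_bool (P S)) \<le> Ebin n p (\<lambda>S. of_bool (Q S) + of_bool (R S))"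
    using assms by (intro Ebin_mono) auto
  then show ?thesis by (simp add: Ebin_add)
qed

lemma Ebin_not:
  assumes "0 \<le> p" "p \<le> 1"
  shows "Ebin n p (\<lambda>S. of_bool (\<not> P S)) = 1 - Ebin n p (\<lambda>S. of_bool (P S))"
proof -
  have "Ebin n p (\<lambda>S. of_bool (\<not> P S)) = Ebin n p (\<lambda>S. 1 - of_bool (P S))"
    by (intro Ebin_cong) auto
  then show ?thesis using assms by (simp add: Ebin_diff Ebin_const)
qed

section \<open>Counting tuples of disjoint sets\<close>

text \<open>The sets are indexed because the count is applied to edges, pairs of edges, stars and
  traces \<open>A - V\<close>, where different indices may carry the same set. Disjointness is
  symmetric, so \<open>sorted_wrt\<close> expresses it for all pairs of positions.\<close>

definition disjoint_tuples :: "('i \<Rightarrow> nat set) \<Rightarrow> 'i set \<Rightarrow> nat \<Rightarrow> 'i list set" where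
  "disjoint_tuples S J r = {xs. length xs = r \<and> set xs \<subseteq> J \<and> sorted_wrt (\<lambda>x y. S x \<inter> S y = {}) xs}"

lemma finite_disjoint_tuples: "finite J \<Longrightarrow> finite (disjoint_tuples S J r)"
  by (rule finite_subset[OF _ finite_lists_length_eq[of J r]]) (auto simp: disjoint_tuples_def)

lemma disjoint_tuples_0: "disjoint_tuples S J 0 = {[]}"
  by (auto simp: disjoint_tuples_def)

lemma disjoint_tuples_Suc:
  "disjoint_tuples S J (Suc r) = (\<lambda>(xs, x). x # xs) `
     (SIGMA xs:disjoint_tuples S J r. {x \<in> J. \<forall>y\<in>set xs. S x \<inter> S y = {}})"
  by (auto simp: disjoint_tuples_def length_Suc_conv image_iff)

lemma inj_on_Cons_pair: "inj_on (\<lambda>(xs, x). x # xs) B"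
  by (auto simp: inj_on_def)

lemma card_disjoint_tuples_Suc:
  assumes "finite J"
  shows "card (disjoint_tuples S J (Suc r)) =
    (\<Sum>xs\<in>disjoint_tuples S J r. card {x \<in> J. \<forall>y\<in>set xs. S x \<inter> S y = {}})"
  unfolding disjoint_tuples_Suc card_image[OF inj_on_Cons_pair]
  using assms by (intro card_SigmaI) (auto simp: finite_disjoint_tuples)

text \<open>An index with a nonempty set conflicts with itself. This is what excludes repetitions in
  a tuple, and the degree bounds below include this self-conflict.\<close>

definition conflicts :: "('i \<Rightarrow> nat set) \<Rightarrow> 'i set \<Rightarrow> 'i \<Rightarrow> 'i set" where
  "conflicts S J x = {y \<in> J. S y \<inter> S x \<noteq> {}}"

lemma card_free_ge:
  assumes "finite J"
  shows "real (card {x \<in> J. \<forall>y\<in>set xs. S x \<inter> S y = {}})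
    \<ge> real (card J) - (\<Sum>l<length xs. real (card (conflicts S J (xs ! l))))"
proof -
  let ?F = "{x \<in> J. \<forall>y\<in>set xs. S x \<inter> S y = {}}"
  have "J \<subseteq> ?F \<union> (\<Union>l<length xs. conflicts S J (xs ! l))"
    by (force simp: conflicts_def in_set_conv_nth)
  then have "card J \<le> card (?F \<union> (\<Union>l<length xs. conflicts S J (xs ! l)))"
    using assms by (intro card_mono) (auto simp: conflicts_def)
  also have "\<dots> \<le> card ?F + card (\<Union>l<length xs. conflicts S J (xs ! l))"
    by (rule card_Un_le)
  also have "card (\<Union>l<length xs. conflicts S J (xs ! l)) \<le> (\<Sum>l<length xs. card (conflicts S J (xs ! l)))"
    by (rule card_UN_le) simp
  finally have "real (card J) \<le> real (card ?F + (\<Sum>l<length xs. card (conflicts S J (xs ! l))))"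
    unfolding of_nat_le_iff by simp
  then show ?thesis by simp
qed

text \<open>Removing the entry at position \<open>l\<close> leaves a disjoint tuple, and the tuple
  is recovered from that entry and the remainder. Thus the pairs (entry, remainder) embed into all
  of \<open>J\<close> times the shorter tuples.\<close>

lemma sum_disjoint_tuples_nth_le:
  fixes g :: "'i \<Rightarrow> real"
  assumes J: "finite J" and l: "l \<le> r" and g: "\<And>y. y \<in> J \<Longrightarrow> 0 \<le> g y"
  shows "(\<Sum>xs\<in>disjoint_tuples S J (Suc r). g (xs ! l)) \<le> (\<Sum>y\<in>J. g y) * real (card (disjoint_tuples S J r))"
proof -
  let ?h = "\<lambda>xs. (xs ! l, take l xs @ drop (Suc l) xs)"
  have eq: "xs = take l xs @ (xs ! l) # drop (Suc l) xs" if "xs \<in> disjoint_tuples S J (Suc r)" for xs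
    using that l by (intro id_take_nth_drop) (auto simp: disjoint_tuples_def)
  have inj: "inj_on ?h (disjoint_tuples S J (Suc r))"
  proof (intro inj_onI)
    fix xs ys assume a: "xs \<in> disjoint_tuples S J (Suc r)" "ys \<in> disjoint_tuples S J (Suc r)" "?h xs = ?h ys"
    have "length (take l xs) = length (take l ys)" using a by (simp add: disjoint_tuples_def)
    then have "take l xs = take l ys" "drop (Suc l) xs = drop (Suc l) ys" using a(3) by auto
    then show "xs = ys" using eq[OF a(1)] eq[OF a(2)] a(3) by (metis fst_conv)
  qed
  have im: "?h ` disjoint_tuples S J (Suc r) \<subseteq> J \<times> disjoint_tuples S J r"
  proof (intro subsetI)
    fix q assume "q \<in> ?h ` disjoint_tuples S J (Suc r)"
    then obtain xs where xs: "xs \<in> disjoint_tuples S J (Suc r)" and q: "q = ?h xs" by auto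
    have 1: "xs ! l \<in> J" using xs l unfolding disjoint_tuples_def
      by (metis (mono_tags, lifting) le_imp_less_Suc mem_Collect_eq nth_mem subsetD)
    have "sorted_wrt (\<lambda>x y. S x \<inter> S y = {}) (take l xs @ (xs ! l) # drop (Suc l) xs)"
      using xs eq[OF xs] by (auto simp: disjoint_tuples_def)
    then have "sorted_wrt (\<lambda>x y. S x \<inter> S y = {}) (take l xs @ drop (Suc l) xs)"
      by (auto simp: sorted_wrt_append)
    moreover have "set (take l xs @ drop (Suc l) xs) \<subseteq> J"
      using xs set_take_subset[of l xs] set_drop_subset[of "Suc l" xs] by (auto simp: disjoint_tuples_def)
    moreover have "length (take l xs @ drop (Suc l) xs) = r" using xs l by (simp add: disjoint_tuples_def)
    ultimately show "q \<in> J \<times> disjoint_tuples S J r" using 1 q by (simp add: disjoint_tuples_def)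
  qed
  have "(\<Sum>xs\<in>disjoint_tuples S J (Suc r). g (xs ! l)) = (\<Sum>q\<in>?h ` disjoint_tuples S J (Suc r). g (fst q))"
    by (subst sum.reindex[OF inj]) simp
  also have "\<dots> \<le> (\<Sum>q\<in>J \<times> disjoint_tuples S J r. g (fst q))"
    using im J g by (intro sum_mono2) (auto simp: finite_disjoint_tuples)
  also have "\<dots> = (\<Sum>y\<in>J. \<Sum>xs\<in>disjoint_tuples S J r. g y)"
    by (subst sum.cartesian_product) (auto simp: case_prod_beta)
  also have "\<dots> = (\<Sum>y\<in>J. g y) * real (card (disjoint_tuples S J r))"
    by (simp add: sum_distrib_right mult.commute)
  finally show ?thesis .
qed

text \<open>A tuple of \<open>i + 1\<close> disjoint sets is lost from the naive count \<open>|J| N\<^sub>i\<close> only through a conflict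
  with one of the \<open>i\<close> earlier entries; deleting that entry leaves a disjoint tuple of length \<open>i - 1\<close>.
  Hence the maximal conflict degree \<open>D\<close> enters only in the crude comparison of \<open>N\<^sub>i\<close> with
  \<open>N\<^sub>i\<^sub>-\<^sub>1\<close>, and the average conflict degree \<open>C\<close> governs the main term.\<close>

lemma card_disjoint_tuples_ge:
  fixes C D w z :: real
  assumes J: "finite J" and z: "0 < z" "z \<le> real (card J)"
    and D: "\<And>x. x \<in> J \<Longrightarrow> real (card (conflicts S J x)) \<le> D"
    and C: "(\<Sum>x\<in>J. real (card (conflicts S J x))) \<le> C * real (card J)"
    and iD: "\<And>i. i < r \<Longrightarrow> 2 * (real i * D) \<le> z"
    and iC: "\<And>i. i < r \<Longrightarrow> 2 * C * real i \<le> w" and w: "0 \<le> w" "w < z"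
  shows "(z - w) ^ r \<le> real (card (disjoint_tuples S J r))"
proof -
  define N where "N i = real (card (disjoint_tuples S J i))" for i
  define z' where "z' = real (card J)"
  have N0: "N 0 = 1" by (simp add: N_def disjoint_tuples_0)
  have Nnn: "0 \<le> N i" for i by (simp add: N_def)
  have NSuc: "N (Suc i) \<ge> z' * N i - (\<Sum>xs\<in>disjoint_tuples S J i. \<Sum>l<i. real (card (conflicts S J (xs ! l))))" for i
  proof -
    have "N (Suc i) = (\<Sum>xs\<in>disjoint_tuples S J i. real (card {x \<in> J. \<forall>y\<in>set xs. S x \<inter> S y = {}}))"
      unfolding N_def card_disjoint_tuples_Suc[OF J] by simp
    also have "\<dots> \<ge> (\<Sum>xs\<in>disjoint_tuples S J i. z' - (\<Sum>l<length xs. real (card (conflicts S J (xs ! l)))))"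
      using card_free_ge[OF J] by (intro sum_mono) (auto simp: z'_def)
    also have "(\<Sum>xs\<in>disjoint_tuples S J i. z' - (\<Sum>l<length xs. real (card (conflicts S J (xs ! l)))))
        = (\<Sum>xs\<in>disjoint_tuples S J i. z' - (\<Sum>l<i. real (card (conflicts S J (xs ! l)))))"
      by (intro sum.cong) (auto simp: disjoint_tuples_def)
    finally show ?thesis by (simp add: sum_subtractf N_def mult.commute)
  qed
  have crude: "N (Suc i) \<ge> (z' - real i * D) * N i" for i
  proof -
    have "(\<Sum>xs\<in>disjoint_tuples S J i. \<Sum>l<i. real (card (conflicts S J (xs ! l))))
        \<le> (\<Sum>xs\<in>disjoint_tuples S J i. \<Sum>l<i. D)"
    proof (intro sum_mono D)
      fix xs l assume "xs \<in> disjoint_tuples S J i" "l \<in> {..<i}"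
      then show "xs ! l \<in> J" unfolding disjoint_tuples_def using nth_mem by blast
    qed
    also have "\<dots> = real i * D * N i" by (simp add: N_def)
    finally show ?thesis using NSuc[of i] by (simp add: algebra_simps)
  qed
  \<comment> \<open>The extensions lost at length \<open>i\<close> number at most
    \<open>i C z' N m\<close> with \<open>i = Suc m\<close>; this has to be compared with
    \<open>N i\<close> itself.\<close>
  have main: "(z - w) * N i \<le> N (Suc i)" if i: "i < r" for i
  proof (cases i)
    case 0
    then show ?thesis using crude[of 0] z w by (simp add: N0 z'_def)
  next
    case (Suc m)
    have "(\<Sum>xs\<in>disjoint_tuples S J i. \<Sum>l<i. real (card (conflicts S J (xs ! l))))
      = (\<Sum>l<i. \<Sum>xs\<in>disjoint_tuples S J i. real (card (conflicts S J (xs ! l))))"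
      by (rule sum.swap)
    also have "\<dots> \<le> (\<Sum>l<i. (\<Sum>y\<in>J. real (card (conflicts S J y))) * N m)"
      unfolding Suc N_def using J by (intro sum_mono sum_disjoint_tuples_nth_le) auto
    also have "\<dots> = real i * ((\<Sum>y\<in>J. real (card (conflicts S J y))) * N m)" by simp
    also have "\<dots> \<le> real i * (C * z' * N m)"
      using C Nnn[of m] by (intro mult_left_mono mult_right_mono) (auto simp: z'_def)
    finally have 1: "N (Suc i) \<ge> z' * N i - real i * (C * z' * N m)" using NSuc[of i] by simp
    \<comment> \<open>The crude estimate one length earlier gives
      \<open>z' * N m \<le> 2 * N i\<close>. It turns the loss \<open>i C z' N m\<close> into
      \<open>2 C i N i\<close>, which is at most \<open>w * N i\<close>.\<close>
    have "2 * (real m * D) \<le> z" using iD[of m] i Suc by simp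
    then have "z' / 2 \<le> z' - real m * D" using z by (simp add: z'_def)
    then have "z' / 2 * N m \<le> (z' - real m * D) * N m" using Nnn by (intro mult_right_mono)
    then have 2: "z' * N m \<le> 2 * N i" using crude[of m] Suc by simp
    have "0 \<le> (\<Sum>x\<in>J. real (card (conflicts S J x)))" by (rule sum_nonneg) simp
    then have "0 \<le> C * z'" using C by (simp add: z'_def)
    moreover have "0 < z'" using z by (simp add: z'_def)
    ultimately have Cnn: "0 \<le> C" by (simp add: zero_le_mult_iff)
    have "real i * (C * z' * N m) = real i * C * (z' * N m)" by simp
    also have "\<dots> \<le> real i * C * (2 * N i)" using 2 Cnn by (intro mult_left_mono) auto
    also have "\<dots> = (2 * C * real i) * N i" by simp
    also have "\<dots> \<le> w * N i" using iC[OF i] Nnn by (intro mult_right_mono) auto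
    finally have "N (Suc i) \<ge> (z' - w) * N i" using 1 by (simp add: algebra_simps)
    moreover have "(z - w) * N i \<le> (z' - w) * N i" using z Nnn by (intro mult_right_mono) (auto simp: z'_def)
    ultimately show ?thesis by simp
  qed
  have "(z - w) ^ i \<le> N i" if "i \<le> r" for i using that
  proof (induction i)
    case (Suc i)
    have "(z - w) ^ Suc i \<le> (z - w) * N i" using Suc w by (simp add: mult_left_mono)
    then show ?case using main[of i] Suc by simp
  qed (simp add: N0)
  then show ?thesis by (simp add: N_def)
qed

lemma power_card_UN_disjoint_tuples:
  assumes "sorted_wrt (\<lambda>x y. S x \<inter> S y = {}) xs" "\<And>x. x \<in> set xs \<Longrightarrow> finite (S x)"
  shows "(p::real) ^ card (\<Union>x\<in>set xs. S x) = prod_list (map (\<lambda>x. p ^ card (S x)) xs)"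
  using assms
proof (induction xs)
  case (Cons a xs)
  have "S a \<inter> (\<Union>x\<in>set xs. S x) = {}" using Cons.prems by auto
  then show ?case using Cons by (simp add: card_Un_disjoint power_add)
qed simp

lemma sum_prod_list_disjoint_tuples_le:
  fixes g :: "'i \<Rightarrow> real"
  assumes I: "finite I" and g: "\<And>x. 0 \<le> g x"
  shows "(\<Sum>xs\<in>disjoint_tuples S I r. prod_list (map g xs)) \<le> (\<Sum>x\<in>I. g x) ^ r"
proof (induction r)
  case (Suc r)
  have pl: "0 \<le> prod_list (map g xs)" for xs by (induction xs) (auto simp: g)
  have "(\<Sum>xs\<in>disjoint_tuples S I (Suc r). prod_list (map g xs))
    = (\<Sum>q\<in>(SIGMA xs:disjoint_tuples S I r. {x \<in> I. \<forall>y\<in>set xs. S x \<inter> S y = {}}). g (snd q) * prod_list (map g (fst q)))"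
    unfolding disjoint_tuples_Suc by (subst sum.reindex[OF inj_on_Cons_pair]) (auto simp: case_prod_beta)
  also have "\<dots> \<le> (\<Sum>q\<in>disjoint_tuples S I r \<times> I. g (snd q) * prod_list (map g (fst q)))"
    using I g pl by (intro sum_mono2) (auto simp: finite_disjoint_tuples)
  also have "\<dots> = (\<Sum>xs\<in>disjoint_tuples S I r. \<Sum>x\<in>I. g x * prod_list (map g xs))"
    by (subst sum.cartesian_product) (auto simp: case_prod_beta)
  also have "\<dots> = (\<Sum>x\<in>I. g x) * (\<Sum>xs\<in>disjoint_tuples S I r. prod_list (map g xs))"
    by (subst sum.swap) (simp add: sum_product)
  also have "\<dots> \<le> (\<Sum>x\<in>I. g x) * (\<Sum>x\<in>I. g x) ^ r"
    using Suc g by (intro mult_left_mono sum_nonneg) auto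
  finally show ?case by simp
qed (simp add: disjoint_tuples_0)

text \<open>Disjoint sets lie in the random set independently, so each tuple contributes a product
  of powers of \<open>p\<close>. Summing these products over all tuples, disjoint or not, would give
  exactly the \<open>r\<close>-th power.\<close>

lemma Ebin_disjoint_tuples_le:
  assumes p: "0 < p" "p \<le> 1" and I: "finite I" and S: "\<And>x. x \<in> I \<Longrightarrow> S x \<subseteq> {1..n}"
  shows "Ebin n p (\<lambda>R. real (card (disjoint_tuples S {x \<in> I. S x \<subseteq> R} r))) \<le> (\<Sum>x\<in>I. p ^ card (S x)) ^ r"
proof -
  have fS: "finite (S x)" if "x \<in> I" for x using S[OF that] finite_subset by blast
  have "real (card (disjoint_tuples S {x \<in> I. S x \<subseteq> R} r))
     = (\<Sum>xs\<in>disjoint_tuples S I r. of_bool ((\<Union>x\<in>set xs. S x) \<subseteq> R))" for R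
  proof -
    have eq: "disjoint_tuples S {x \<in> I. S x \<subseteq> R} r = {xs \<in> disjoint_tuples S I r. (\<Union>x\<in>set xs. S x) \<subseteq> R}"
      by (auto simp: disjoint_tuples_def)
    show ?thesis unfolding eq using finite_disjoint_tuples[OF I, of S r]
      by (simp add: of_bool_def sum.If_cases Collect_conj_eq)
  qed
  then have "Ebin n p (\<lambda>R. real (card (disjoint_tuples S {x \<in> I. S x \<subseteq> R} r)))
      = (\<Sum>xs\<in>disjoint_tuples S I r. Ebin n p (\<lambda>R. of_bool ((\<Union>x\<in>set xs. S x) \<subseteq> R)))"
    by (simp add: Ebin_sum)
  also have "\<dots> = (\<Sum>xs\<in>disjoint_tuples S I r. prod_list (map (\<lambda>x. p ^ card (S x)) xs))"
  proof (intro sum.cong refl)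
    fix xs assume "xs \<in> disjoint_tuples S I r"
    then have "sorted_wrt (\<lambda>x y. S x \<inter> S y = {}) xs" "set xs \<subseteq> I" by (auto simp: disjoint_tuples_def)
    moreover have "(\<Union>x\<in>set xs. S x) \<subseteq> {1..n}" using S calculation(2) by blast
    ultimately show "Ebin n p (\<lambda>R. of_bool ((\<Union>x\<in>set xs. S x) \<subseteq> R)) = prod_list (map (\<lambda>x. p ^ card (S x)) xs)"
      using p fS by (subst Ebin_of_subset) (auto simp: power_card_UN_disjoint_tuples subset_iff)
  qed
  also have "\<dots> \<le> (\<Sum>x\<in>I. p ^ card (S x)) ^ r"
    using p by (intro sum_prod_list_disjoint_tuples_le I) auto
  finally show ?thesis .
qed

lemma prob_disjoint_tuples_nonempty:
  assumes p: "0 < p" "p \<le> 1" and I: "finite I" and S: "\<And>x. x \<in> I \<Longrightarrow> S x \<subseteq> {1..n}"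
  shows "Ebin n p (\<lambda>R. of_bool (disjoint_tuples S {x \<in> I. S x \<subseteq> R} r \<noteq> {})) \<le> (\<Sum>x\<in>I. p ^ card (S x)) ^ r"
proof -
  have "Ebin n p (\<lambda>R. of_bool (disjoint_tuples S {x \<in> I. S x \<subseteq> R} r \<noteq> {}))
      \<le> Ebin n p (\<lambda>R. real (card (disjoint_tuples S {x \<in> I. S x \<subseteq> R} r))) / 1"
  proof (intro Ebin_markov)
    fix R assume "disjoint_tuples S {x \<in> I. S x \<subseteq> R} r \<noteq> {}"
    then have "card (disjoint_tuples S {x \<in> I. S x \<subseteq> R} r) \<noteq> 0" using I by (simp add: finite_disjoint_tuples)
    then show "1 \<le> real (card (disjoint_tuples S {x \<in> I. S x \<subseteq> R} r))" by linarith
  qed (use p in auto)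
  also have "\<dots> \<le> (\<Sum>x\<in>I. p ^ card (S x)) ^ r"
    using Ebin_disjoint_tuples_le[of p I S n r] p I S by simp
  finally show ?thesis .
qed

text \<open>The subfamily \<open>J\<close> is existentially quantified so that edges may be deleted
  in a way that depends on the random set. \<open>D\<close> bounds the maximal and \<open>C\<close>
  the average conflict degree within \<open>J\<close>.\<close>

definition many_sparse :: "('i \<Rightarrow> nat set) \<Rightarrow> 'i set \<Rightarrow> real \<Rightarrow> real \<Rightarrow> real \<Rightarrow> bool" where
  "many_sparse S I z D C \<longleftrightarrow> (\<exists>J\<subseteq>I. z \<le> real (card J) \<and>
     (\<forall>x\<in>J. real (card (conflicts S J x)) \<le> D) \<and>
     (\<Sum>x\<in>J. real (card (conflicts S J x))) \<le> C * real (card J))"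

text \<open>Disjoint tuples of \<open>J\<close> are disjoint tuples of the whole family inside
  \<open>R\<close>. One first moment therefore treats every choice of \<open>J\<close> at once, and
  no union bound over subfamilies is paid.\<close>

lemma prob_many_sparse_le:
  assumes p: "0 < p" "p \<le> 1" and I: "finite I" and S: "\<And>x. x \<in> I \<Longrightarrow> S x \<subseteq> {1..n}" and z: "0 < z"
    and iD: "\<And>i. i < r \<Longrightarrow> 2 * (real i * D) \<le> z"
    and iC: "\<And>i. i < r \<Longrightarrow> 2 * C * real i \<le> w" and w: "0 \<le> w" "w < z"
  shows "Ebin n p (\<lambda>R. of_bool (many_sparse S {x \<in> I. S x \<subseteq> R} z D C))
    \<le> ((\<Sum>x\<in>I. p ^ card (S x)) / (z - w)) ^ r"
proof -
  have "Ebin n p (\<lambda>R. of_bool (many_sparse S {x \<in> I. S x \<subseteq> R} z D C))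
      \<le> Ebin n p (\<lambda>R. real (card (disjoint_tuples S {x \<in> I. S x \<subseteq> R} r))) / (z - w) ^ r"
  proof (intro Ebin_markov)
    fix R assume "many_sparse S {x \<in> I. S x \<subseteq> R} z D C"
    then obtain J where J: "J \<subseteq> {x \<in> I. S x \<subseteq> R}" "z \<le> real (card J)"
      "\<forall>x\<in>J. real (card (conflicts S J x)) \<le> D"
      "(\<Sum>x\<in>J. real (card (conflicts S J x))) \<le> C * real (card J)"
      by (auto simp: many_sparse_def)
    have fJ: "finite J" using J(1) I by (auto intro: finite_subset)
    have "(z - w) ^ r \<le> real (card (disjoint_tuples S J r))"
      using J z w iD iC by (intro card_disjoint_tuples_ge[where C = C and D = D] fJ) auto
    also have "\<dots> \<le> real (card (disjoint_tuples S {x \<in> I. S x \<subseteq> R} r))"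
      using J(1) I by (intro of_nat_mono card_mono finite_disjoint_tuples) (auto simp: disjoint_tuples_def)
    finally show "(z - w) ^ r \<le> real (card (disjoint_tuples S {x \<in> I. S x \<subseteq> R} r))" .
  qed (use p w in auto)
  also have "\<dots> \<le> (\<Sum>x\<in>I. p ^ card (S x)) ^ r / (z - w) ^ r"
    using w by (intro divide_right_mono Ebin_disjoint_tuples_le p I S) auto
  finally show ?thesis by (simp add: power_divide)
qed

section \<open>Almost linear hypergraphs and arithmetic progressions\<close>

text \<open>Apart from the number of edges inside initial intervals, progressions enter only through
  these counts: order n^2 edges, at most k n through one element, at most k^2 through two. The
  constant in \<open>H_lower\<close> is that of \<open>card_arith_progs_ge\<close>.\<close>

locale almost_linear =
  fixes n k :: nat and H :: "nat set set"
  assumes k3: "3 \<le> k" and n1: "1 \<le> n"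
    and H_sub: "A \<in> H \<Longrightarrow> A \<subseteq> {1..n}"
    and H_card: "A \<in> H \<Longrightarrow> card A = k"
    and degree: "card {A \<in> H. x \<in> A} \<le> k * n"
    and codegree: "x \<noteq> y \<Longrightarrow> card {A \<in> H. x \<in> A \<and> y \<in> A} \<le> k\<^sup>2"
    and H_upper: "card H \<le> n\<^sup>2"
    and H_lower: "(real n)\<^sup>2 \<le> 16 * real k * real (card H)"
begin

lemma finite_H: "finite H"
  by (rule finite_subset[of _ "Pow {1..n}"]) (use H_sub in auto)

lemma k3_real: "3 \<le> real k"
  using k3 by simp

lemma p_pow_k: "(p :: real) ^ k = p * p ^ (k - 1)"
  using k3 by (simp flip: power_Suc)

lemma finite_edge: "A \<in> H \<Longrightarrow> finite A"
  using H_sub finite_subset by blast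

definition X :: "nat set set \<Rightarrow> nat set \<Rightarrow> real" where
  "X G S = real (card {A \<in> G. A \<subseteq> S})"

definition mu :: "real \<Rightarrow> real" where
  "mu p = real (card H) * p ^ k"

text \<open>The sum of covariances over ordered pairs of edges; disjoint pairs contribute 0 because
  their union has 2 k elements. Subfamilies are allowed because the planted lower bound needs the
  variance of the edges not inside the planted set.\<close>

definition vr :: "real \<Rightarrow> nat set set \<Rightarrow> real" where
  "vr p G = (\<Sum>A\<in>G. \<Sum>B\<in>G. p ^ card (A \<union> B) - p ^ (2 * k))"

lemma card_H_pos: "0 < card H"
proof -
  have "0 < (real n)\<^sup>2" using n1 by simp
  then have "0 < 16 * real k * real (card H)" using H_lower by linarith
  then show ?thesis by (simp add: zero_less_mult_iff)
qed

lemma mu_pos: "0 < p \<Longrightarrow> 0 < mu p"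
  using card_H_pos by (simp add: mu_def)

lemma mu_le: "0 < p \<Longrightarrow> mu p \<le> (real n)\<^sup>2 * p ^ k"
  unfolding mu_def using H_upper
  by (intro mult_right_mono) (auto simp flip: of_nat_power)

lemma mu_ge: "0 < p \<Longrightarrow> (real n)\<^sup>2 * p ^ k \<le> 16 * real k * mu p"
  unfolding mu_def using H_lower mult_right_mono[of _ _ "p ^ k"] by (simp add: mult.assoc)

lemma card_meet1:
  assumes "finite W"
  shows "card {B \<in> H. B \<inter> W \<noteq> {}} \<le> card W * (k * n)"
proof -
  have "{B \<in> H. B \<inter> W \<noteq> {}} = (\<Union>x\<in>W. {B \<in> H. x \<in> B})" by auto
  then have "card {B \<in> H. B \<inter> W \<noteq> {}} \<le> (\<Sum>x\<in>W. card {B \<in> H. x \<in> B})"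
    using card_UN_le[OF assms, of "\<lambda>x. {B \<in> H. x \<in> B}"] by simp
  also have "\<dots> \<le> (\<Sum>x\<in>W. k * n)" by (intro sum_mono degree)
  finally show ?thesis by simp
qed

lemma card_meet2:
  assumes "finite W"
  shows "card {B \<in> H. 2 \<le> card (B \<inter> W)} \<le> (card W)\<^sup>2 * k\<^sup>2"
proof -
  let ?P = "{q \<in> W \<times> W. fst q \<noteq> snd q}"
  have "{B \<in> H. 2 \<le> card (B \<inter> W)} \<subseteq> (\<Union>q\<in>?P. {B \<in> H. fst q \<in> B \<and> snd q \<in> B})"
  proof
    fix B assume B: "B \<in> {B \<in> H. 2 \<le> card (B \<inter> W)}"
    then have "finite (B \<inter> W)" "\<not> card (B \<inter> W) \<le> Suc 0" using assms by auto
    then obtain x y where "x \<in> B \<inter> W" "y \<in> B \<inter> W" "x \<noteq> y" by (auto simp: card_le_Suc0_iff_eq)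
    then show "B \<in> (\<Union>q\<in>?P. {B \<in> H. fst q \<in> B \<and> snd q \<in> B})" using B
      by (intro UN_I[of "(x, y)"]) auto
  qed
  then have "card {B \<in> H. 2 \<le> card (B \<inter> W)} \<le> card (\<Union>q\<in>?P. {B \<in> H. fst q \<in> B \<and> snd q \<in> B})"
    using assms finite_H by (intro card_mono) auto
  also have "\<dots> \<le> (\<Sum>q\<in>?P. card {B \<in> H. fst q \<in> B \<and> snd q \<in> B})"
    using assms by (intro card_UN_le) auto
  also have "\<dots> \<le> (\<Sum>q\<in>?P. k\<^sup>2)" by (intro sum_mono codegree) auto
  also have "\<dots> = card ?P * k\<^sup>2" by simp
  also have "\<dots> \<le> card (W \<times> W) * k\<^sup>2" using assms by (intro mult_right_mono card_mono) auto
  finally show ?thesis by (simp add: card_cartesian_product power2_eq_square)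
qed

lemma X_eq_sum: "finite G \<Longrightarrow> X G S = (\<Sum>A\<in>G. of_bool (A \<subseteq> S))"
  unfolding X_def by (simp add: of_bool_def sum.If_cases Collect_conj_eq)

lemma Ebin_X:
  assumes "0 < p" "p \<le> 1" "G \<subseteq> H"
  shows "Ebin n p (X G) = real (card G) * p ^ k"
proof -
  have "finite G" using assms finite_H finite_subset by blast
  then have "X G = (\<lambda>S. \<Sum>A\<in>G. of_bool (A \<subseteq> S))" using X_eq_sum by blast
  then have "Ebin n p (X G) = (\<Sum>A\<in>G. Ebin n p (\<lambda>S. of_bool (A \<subseteq> S)))"
    by (simp only: Ebin_sum)
  also have "\<dots> = (\<Sum>A\<in>G. p ^ k)"
    using assms H_sub H_card by (intro sum.cong refl) (subst Ebin_of_subset, auto)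
  finally show ?thesis by simp
qed

lemma Ebin_X_variance:
  assumes p: "0 < p" "p \<le> 1" and G: "G \<subseteq> H"
  shows "Ebin n p (\<lambda>S. (X G S - real (card G) * p ^ k)\<^sup>2) = vr p G"
proof -
  let ?m = "real (card G) * p ^ k"
  have fin: "finite G" using G finite_H finite_subset by blast
  have XX: "X G S * X G S = (\<Sum>A\<in>G. \<Sum>B\<in>G. of_bool (A \<union> B \<subseteq> S))" for S
    unfolding X_eq_sum[OF fin] sum_product by (intro sum.cong refl) auto
  have "Ebin n p (\<lambda>S. X G S * X G S) = (\<Sum>A\<in>G. \<Sum>B\<in>G. Ebin n p (\<lambda>S. of_bool (A \<union> B \<subseteq> S)))"
    unfolding XX by (simp add: Ebin_sum)
  also have "\<dots> = (\<Sum>A\<in>G. \<Sum>B\<in>G. p ^ card (A \<union> B))"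
  proof (intro sum.cong refl Ebin_of_subset p)
    fix A B assume "A \<in> G" "B \<in> G"
    then show "A \<union> B \<subseteq> {1..n}" using G H_sub by (meson Un_least subsetD)
  qed
  finally have E2: "Ebin n p (\<lambda>S. X G S * X G S) = (\<Sum>A\<in>G. \<Sum>B\<in>G. p ^ card (A \<union> B))" .
  have "Ebin n p (\<lambda>S. (X G S - ?m)\<^sup>2) = Ebin n p (\<lambda>S. X G S * X G S + ((- 2 * ?m) * X G S + ?m\<^sup>2))"
    by (intro Ebin_cong) (simp add: power2_eq_square algebra_simps)
  also have "\<dots> = Ebin n p (\<lambda>S. X G S * X G S) + ((- 2 * ?m) * ?m + ?m\<^sup>2)"
    unfolding Ebin_add Ebin_cmult using p G by (simp add: Ebin_X Ebin_const)
  also have "\<dots> = (\<Sum>A\<in>G. \<Sum>B\<in>G. p ^ card (A \<union> B)) - real (card G) * (real (card G) * p ^ (2 * k))"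
  proof -
    have "p ^ (2 * k) = p ^ k * p ^ k" by (simp only: mult_2 power_add)
    then show ?thesis unfolding E2 by (simp add: power2_eq_square)
  qed
  also have "\<dots> = vr p G"
    unfolding vr_def sum_subtractf by simp
  finally show ?thesis .
qed

lemma card_Un_edges:
  assumes "A \<in> H" "B \<in> H"
  shows "card (A \<union> B) + card (A \<inter> B) = 2 * k"
  using card_Un_Int[of A B] assms finite_edge H_card by simp

lemma vr_term_nonneg:
  fixes p :: real
  assumes "0 < p" "p \<le> 1" "A \<in> H" "B \<in> H"
  shows "0 \<le> p ^ card (A \<union> B) - p ^ (2 * k)"
  using power_decreasing[of "card (A \<union> B)" "2 * k" p] card_Un_edges[OF assms(3,4)] assms by simp

lemma vr_mono:
  assumes "0 < p" "p \<le> 1" "G \<subseteq> H"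
  shows "vr p G \<le> vr p H"
  unfolding vr_def
proof -
  have "(\<Sum>A\<in>G. \<Sum>B\<in>G. p ^ card (A \<union> B) - p ^ (2 * k)) \<le> (\<Sum>A\<in>G. \<Sum>B\<in>H. p ^ card (A \<union> B) - p ^ (2 * k))"
    using assms finite_H vr_term_nonneg by (intro sum_mono sum_mono2) blast+
  also have "\<dots> \<le> (\<Sum>A\<in>H. \<Sum>B\<in>H. p ^ card (A \<union> B) - p ^ (2 * k))"
    using assms finite_H vr_term_nonneg by (intro sum_mono2 sum_nonneg) blast+
  finally show "(\<Sum>A\<in>G. \<Sum>B\<in>G. p ^ card (A \<union> B) - p ^ (2 * k)) \<le> (\<Sum>A\<in>H. \<Sum>B\<in>H. p ^ card (A \<union> B) - p ^ (2 * k))" .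
qed

lemma vr_ge_mu:
  assumes p: "0 < p" "p \<le> 1"
  shows "(1 - p) * mu p \<le> vr p H"
proof -
  have "(1 - p) * mu p = (\<Sum>A\<in>H. (1 - p) * p ^ k)" by (simp add: mu_def)
  also have "\<dots> \<le> (\<Sum>A\<in>H. \<Sum>B\<in>H. p ^ card (A \<union> B) - p ^ (2 * k))"
  proof (intro sum_mono)
    fix A assume A: "A \<in> H"
    have "p ^ k \<le> p ^ 1" using p k3 by (intro power_decreasing) auto
    then have "(1 - p) * p ^ k \<le> (1 - p ^ k) * p ^ k" using p by (intro mult_right_mono) auto
    also have "\<dots> = (\<Sum>B\<in>{A}. p ^ card (A \<union> B) - p ^ (2 * k))"
      using H_card[OF A] by (simp add: left_diff_distrib mult_2 flip: power_add)
    also have "\<dots> \<le> (\<Sum>B\<in>H. p ^ card (A \<union> B) - p ^ (2 * k))"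
      using A p finite_H vr_term_nonneg by (intro sum_mono2) auto
    finally show "(1 - p) * p ^ k \<le> (\<Sum>B\<in>H. p ^ card (A \<union> B) - p ^ (2 * k))" .
  qed
  finally show ?thesis by (simp add: vr_def)
qed

text \<open>By Cauchy-Schwarz for the degrees, at least |H|^2 / n ordered pairs of edges meet, and
  each contributes at least (1 - p) p^(2k-1). With the diagonal bound \<open>vr_ge_mu\<close> the
  variance is at least of order mu max(1, n p^(k-1)) while 1 - p stays away from 0.\<close>

lemma vr_ge_mu_sq:
  assumes p: "0 < p" "p \<le> 1"
  shows "(1 - p) * (mu p)\<^sup>2 / (real n * p) \<le> vr p H"
proof -
  define d where "d x = (\<Sum>A\<in>H. of_bool (x \<in> A) :: real)" for x :: nat
  have sum_d: "(\<Sum>x\<in>{1..n}. d x) = real k * real (card H)"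
  proof -
    have "(\<Sum>x\<in>{1..n}. d x) = (\<Sum>A\<in>H. \<Sum>x\<in>{1..n}. of_bool (x \<in> A))"
      unfolding d_def by (rule sum.swap)
    also have "\<dots> = (\<Sum>A\<in>H. real k)"
    proof (intro sum.cong refl)
      fix A assume A: "A \<in> H"
      have "(\<Sum>x\<in>{1..n}. of_bool (x \<in> A)) = real (card ({1..n} \<inter> A))"
        by (simp add: of_bool_def sum.If_cases)
      also have "{1..n} \<inter> A = A" using H_sub[OF A] by auto
      finally show "(\<Sum>x\<in>{1..n}. of_bool (x \<in> A)) = real k" using H_card[OF A] by simp
    qed
    finally show ?thesis by simp
  qed
  have "(real k * real (card H))\<^sup>2 \<le> real n * (\<Sum>x\<in>{1..n}. (d x)\<^sup>2)"
    using Cauchy_Schwarz_ineq_sum[of "\<lambda>_. 1" d "{1..n}"] sum_d by simp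
  also have "(\<Sum>x\<in>{1..n}. (d x)\<^sup>2) = (\<Sum>A\<in>H. \<Sum>B\<in>H. \<Sum>x\<in>{1..n}. of_bool (x \<in> A) * of_bool (x \<in> B))"
    unfolding d_def power2_eq_square sum_product
    by (subst sum.swap, intro sum.cong refl, rule sum.swap)
  also have "\<dots> \<le> (\<Sum>A\<in>H. \<Sum>B\<in>H. real k * of_bool (A \<inter> B \<noteq> {}))"
  proof (intro sum_mono)
    fix A B assume A: "A \<in> H" "B \<in> H"
    have "(\<Sum>x\<in>{1..n}. of_bool (x \<in> A) * of_bool (x \<in> B) :: real) = (\<Sum>x\<in>{1..n}. of_bool (x \<in> A \<inter> B))"
      by (intro sum.cong) auto
    also have "\<dots> = real (card ({1..n} \<inter> (A \<inter> B)))"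
      by (simp add: of_bool_def sum.If_cases Int_def)
    also have "\<dots> \<le> real k * of_bool (A \<inter> B \<noteq> {})"
    proof (cases "A \<inter> B = {}")
      case False
      have "card ({1..n} \<inter> (A \<inter> B)) \<le> card A" using A finite_edge by (intro card_mono) auto
      then show ?thesis using False H_card A by simp
    qed simp
    finally show "(\<Sum>x\<in>{1..n}. of_bool (x \<in> A) * of_bool (x \<in> B) :: real) \<le> real k * of_bool (A \<inter> B \<noteq> {})" .
  qed
  finally have cs: "(real k * real (card H))\<^sup>2 \<le> real n * (\<Sum>A\<in>H. \<Sum>B\<in>H. real k * of_bool (A \<inter> B \<noteq> {}))"
    by (simp add: mult_left_mono)
  define M where "M = (\<Sum>A\<in>H. \<Sum>B\<in>H. of_bool (A \<inter> B \<noteq> {}) :: real)"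
  have "(real k)\<^sup>2 * (real (card H))\<^sup>2 \<le> real n * (real k * M)"
    using cs by (simp add: M_def sum_distrib_left power_mult_distrib)
  then have "real k * (real k * (real (card H))\<^sup>2) \<le> real k * (real n * M)"
    by (simp add: power2_eq_square algebra_simps)
  then have "real k * (real (card H))\<^sup>2 \<le> real n * M"
    by (rule mult_left_le_imp_le) (use k3 in simp)
  moreover have "1 * (real (card H))\<^sup>2 \<le> real k * (real (card H))\<^sup>2" using k3 by (intro mult_right_mono) auto
  ultimately have M: "(real (card H))\<^sup>2 \<le> real n * M" by simp
  have "(1 - p) * (p ^ (2 * k - 1) * M) \<le> vr p H"
    unfolding vr_def M_def sum_distrib_left
  proof (intro sum_mono)
    fix A B assume A: "A \<in> H" "B \<in> H"
    show "(1 - p) * (p ^ (2 * k - 1) * of_bool (A \<inter> B \<noteq> {})) \<le> p ^ card (A \<union> B) - p ^ (2 * k)"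
    proof (cases "A \<inter> B = {}")
      case False
      then have "0 < card (A \<inter> B)" using A finite_edge by (simp add: card_gt_0_iff)
      then have "card (A \<union> B) \<le> 2 * k - 1" using card_Un_edges[OF A] by simp
      then have "p ^ (2 * k - 1) \<le> p ^ card (A \<union> B)" using p by (intro power_decreasing) auto
      moreover have "p ^ (2 * k) = p * p ^ (2 * k - 1)" using k3 by (cases k) auto
      ultimately show ?thesis using False by (simp add: algebra_simps)
    qed (use vr_term_nonneg[OF p A] in simp)
  qed
  moreover have "(1 - p) * (mu p)\<^sup>2 / (real n * p) \<le> (1 - p) * (p ^ (2 * k - 1) * M)"
  proof -
    have "(mu p)\<^sup>2 = p * p ^ (2 * k - 1) * (real (card H))\<^sup>2"
    proof -
      have "p * p ^ (2 * k - 1) = p ^ (2 * k)" using k3 by (simp flip: power_Suc)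
      also have "\<dots> = (p ^ k)\<^sup>2" by (simp add: power_mult[symmetric] mult.commute)
      finally show ?thesis by (simp add: mu_def power_mult_distrib)
    qed
    also have "\<dots> \<le> p * p ^ (2 * k - 1) * (real n * M)" using M p by (intro mult_left_mono) auto
    also have "\<dots> = (p ^ (2 * k - 1) * M) * (real n * p)" by simp
    finally have "(mu p)\<^sup>2 / (real n * p) \<le> p ^ (2 * k - 1) * M"
      using p n1 by (subst pos_divide_le_eq) auto
    then have "(1 - p) * ((mu p)\<^sup>2 / (real n * p)) \<le> (1 - p) * (p ^ (2 * k - 1) * M)"
      using p by (intro mult_left_mono) auto
    then show ?thesis by simp
  qed
  ultimately show ?thesis by linarith
qed

text \<open>For a fixed edge, the at most k^2 n edges meeting it in one element contribute at most
  p^(2k-1) each, and the at most k^4 edges sharing two or more elements contribute at most p^k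
  each.\<close>

lemma vr_le:
  assumes p: "0 < p" "p \<le> 1"
  shows "vr p H \<le> real k ^ 4 * mu p * (1 + real n * p ^ (k - 1))"
proof -
  have "vr p H \<le> (\<Sum>A\<in>H. real k ^ 4 * (real n * p ^ (2 * k - 1)) + real k ^ 4 * p ^ k)"
    unfolding vr_def
  proof (intro sum_mono)
    fix A assume A: "A \<in> H"
    have "(\<Sum>B\<in>H. p ^ card (A \<union> B) - p ^ (2 * k))
        \<le> (\<Sum>B\<in>H. p ^ (2 * k - 1) * of_bool (B \<inter> A \<noteq> {}) + p ^ k * of_bool (2 \<le> card (B \<inter> A)))"
    proof (intro sum_mono)
      fix B assume B: "B \<in> H"
      have un: "card (A \<union> B) + card (B \<inter> A) = 2 * k" using card_Un_edges[OF A B] by (simp add: Int_commute)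
      have pk: "0 \<le> p ^ (2 * k)" "0 \<le> p ^ (2 * k - 1)" using p by auto
      consider "card (B \<inter> A) = 0" | "card (B \<inter> A) = 1" | "2 \<le> card (B \<inter> A)" by linarith
      then show "p ^ card (A \<union> B) - p ^ (2 * k)
        \<le> p ^ (2 * k - 1) * of_bool (B \<inter> A \<noteq> {}) + p ^ k * of_bool (2 \<le> card (B \<inter> A))"
      proof cases
        case 2
        then have "card (A \<union> B) = 2 * k - 1" "B \<inter> A \<noteq> {}" using un by auto
        then show ?thesis using 2 pk by simp
      next
        case 3
        have "card A \<le> card (A \<union> B)" using A B finite_edge by (intro card_mono) auto
        then have "p ^ card (A \<union> B) \<le> p ^ k" using p H_card[OF A] by (intro power_decreasing) auto
        then have "p ^ card (A \<union> B) - p ^ (2 * k) \<le> p ^ k" using pk by linarith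
        also have "\<dots> \<le> p ^ (2 * k - 1) * of_bool (B \<inter> A \<noteq> {}) + p ^ k * of_bool (2 \<le> card (B \<inter> A))"
          using 3 pk by simp
        finally show ?thesis .
      qed (use un pk in auto)
    qed
    also have "\<dots> = p ^ (2 * k - 1) * real (card {B \<in> H. B \<inter> A \<noteq> {}})
        + p ^ k * real (card {B \<in> H. 2 \<le> card (B \<inter> A)})"
      using finite_H by (simp add: sum.distrib sum_distrib_left[symmetric] of_bool_def sum.If_cases Collect_conj_eq)
    also have "\<dots> \<le> p ^ (2 * k - 1) * (real k ^ 4 * real n) + p ^ k * real k ^ 4"
    proof (intro add_mono mult_left_mono)
      have "card {B \<in> H. B \<inter> A \<noteq> {}} \<le> k * (k * n)"
        using card_meet1[OF finite_edge[OF A]] H_card[OF A] by simp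
      also have "\<dots> = k ^ 2 * n" by (simp add: power2_eq_square)
      also have "\<dots> \<le> k ^ 4 * n" using k3 by (intro mult_right_mono power_increasing) auto
      finally have "real (card {B \<in> H. B \<inter> A \<noteq> {}}) \<le> real (k ^ 4 * n)" unfolding of_nat_le_iff .
      then show "real (card {B \<in> H. B \<inter> A \<noteq> {}}) \<le> real k ^ 4 * real n"
        by (simp only: of_nat_mult of_nat_power)
      have "card {B \<in> H. 2 \<le> card (B \<inter> A)} \<le> k\<^sup>2 * k\<^sup>2"
        using card_meet2[OF finite_edge[OF A]] H_card[OF A] by simp
      also have "\<dots> = k ^ 4" by (simp flip: power_add)
      finally have "real (card {B \<in> H. 2 \<le> card (B \<inter> A)}) \<le> real (k ^ 4)" unfolding of_nat_le_iff .
      then show "real (card {B \<in> H. 2 \<le> card (B \<inter> A)}) \<le> real k ^ 4"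
        by (simp only: of_nat_power)
    qed (use p in auto)
    finally show "(\<Sum>B\<in>H. p ^ card (A \<union> B) - p ^ (2 * k))
      \<le> real k ^ 4 * (real n * p ^ (2 * k - 1)) + real k ^ 4 * p ^ k" by (simp add: mult_ac)
  qed
  also have "\<dots> = real k ^ 4 * mu p * (1 + real n * p ^ (k - 1))"
  proof -
    have "2 * k - 1 = k + (k - 1)" using k3 by simp
    then have "p ^ (2 * k - 1) = p ^ k * p ^ (k - 1)" by (simp only: power_add)
    then show ?thesis by (simp add: mu_def algebra_simps)
  qed
  finally show ?thesis .
qed

end

section \<open>Degrees, codegrees and the number of arithmetic progressions\<close>

lemma AP_pos_diff:
  assumes "A = (\<lambda>i. a + i * d) ` {..<k}" "card A = k" "2 \<le> k"
  shows "1 \<le> (d::nat)"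
proof (rule ccontr)
  assume "\<not> 1 \<le> d"
  then have "A \<subseteq> {a}" using assms(1) by auto
  then have "card A \<le> 1" using card_mono[of "{a}" A] by simp
  then show False using assms by simp
qed

lemma card_AP:
  assumes "1 \<le> (d::nat)"
  shows "card ((\<lambda>i. a + i * d) ` {..<k}) = k"
  using assms by (subst card_image) (auto simp: inj_on_def)

lemma arith_progs_deg:
  assumes k: "2 \<le> k"
  shows "card {A \<in> arith_progs k {1..n}. x \<in> A} \<le> k * n"
proof -
  \<comment> \<open>A progression through \<open>x\<close> is recovered from the position of
    \<open>x\<close> and the difference. The truncated subtraction is exact there, since
    \<open>x\<close> equals the first term plus \<open>i * d\<close>.\<close>
  let ?f = "\<lambda>(i, d). (\<lambda>j. (x - i * d) + j * d) ` {..<k}"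
  have "{A \<in> arith_progs k {1..n}. x \<in> A} \<subseteq> ?f ` ({..<k} \<times> {1..n})"
  proof
    fix A assume "A \<in> {A \<in> arith_progs k {1..n}. x \<in> A}"
    then obtain a d where A: "A \<subseteq> {1..n}" "card A = k" "A = (\<lambda>i. a + i * d) ` {..<k}" "x \<in> A"
      by (auto simp: arith_progs_def)
    have d: "1 \<le> d" using AP_pos_diff[OF A(3,2) k] .
    have "a + 1 * d \<in> A" unfolding A(3) using k by (intro imageI) auto
    then have dn: "d \<le> n" using A(1) by auto
    obtain i where i: "i < k" "x = a + i * d" using A(3,4) by auto
    have "A = ?f (i, d)" unfolding A(3) using i by simp
    moreover have "(i, d) \<in> {..<k} \<times> {1..n}" using i d dn by auto
    ultimately show "A \<in> ?f ` ({..<k} \<times> {1..n})" by (rule image_eqI)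
  qed
  then have "card {A \<in> arith_progs k {1..n}. x \<in> A} \<le> card (?f ` ({..<k} \<times> {1..n}))"
    by (intro card_mono) auto
  also have "\<dots> \<le> card ({..<k} \<times> {1..n})" by (intro card_image_le) auto
  finally show ?thesis by simp
qed

lemma arith_progs_codeg:
  assumes xy: "x \<noteq> y"
  shows "card {A \<in> arith_progs k {1..n}. x \<in> A \<and> y \<in> A} \<le> k\<^sup>2"
proof -
  \<comment> \<open>The positions of \<open>x\<close> and \<open>y\<close> determine the difference.
    The quotient is taken over the integers because either element may come first; at the true
    positions it is exact.\<close>
  let ?d = "\<lambda>i j. nat ((int y - int x) div (int j - int i))"
  let ?f = "\<lambda>(i, j). (\<lambda>l. (x - i * ?d i j) + l * ?d i j) ` {..<k}"
  have "{A \<in> arith_progs k {1..n}. x \<in> A \<and> y \<in> A} \<subseteq> ?f ` ({..<k} \<times> {..<k})"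
  proof
    fix A assume "A \<in> {A \<in> arith_progs k {1..n}. x \<in> A \<and> y \<in> A}"
    then obtain a d where A: "A = (\<lambda>i. a + i * d) ` {..<k}" "x \<in> A" "y \<in> A"
      by (auto simp: arith_progs_def)
    obtain i where i: "i < k" "x = a + i * d" using A by auto
    obtain j where j: "j < k" "y = a + j * d" using A by auto
    have "int y - int x = (int j - int i) * int d" using i j by (simp add: algebra_simps)
    moreover have "int j - int i \<noteq> 0" using xy i j by auto
    ultimately have "?d i j = d" by simp
    then have "A = ?f (i, j)" unfolding A(1) using i by simp
    moreover have "(i, j) \<in> {..<k} \<times> {..<k}" using i j by auto
    ultimately show "A \<in> ?f ` ({..<k} \<times> {..<k})" by (rule image_eqI)
  qed
  then have "card {A \<in> arith_progs k {1..n}. x \<in> A \<and> y \<in> A} \<le> card (?f ` ({..<k} \<times> {..<k}))"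
    by (intro card_mono) auto
  also have "\<dots> \<le> card ({..<k} \<times> {..<k})" by (intro card_image_le) auto
  finally show ?thesis by (simp add: power2_eq_square)
qed

lemma card_arith_progs_le:
  assumes k: "2 \<le> k"
  shows "card (arith_progs k {1..n}) \<le> n\<^sup>2"
proof -
  let ?f = "\<lambda>(a, d). (\<lambda>i. a + i * d) ` {..<k}"
  have "arith_progs k {1..n} \<subseteq> ?f ` ({1..n} \<times> {1..n})"
  proof
    fix A assume "A \<in> arith_progs k {1..n}"
    then obtain a d where A: "A \<subseteq> {1..n}" "card A = k" "A = (\<lambda>i. a + i * d) ` {..<k}"
      by (auto simp: arith_progs_def)
    have d: "1 \<le> d" using AP_pos_diff[OF A(3,2) k] .
    have "a + 1 * d \<in> A" "a + 0 * d \<in> A" unfolding A(3) using k by (intro imageI; auto)+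
    then have "a \<in> {1..n}" "d \<in> {1..n}" using A(1) d by auto
    then have "(a, d) \<in> {1..n} \<times> {1..n}" by simp
    moreover have "A = ?f (a, d)" using A(3) by simp
    ultimately show "A \<in> ?f ` ({1..n} \<times> {1..n})" by (rule image_eqI[rotated])
  qed
  then have "card (arith_progs k {1..n}) \<le> card (?f ` ({1..n} \<times> {1..n}))"
    by (intro card_mono) auto
  also have "\<dots> \<le> card ({1..n} \<times> {1..n})" by (intro card_image_le) auto
  finally show ?thesis by (simp add: power2_eq_square)
qed

text \<open>Starting points up to n/2 and differences up to n/(2 k) keep the progression inside
  \<open>{1..n}\<close>, and minimum and maximum recover both parameters. Rounding down loses a
  factor at most 2 in each coordinate because n is at least 4 k, hence 2 * 2 * 2 * 2k = 16
  k.\<close>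

lemma card_arith_progs_ge:
  assumes k: "2 \<le> k" and n: "4 * k \<le> n"
  shows "(real n)\<^sup>2 \<le> 16 * real k * real (card (arith_progs k {1..n}))"
proof -
  let ?f = "\<lambda>(a, d). (\<lambda>i. a + i * d) ` {..<k}"
  let ?D = "{1..n div 2} \<times> {1..n div (2 * k)}"
  have inj: "inj_on ?f ?D"
  proof (intro inj_onI)
    fix q q' assume q: "q \<in> ?D" "q' \<in> ?D" "?f q = ?f q'"
    obtain a d a' d' where e: "q = (a, d)" "q' = (a', d')" by (cases q; cases q')
    have mn: "Min ((\<lambda>i. a + i * d) ` {..<k}) = a" for a d :: nat
      using k by (intro Min_eqI) (auto intro!: image_eqI[of _ _ 0])
    have mx: "Max ((\<lambda>i. a + i * d) ` {..<k}) = a + (k - 1) * d" for a d :: nat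
    proof (intro Max_eqI)
      show "a + (k - 1) * d \<in> (\<lambda>i. a + i * d) ` {..<k}" using k by (intro imageI) auto
      fix y assume "y \<in> (\<lambda>i. a + i * d) ` {..<k}"
      then obtain i where "i < k" "y = a + i * d" by auto
      moreover have "i * d \<le> (k - 1) * d" using \<open>i < k\<close> by (intro mult_right_mono) auto
      ultimately show "y \<le> a + (k - 1) * d" by simp
    qed auto
    have eq: "(\<lambda>i. a + i * d) ` {..<k} = (\<lambda>i. a' + i * d') ` {..<k}" using q(3) e by simp
    have aa: "a = a'" using mn[of a d] mn[of a' d'] eq by simp
    have "a + (k - 1) * d = a' + (k - 1) * d'" using mx[of a d] mx[of a' d'] eq by simp
    then have "d = d'" using aa k by simp
    then show "q = q'" using aa e by simp
  qed
  have sub: "?f ` ?D \<subseteq> arith_progs k {1..n}"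
  proof
    fix A assume "A \<in> ?f ` ?D"
    then obtain a d where A: "A = (\<lambda>i. a + i * d) ` {..<k}" "1 \<le> a" "a \<le> n div 2" "1 \<le> d" "d \<le> n div (2 * k)"
      by auto
    have "2 * k * d \<le> n" using A(5) k by (simp add: less_eq_div_iff_mult_less_eq mult_ac)
    have "a + i * d \<le> n" if "i < k" for i
    proof -
      have "i * d \<le> k * d" using that by (intro mult_right_mono) auto
      then have "2 * (i * d) \<le> n" using \<open>2 * k * d \<le> n\<close> by linarith
      then show ?thesis using A(3) by linarith
    qed
    then have "A \<subseteq> {1..n}" using A(1,2) by auto
    then show "A \<in> arith_progs k {1..n}" using card_AP[OF A(4)] A(1) by (auto simp: arith_progs_def)
  qed
  have fin: "finite (arith_progs k {1..n})"
    by (rule finite_subset[of _ "Pow {1..n}"]) (auto simp: arith_progs_def)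
  have "card ?D = card (?f ` ?D)" using inj by (simp add: card_image)
  also have "\<dots> \<le> card (arith_progs k {1..n})" using sub fin by (rule card_mono[rotated])
  finally have c: "real (n div 2) * real (n div (2 * k)) \<le> real (card (arith_progs k {1..n}))"
    by (simp flip: of_nat_mult)
  have dv: "real n \<le> 2 * real m * real (n div m)" if "0 < m" "2 * m \<le> n" for m
  proof -
    have "n < m * (n div m) + m" using that(1) by (metis mult_div_mod_eq nat_add_left_cancel_less mod_less_divisor)
    moreover have "m * 1 \<le> m * (n div m)" using that by (intro mult_left_mono) (auto simp: less_eq_div_iff_mult_less_eq)
    ultimately have "n \<le> 2 * (m * (n div m))" by linarith
    then have "n \<le> 2 * m * (n div m)" by simp
    then have "real n \<le> real (2 * m * (n div m))" unfolding of_nat_le_iff .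
    then show ?thesis by (simp only: of_nat_mult of_nat_numeral)
  qed
  have "real n * real n \<le> (2 * real 2 * real (n div 2)) * (2 * real (2 * k) * real (n div (2 * k)))"
    using dv[of 2] dv[of "2 * k"] k n by (intro mult_mono) auto
  also have "\<dots> = 16 * real k * (real (n div 2) * real (n div (2 * k)))" by simp
  also have "\<dots> \<le> 16 * real k * real (card (arith_progs k {1..n}))" using c by (intro mult_left_mono) auto
  finally show ?thesis by (simp add: power2_eq_square)
qed

lemma almost_linear_arith_progs:
  assumes "3 \<le> k" "4 * k \<le> n"
  shows "almost_linear n k (arith_progs k {1..n})"
  using assms arith_progs_deg[of k] arith_progs_codeg[of _ _ k] card_arith_progs_le[of k n] card_arith_progs_ge[of k n]
  by unfold_locales (auto simp: arith_progs_def)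

section \<open>Tail estimates for families with few conflicts\<close>

lemma phi_le_ln: "0 \<le> x \<Longrightarrow> phi x \<le> x * ln (1 + x)"
  using ln_add_one_self_le_self[of x] by (simp add: phi_def algebra_simps)

lemma phi_le_sq: "0 \<le> x \<Longrightarrow> phi x \<le> x\<^sup>2"
  using phi_le_ln[of x] mult_left_mono[OF ln_add_one_self_le_self[of x], of x]
  by (simp add: power2_eq_square)

text \<open>Both sides vanish at 0, and the derivative ln (1 + y) is at least y / (1 + y), which
  dominates the derivative of the other side. The single bound serves the quadratic range of small x
  and the linear range of large x.\<close>

lemma phi_ge:
  assumes "0 \<le> x"
  shows "x\<^sup>2 / (2 * (1 + x)) \<le> phi x"
proof -
  let ?g = "\<lambda>y. phi y - y\<^sup>2 / (2 * (1 + y))"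
  have "?g 0 \<le> ?g x"
  proof (rule DERIV_nonneg_imp_nondecreasing[OF assms])
    fix y :: real assume y: "0 \<le> y" "y \<le> x"
    have "(?g has_real_derivative (ln (1 + y) + 1 - 1) - (2 * y * (2 * (1 + y)) - y\<^sup>2 * 2) / (2 * (1 + y))\<^sup>2) (at y)"
      unfolding phi_def using y
      by (auto intro!: derivative_eq_intros simp: field_simps power2_eq_square)
    moreover have "(ln (1 + y) + 1 - 1) - (2 * y * (2 * (1 + y)) - y\<^sup>2 * 2) / (2 * (1 + y))\<^sup>2 \<ge> 0"
    proof -
      have "ln (1 / (1 + y)) \<le> 1 / (1 + y) - 1" using y by (intro ln_le_minus_one) auto
      then have l: "1 - 1 / (1 + y) \<le> ln (1 + y)" using y by (simp add: ln_div)
      have "(2 * y * (2 * (1 + y)) - y\<^sup>2 * 2) / (2 * (1 + y))\<^sup>2 \<le> 1 - 1 / (1 + y)"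
      proof -
        have "1 - 1 / (1 + y) = (2 * y * (2 * (1 + y))) / (2 * (1 + y))\<^sup>2"
          using y by (simp add: divide_simps) (simp add: power2_eq_square algebra_simps)
        moreover have "(2 * y * (2 * (1 + y)) - y\<^sup>2 * 2) / (2 * (1 + y))\<^sup>2 \<le> (2 * y * (2 * (1 + y))) / (2 * (1 + y))\<^sup>2"
          by (intro divide_right_mono) auto
        ultimately show ?thesis by linarith
      qed
      then show ?thesis using l by linarith
    qed
    ultimately show "\<exists>d. (?g has_real_derivative d) (at y) \<and> 0 \<le> d" by blast
  qed
  then show ?thesis by (simp add: phi_def)
qed

lemma phi_pos:
  assumes "0 < x"
  shows "0 < phi x"
proof -
  have "0 < x\<^sup>2 / (2 * (1 + x))" using assms by simp
  then show ?thesis using phi_ge[of x] assms by linarith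
qed

lemma phi_ge_small:
  assumes "0 \<le> x" "x \<le> 1"
  shows "x\<^sup>2 / 4 \<le> phi x"
proof -
  have "x\<^sup>2 / 4 \<le> x\<^sup>2 / (2 * (1 + x))" using assms by (intro divide_left_mono) auto
  then show ?thesis using phi_ge[of x] assms by linarith
qed

lemma phi_ge_large:
  assumes "1 \<le> x"
  shows "x / 4 \<le> phi x"
proof -
  have "x / 4 \<le> x\<^sup>2 / (2 * (1 + x))" using assms by (simp add: field_simps power2_eq_square)
  then show ?thesis using phi_ge[of x] assms by linarith
qed

lemma exp_minus_half_ge: "1 / 2 \<le> exp (- (1 / 2) :: real)"
  using exp_bound_half[of "1/2 :: real"] by (simp add: exp_minus field_simps)

lemma exp_2_ge: "4 \<le> exp (2 :: real)"
proof -
  have "(1 + 1 :: real) * (1 + 1) \<le> exp 1 * exp 1" using exp_ge_add_one_self[of 1] by (intro mult_mono) auto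
  then show ?thesis by (simp flip: exp_add)
qed

lemma sqrt_le_self: "1 \<le> x \<Longrightarrow> sqrt x \<le> x"
  by (intro real_le_lsqrt) (auto simp: power2_eq_square)

text \<open>One term of the exponential series gives m^m / m! \<le> e^m.\<close>

lemma choose_le_exp_pow:
  assumes "1 \<le> m"
  shows "real (N choose m) \<le> (exp 1 * real N / real m) ^ m"
proof -
  have "(\<lambda>j. real m ^ j /\<^sub>R fact j) sums exp (real m)" by (rule exp_converges)
  then have "summable (\<lambda>j. real m ^ j /\<^sub>R fact j)" "(\<Sum>j. real m ^ j /\<^sub>R fact j) = exp (real m)"
    by (auto simp: sums_iff)
  then have "(\<Sum>j\<in>{m}. real m ^ j /\<^sub>R fact j) \<le> exp (real m)"
    using sum_le_suminf[of "\<lambda>j. real m ^ j /\<^sub>R fact j" "{m}"] by auto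
  then have f: "real m ^ m \<le> exp 1 ^ m * fact m"
    by (simp add: field_simps exp_of_nat_mult[symmetric])
  have "real (N choose m) * fact m \<le> real N ^ m"
    using binomial_fact_pow[of N m] by (metis of_nat_fact of_nat_le_iff of_nat_mult of_nat_power)
  then have "real (N choose m) * real m ^ m * fact m \<le> (real N ^ m * exp 1 ^ m) * fact m"
    using mult_mono[OF _ f, of "real (N choose m) * fact m" "real N ^ m"] by (simp add: mult_ac)
  then have "real (N choose m) * real m ^ m \<le> real N ^ m * exp 1 ^ m"
    by (rule mult_right_le_imp_le) simp
  then have "real (N choose m) \<le> real N ^ m * exp 1 ^ m / real m ^ m"
    using assms by (simp add: pos_le_divide_eq)
  then show ?thesis by (simp add: power_divide power_mult_distrib mult_ac)
qed

text \<open>Giving each element the weight x, all subsets together weigh (1 + x)^n, while each small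
  one weighs at least x^v. The parameter x stays free; it is later taken so that n x is at most v,
  and a choice of V then costs about v log (1/x) in the exponent.\<close>

lemma card_small_subsets:
  fixes x v :: real
  assumes x: "0 < x" "x \<le> 1"
  shows "real (card {V. V \<subseteq> {1..n} \<and> real (card V) \<le> v}) \<le> exp (real n * x) * x powr (- v)"
proof -
  let ?F = "{V. V \<subseteq> {1..n} \<and> real (card V) \<le> v}"
  have "(\<Sum>V\<in>Pow {1..n}. x ^ card V) = (1 + x) ^ n"
    using prod_add[of "{1..n}" "\<lambda>_. x" "\<lambda>_. 1"] by (simp add: add.commute)
  also have "\<dots> \<le> exp x ^ n" using x exp_ge_add_one_self[of x] by (intro power_mono) auto
  also have "\<dots> = exp (real n * x)" by (simp add: exp_of_nat_mult)
  finally have s: "(\<Sum>V\<in>Pow {1..n}. x ^ card V) \<le> exp (real n * x)" .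
  have "real (card ?F) * x powr v = (\<Sum>V\<in>?F. x powr v)" by simp
  also have "\<dots> \<le> (\<Sum>V\<in>?F. x ^ card V)"
  proof (intro sum_mono)
    fix V assume "V \<in> ?F"
    then have "x powr v \<le> x powr (real (card V))" using x by (intro powr_mono') auto
    then show "x powr v \<le> x ^ card V" using x by (simp add: powr_realpow)
  qed
  also have "\<dots> \<le> (\<Sum>V\<in>Pow {1..n}. x ^ card V)" using x by (intro sum_mono2) auto
  finally have "real (card ?F) * x powr v \<le> exp (real n * x)" using s by simp
  then have "real (card ?F) * x powr v * x powr (- v) \<le> exp (real n * x) * x powr (- v)"
    by (intro mult_right_mono) auto
  then show ?thesis using x by (simp add: powr_minus field_simps)
qed

section \<open>Tail bounds for sparse families, for pairs of edges, and for edges meeting a fixed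
  set once\<close>

context almost_linear
begin

lemma sparse_tail:
  assumes p: "0 < p" "p \<le> 1" and e: "0 < \<epsilon>" and C: "0 < C"
    and D: "\<epsilon> * D \<le> 4 * C * (1 + \<epsilon> / 2)" "0 \<le> D"
  shows "Ebin n p (\<lambda>R. of_bool (many_sparse (\<lambda>A. A) {A \<in> H. A \<subseteq> R} ((1 + \<epsilon> / 2) * mu p) D C))
    \<le> exp (- (phi \<epsilon> * mu p / (32 * C)))"
proof -
  \<comment> \<open>The largest tuple length whose loss 2 C x is at most \<epsilon> mu / 4; the base
    of the tuple count then stays above (1 + \<epsilon>/4) mu.\<close>
  define x where "x = \<epsilon> * mu p / (8 * C)"
  define r where "r = nat \<lceil>x\<rceil>"
  have m: "0 < mu p" using mu_pos p by simp
  have x0: "0 < x" using m e C by (simp add: x_def)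
  have r: "x \<le> real r" "\<And>i. i < r \<Longrightarrow> real i \<le> x" using x0 unfolding r_def by linarith+
  have "Ebin n p (\<lambda>R. of_bool (many_sparse (\<lambda>A. A) {A \<in> H. A \<subseteq> R} ((1 + \<epsilon> / 2) * mu p) D C))
    \<le> ((\<Sum>A\<in>H. p ^ card A) / ((1 + \<epsilon> / 2) * mu p - \<epsilon> * mu p / 4)) ^ r"
  proof (intro prob_many_sparse_le p finite_H)
    fix i assume "i < r"
    then have i: "real i \<le> x" by (rule r(2))
    have "2 * (real i * D) \<le> 2 * (x * D)" using i D by (simp add: mult_right_mono)
    also have "\<dots> = (\<epsilon> * D) * mu p / (4 * C)" using C by (simp add: x_def field_simps)
    also have "\<dots> \<le> (4 * C * (1 + \<epsilon> / 2)) * mu p / (4 * C)"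
      using D m C by (intro divide_right_mono mult_right_mono) auto
    also have "\<dots> = (1 + \<epsilon> / 2) * mu p" using C by simp
    finally show "2 * (real i * D) \<le> (1 + \<epsilon> / 2) * mu p" .
    have "2 * C * real i \<le> 2 * C * x" using i C by simp
    then show "2 * C * real i \<le> \<epsilon> * mu p / 4" using C by (simp add: x_def)
  qed (use H_sub m e in \<open>auto simp: algebra_simps add_pos_pos\<close>)
  also have "(\<Sum>A\<in>H. p ^ card A) = mu p" using H_card by (simp add: mu_def)
  also have "mu p / ((1 + \<epsilon> / 2) * mu p - \<epsilon> * mu p / 4) = 1 / (1 + \<epsilon> / 4)"
  proof -
    have "(1 + \<epsilon> / 2) * mu p - \<epsilon> * mu p / 4 = (1 + \<epsilon> / 4) * mu p" by (simp add: algebra_simps)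
    then show ?thesis using m by simp
  qed
  also have "(1 / (1 + \<epsilon> / 4)) ^ r = exp (- (real r * ln (1 + \<epsilon> / 4)))"
    using e by (simp add: exp_minus exp_of_nat_mult power_one_over inverse_eq_divide)
  also have "\<dots> \<le> exp (- (phi \<epsilon> * mu p / (32 * C)))"
  proof -
    \<comment> \<open>This keeps the factor log (1 + \<epsilon>) for large \<epsilon> as well. It
      accounts for the 4 in 32 = 8 * 4.\<close>
    have "1 + \<epsilon> \<le> (1 + \<epsilon> / 4) ^ 4" using Bernoulli_inequality[of "\<epsilon> / 4" 4] e by simp
    then have "ln (1 + \<epsilon>) \<le> ln ((1 + \<epsilon> / 4) ^ 4)" using e by simp
    also have "\<dots> = 4 * ln (1 + \<epsilon> / 4)" using e by (simp add: ln_realpow)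
    finally have l: "ln (1 + \<epsilon>) / 4 \<le> ln (1 + \<epsilon> / 4)" by simp
    have "phi \<epsilon> * mu p / (32 * C) \<le> (\<epsilon> * ln (1 + \<epsilon>)) * mu p / (32 * C)"
      using phi_le_ln[of \<epsilon>] e m C by (intro divide_right_mono mult_right_mono) auto
    also have "\<dots> = x * (ln (1 + \<epsilon>) / 4)" by (simp add: x_def)
    also have "\<dots> \<le> real r * ln (1 + \<epsilon> / 4)" using r(1) l x0 e by (intro mult_mono) auto
    finally show ?thesis by simp
  qed
  finally show ?thesis .
qed

text \<open>If the average conflict degree exceeds C, then J contains at least C mu / 2 ordered
  pairs of edges sharing exactly one element, although at most C mu / 8 are expected. The maximal
  degree D bounds the conflicts among such pairs, so the tuple count applies to the pairs
  themselves.\<close>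

lemma cherry_tail:
  assumes p: "0 < p" "p \<le> 1" and D: "0 < D"
    and C: "2 * real k ^ 4 \<le> C" "8 * (real k)\<^sup>2 * real n * p ^ (k - 1) \<le> C"
  shows "Ebin n p (\<lambda>R. of_bool (\<exists>J\<subseteq>{A \<in> H. A \<subseteq> R}. mu p \<le> real (card J) \<and>
      (\<forall>A\<in>J. real (card (conflicts (\<lambda>A. A) J A)) \<le> D) \<and>
      C * real (card J) < (\<Sum>A\<in>J. real (card (conflicts (\<lambda>A. A) J A)))))
    \<le> exp (- (C * mu p / (64 * D\<^sup>2)))"
proof -
  define I where "I = {(A, B). A \<in> H \<and> B \<in> H \<and> card (A \<inter> B) = 1}"
  define S where "S = (\<lambda>(A, B). A \<union> B :: nat set)"
  define Q where "Q = C * mu p / 2"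
  \<comment> \<open>Each pair meets at most 4 D^2 others, and 8 D^2 x = Q/2, so half of
    \<open>Q\<close> survives. The expectation is at most \<open>Q / 4\<close>, whence the ratio 1/2
    per step.\<close>
  define x where "x = C * mu p / (32 * D\<^sup>2)"
  define r where "r = nat \<lceil>x\<rceil>"
  have m: "0 < mu p" using mu_pos p by simp
  have C0: "0 < C"
  proof -
    have "0 < 2 * real k ^ 4" using k3 by simp
    then show ?thesis using C(1) by linarith
  qed
  have Q0: "0 < Q" using m C0 by (simp add: Q_def)
  have x0: "0 < x" using m C0 D by (simp add: x_def)
  have r: "x \<le> real r" "\<And>i. i < r \<Longrightarrow> real i \<le> x" using x0 unfolding r_def by linarith+
  have finI: "finite I" by (rule finite_subset[of _ "H \<times> H"]) (auto simp: I_def finite_H)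
  have sum_le: "(\<Sum>q\<in>I. p ^ card (S q)) \<le> Q / 4"
  proof -
    have "(\<Sum>q\<in>I. p ^ card (S q)) = (\<Sum>q\<in>I. p ^ (2 * k - 1))"
    proof (intro sum.cong refl)
      fix q assume "q \<in> I"
      then obtain A B where q: "q = (A, B)" "A \<in> H" "B \<in> H" "card (A \<inter> B) = 1" by (auto simp: I_def)
      then have "card (A \<union> B) = 2 * k - 1" using card_Un_edges[of A B] by simp
      then show "p ^ card (S q) = p ^ (2 * k - 1)" by (simp add: q S_def)
    qed
    also have "\<dots> = real (card I) * (p ^ k * p ^ (k - 1))"
    proof -
      have "2 * k - 1 = k + (k - 1)" using k3 by simp
      then have "p ^ (2 * k - 1) = p ^ k * p ^ (k - 1)" by (simp only: power_add)
      then show ?thesis by simp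
    qed
    also have "\<dots> \<le> (real (card H) * ((real k)\<^sup>2 * real n)) * (p ^ k * p ^ (k - 1))"
    proof (intro mult_right_mono)
      have "I \<subseteq> (SIGMA A:H. {B \<in> H. B \<inter> A \<noteq> {}})"
      proof
        fix q assume "q \<in> I"
        then obtain A B where q: "q = (A, B)" "A \<in> H" "B \<in> H" "card (A \<inter> B) = 1" by (auto simp: I_def)
        then have "B \<inter> A \<noteq> {}" by (auto simp: Int_commute)
        then show "q \<in> (SIGMA A:H. {B \<in> H. B \<inter> A \<noteq> {}})" using q by auto
      qed
      then have "card I \<le> card (SIGMA A:H. {B \<in> H. B \<inter> A \<noteq> {}})"
        using finite_H by (intro card_mono finite_SigmaI) auto
      also have "\<dots> = (\<Sum>A\<in>H. card {B \<in> H. B \<inter> A \<noteq> {}})" using finite_H by (intro card_SigmaI) auto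
      also have "\<dots> \<le> (\<Sum>A\<in>H. k * (k * n))"
      proof (intro sum_mono)
        fix A assume "A \<in> H"
        then show "card {B \<in> H. B \<inter> A \<noteq> {}} \<le> k * (k * n)"
          using card_meet1[of A] finite_edge H_card by simp
      qed
      finally have "real (card I) \<le> real (card H * (k * (k * n)))" unfolding of_nat_le_iff by simp
      then show "real (card I) \<le> real (card H) * ((real k)\<^sup>2 * real n)"
        by (simp add: power2_eq_square mult_ac)
    qed (use p in auto)
    also have "\<dots> = (8 * (real k)\<^sup>2 * real n * p ^ (k - 1)) * mu p / 8" by (simp add: mu_def)
    also have "\<dots> \<le> C * mu p / 8" using C m by (intro divide_right_mono mult_right_mono) auto
    finally show ?thesis by (simp add: Q_def)
  qed
  have "Ebin n p (\<lambda>R. of_bool (\<exists>J\<subseteq>{A \<in> H. A \<subseteq> R}. mu p \<le> real (card J) \<and>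
      (\<forall>A\<in>J. real (card (conflicts (\<lambda>A. A) J A)) \<le> D) \<and>
      C * real (card J) < (\<Sum>A\<in>J. real (card (conflicts (\<lambda>A. A) J A)))))
    \<le> Ebin n p (\<lambda>R. of_bool (many_sparse S {q \<in> I. S q \<subseteq> R} Q (4 * D\<^sup>2) (4 * D\<^sup>2)))"
  proof (intro Ebin_mono)
    fix R assume "R \<subseteq> {1..n}"
    have "many_sparse S {q \<in> I. S q \<subseteq> R} Q (4 * D\<^sup>2) (4 * D\<^sup>2)"
      if J: "J \<subseteq> {A \<in> H. A \<subseteq> R}" "mu p \<le> real (card J)"
        "\<forall>A\<in>J. real (card (conflicts (\<lambda>A. A) J A)) \<le> D"
        "C * real (card J) < (\<Sum>A\<in>J. real (card (conflicts (\<lambda>A. A) J A)))" for J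
    proof -
      let ?N = "\<lambda>A. conflicts (\<lambda>A. A) J A"
      have JH: "J \<subseteq> H" using J(1) by auto
      have finJ: "finite J" using JH finite_H finite_subset by blast
      have finN: "finite (?N A)" for A using finJ by (simp add: conflicts_def)
      define J2 where "J2 = {(A, B). A \<in> J \<and> B \<in> J \<and> card (A \<inter> B) = 1}"
      have sub: "J2 \<subseteq> {q \<in> I. S q \<subseteq> R}" using J(1) by (auto simp: J2_def I_def S_def)
      have c1: "(\<Sum>A\<in>J. real (card (?N A))) \<le> real (card J2) + real k ^ 4 * real (card J)"
      proof -
        have "J2 = (SIGMA A:J. {B \<in> J. card (A \<inter> B) = 1})" by (auto simp: J2_def)
        then have cJ2: "card J2 = (\<Sum>A\<in>J. card {B \<in> J. card (A \<inter> B) = 1})" using finJ by simp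
        have "card (?N A) \<le> card {B \<in> J. card (A \<inter> B) = 1} + k ^ 4" if A: "A \<in> J" for A
        proof -
          have fA: "finite A" "card A = k" using A JH finite_edge H_card by auto
          \<comment> \<open>The self-conflict of \<open>A\<close> falls into the second set, since
            \<open>A\<close> shares k >= 2 elements with itself.\<close>
          have "?N A \<subseteq> {B \<in> J. card (A \<inter> B) = 1} \<union> {B \<in> H. 2 \<le> card (B \<inter> A)}"
          proof
            fix B assume B: "B \<in> ?N A"
            then have "card (B \<inter> A) \<noteq> 0" using fA by (simp add: conflicts_def)
            then show "B \<in> {B \<in> J. card (A \<inter> B) = 1} \<union> {B \<in> H. 2 \<le> card (B \<inter> A)}"
              using B JH by (auto simp: conflicts_def Int_commute)
          qed
          then have "card (?N A) \<le> card ({B \<in> J. card (A \<inter> B) = 1} \<union> {B \<in> H. 2 \<le> card (B \<inter> A)})"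
            using finJ finite_H by (intro card_mono) auto
          also have "\<dots> \<le> card {B \<in> J. card (A \<inter> B) = 1} + card {B \<in> H. 2 \<le> card (B \<inter> A)}"
            by (rule card_Un_le)
          also have "card {B \<in> H. 2 \<le> card (B \<inter> A)} \<le> k\<^sup>2 * k\<^sup>2"
            using card_meet2[OF fA(1)] fA(2) by simp
          also have "k\<^sup>2 * k\<^sup>2 = k ^ 4" by (simp flip: power_add)
          finally show ?thesis by simp
        qed
        then have "(\<Sum>A\<in>J. card (?N A)) \<le> (\<Sum>A\<in>J. card {B \<in> J. card (A \<inter> B) = 1} + k ^ 4)"
          by (rule sum_mono)
        also have "\<dots> = card J2 + k ^ 4 * card J" by (simp add: sum.distrib cJ2)
        finally have "real (\<Sum>A\<in>J. card (?N A)) \<le> real (card J2 + k ^ 4 * card J)" unfolding of_nat_le_iff .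
        then show ?thesis by simp
      qed
      have "C * real (card J) - real k ^ 4 * real (card J) \<le> real (card J2)" using c1 J(4) by linarith
      moreover have "real k ^ 4 * real (card J) \<le> (C / 2) * real (card J)"
        using C(1) by (intro mult_right_mono) auto
      ultimately have "(C / 2) * real (card J) \<le> real (card J2)" by (simp add: algebra_simps)
      moreover have "(C / 2) * mu p \<le> (C / 2) * real (card J)" using J(2) C0 by simp
      ultimately have zJ: "Q \<le> real (card J2)" by (simp add: Q_def)
      have cf: "real (card (conflicts S J2 q)) \<le> 4 * D\<^sup>2" if q: "q \<in> J2" for q
      proof -
        obtain A B where AB: "q = (A, B)" "A \<in> J" "B \<in> J" using q by (auto simp: J2_def)
        \<comment> \<open>In a pair meeting \<open>A \<union> B\<close>, one edge meets
          \<open>A\<close> or \<open>B\<close>, which leaves 2 D choices, and its partner meets that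
          edge, which leaves D. The swap accounts for the two orders, giving 4 D^2 in all.\<close>
        define W where "W = (SIGMA A':?N A \<union> ?N B. ?N A')"
        have finW: "finite W" unfolding W_def using finN by (intro finite_SigmaI) auto
        have "conflicts S J2 q \<subseteq> W \<union> prod.swap ` W"
        proof
          fix t assume "t \<in> conflicts S J2 q"
          then obtain A' B' where t: "t = (A', B')" "A' \<in> J" "B' \<in> J" "card (A' \<inter> B') = 1"
            "(A' \<union> B') \<inter> (A \<union> B) \<noteq> {}" by (auto simp: conflicts_def J2_def S_def AB)
          have ne: "A' \<inter> B' \<noteq> {}" using t(4) by auto
          consider "A' \<inter> (A \<union> B) \<noteq> {}" | "B' \<inter> (A \<union> B) \<noteq> {}" using t(5) by blast
          then show "t \<in> W \<union> prod.swap ` W"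
          proof cases
            case 1
            then have "(A', B') \<in> W" using t ne by (auto simp: W_def conflicts_def)
            then show ?thesis by (simp add: t)
          next
            case 2
            then have "(B', A') \<in> W" using t ne by (auto simp: W_def conflicts_def)
            then have "prod.swap (B', A') \<in> prod.swap ` W" by (rule imageI)
            then show ?thesis by (simp add: t)
          qed
        qed
        then have "card (conflicts S J2 q) \<le> card (W \<union> prod.swap ` W)" using finW by (intro card_mono) auto
        also have "\<dots> \<le> card W + card (prod.swap ` W)" by (rule card_Un_le)
        also have "\<dots> \<le> card W + card W" using finW by (intro add_left_mono card_image_le)
        finally have "real (card (conflicts S J2 q)) \<le> 2 * real (card W)" by simp
        also have "real (card W) = (\<Sum>A'\<in>?N A \<union> ?N B. real (card (?N A')))"
          unfolding W_def using finN by simp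
        also have "\<dots> \<le> (\<Sum>A'\<in>?N A \<union> ?N B. D)"
          using J(3) by (intro sum_mono) (auto simp: conflicts_def)
        also have "\<dots> = real (card (?N A \<union> ?N B)) * D" by simp
        also have "\<dots> \<le> (D + D) * D"
        proof (intro mult_right_mono)
          have "real (card (?N A \<union> ?N B)) \<le> real (card (?N A)) + real (card (?N B))"
            using card_Un_le[of "?N A" "?N B"] by (simp flip: of_nat_add)
          then show "real (card (?N A \<union> ?N B)) \<le> D + D" using J(3) AB by (smt (verit))
        qed (use D in auto)
        finally show ?thesis by (simp add: power2_eq_square)
      qed
      have "(\<Sum>q\<in>J2. real (card (conflicts S J2 q))) \<le> (\<Sum>q\<in>J2. 4 * D\<^sup>2)" using cf by (intro sum_mono)
      then show ?thesis unfolding many_sparse_def using sub zJ cf by (intro exI[of _ J2]) (auto simp: mult.commute)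
    qed
    then show "of_bool (\<exists>J\<subseteq>{A \<in> H. A \<subseteq> R}. mu p \<le> real (card J) \<and>
      (\<forall>A\<in>J. real (card (conflicts (\<lambda>A. A) J A)) \<le> D) \<and>
      C * real (card J) < (\<Sum>A\<in>J. real (card (conflicts (\<lambda>A. A) J A))))
      \<le> (of_bool (many_sparse S {q \<in> I. S q \<subseteq> R} Q (4 * D\<^sup>2) (4 * D\<^sup>2)) :: real)"
      unfolding of_bool_def by (auto split: if_splits)
  qed (use p in auto)
  also have "\<dots> \<le> ((\<Sum>q\<in>I. p ^ card (S q)) / (Q - Q / 2)) ^ r"
  proof (intro prob_many_sparse_le p finI Q0)
    fix i assume "i < r"
    then have "real i \<le> x" by (rule r(2))
    then have "real i * (8 * D\<^sup>2) \<le> x * (8 * D\<^sup>2)" by (intro mult_right_mono) auto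
    also have "\<dots> = Q / 2" using D by (simp add: x_def Q_def)
    finally have "real i * (8 * D\<^sup>2) \<le> Q / 2" .
    then show "2 * (real i * (4 * D\<^sup>2)) \<le> Q" "2 * (4 * D\<^sup>2) * real i \<le> Q / 2" using Q0 by (simp_all add: mult_ac)
  next
    fix q assume "q \<in> I"
    then show "S q \<subseteq> {1..n}" using H_sub by (auto simp: I_def S_def)
  qed (use Q0 in auto)
  also have "\<dots> \<le> (1 / 2) ^ r"
    using sum_le Q0 p by (intro power_mono divide_nonneg_nonneg sum_nonneg) (auto simp: divide_le_eq)
  also have "(1 / 2 :: real) ^ r \<le> exp (- (1 / 2)) ^ r" by (intro power_mono exp_minus_half_ge) auto
  also have "\<dots> = exp (- (real r / 2))" by (simp add: exp_of_nat_mult[symmetric])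
  also have "\<dots> \<le> exp (- (C * mu p / (64 * D\<^sup>2)))" using r(1) by (simp add: x_def)
  finally show ?thesis .
qed

text \<open>Only the trace \<open>A - V\<close> has to be random. If two such traces meet, the
  second edge passes through an element of the first trace and an element of \<open>V\<close>, so
  bounded codegree limits the conflicts to k^3 v; maximal and average degree need not be
  distinguished here.\<close>

lemma single_touch_tail:
  assumes p: "0 < p" "p \<le> 1" and V: "V \<subseteq> {1..n}" "real (card V) \<le> v" and v: "0 < v" and t: "0 < t"
  shows "Ebin n p (\<lambda>R. of_bool (t \<le> real (card {A \<in> H. card (A \<inter> V) = 1 \<and> A - V \<subseteq> R})))
    \<le> (2 * real k * real n * v * p ^ (k - 1) / t) ^ nat \<lceil>t / (4 * real k ^ 3 * v)\<rceil>"
proof -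
  define I where "I = {A \<in> H. card (A \<inter> V) = 1}"
  define D where "D = real k ^ 3 * v"
  define x where "x = t / (4 * D)"
  define r where "r = nat \<lceil>x\<rceil>"
  have finV: "finite V" using V finite_subset by auto
  have D0: "0 < D" using v k3 by (simp add: D_def)
  have x0: "0 < x" using D0 t by (simp add: x_def)
  have r: "x \<le> real r" "\<And>i. i < r \<Longrightarrow> real i \<le> x" using x0 unfolding r_def by linarith+
  have finI: "finite I" by (simp add: I_def finite_H)
  have cf: "real (card (conflicts (\<lambda>A. A - V) J A)) \<le> D" if J: "J \<subseteq> I" and A: "A \<in> J" for J A
  proof -
    have AH: "A \<in> H" using J A by (auto simp: I_def)
    let ?P = "(A - V) \<times> V"
    have "conflicts (\<lambda>A. A - V) J A \<subseteq> (\<Union>q\<in>?P. {B \<in> H. fst q \<in> B \<and> snd q \<in> B})"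
    proof
      fix B assume "B \<in> conflicts (\<lambda>A. A - V) J A"
      then have B: "B \<in> H" "card (B \<inter> V) = 1" "(B - V) \<inter> (A - V) \<noteq> {}" using J by (auto simp: conflicts_def I_def)
      obtain a where a: "a \<in> B - V" "a \<in> A - V" using B(3) by blast
      have "B \<inter> V \<noteq> {}" using B(2) by auto
      then obtain b where b: "b \<in> B" "b \<in> V" by blast
      show "B \<in> (\<Union>q\<in>?P. {B \<in> H. fst q \<in> B \<and> snd q \<in> B})"
        using a b B(1) by (intro UN_I[of "(a, b)"]) auto
    qed
    then have "card (conflicts (\<lambda>A. A - V) J A) \<le> card (\<Union>q\<in>?P. {B \<in> H. fst q \<in> B \<and> snd q \<in> B})"
      using finV finite_edge[OF AH] finite_H by (intro card_mono) auto
    also have "\<dots> \<le> (\<Sum>q\<in>?P. card {B \<in> H. fst q \<in> B \<and> snd q \<in> B})"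
      using finV finite_edge[OF AH] by (intro card_UN_le) auto
    also have "\<dots> \<le> (\<Sum>q\<in>?P. k\<^sup>2)" by (intro sum_mono codegree) auto
    also have "\<dots> = card (A - V) * card V * k\<^sup>2" by (simp add: card_cartesian_product)
    also have "\<dots> \<le> k * card V * k\<^sup>2"
      using card_mono[of A "A - V"] finite_edge[OF AH] H_card[OF AH] by (intro mult_right_mono) auto
    finally have "real (card (conflicts (\<lambda>A. A - V) J A)) \<le> real (k * card V * k\<^sup>2)" unfolding of_nat_le_iff .
    also have "\<dots> = real k ^ 3 * real (card V)" by (simp add: power2_eq_square power3_eq_cube)
    also have "\<dots> \<le> D" unfolding D_def using V by (intro mult_left_mono) auto
    finally show ?thesis .
  qed
  have "Ebin n p (\<lambda>R. of_bool (t \<le> real (card {A \<in> H. card (A \<inter> V) = 1 \<and> A - V \<subseteq> R})))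
    \<le> Ebin n p (\<lambda>R. of_bool (many_sparse (\<lambda>A. A - V) {A \<in> I. A - V \<subseteq> R} t D D))"
  proof (intro Ebin_mono p)
    fix R assume "R \<subseteq> {1..n}"
    have "many_sparse (\<lambda>A. A - V) {A \<in> I. A - V \<subseteq> R} t D D"
      if "t \<le> real (card {A \<in> H. card (A \<inter> V) = 1 \<and> A - V \<subseteq> R})"
    proof -
      let ?J = "{A \<in> I. A - V \<subseteq> R}"
      have cfJ: "real (card (conflicts (\<lambda>A. A - V) ?J A)) \<le> D" if "A \<in> ?J" for A
        using that by (intro cf) auto
      then have "(\<Sum>A\<in>?J. real (card (conflicts (\<lambda>A. A - V) ?J A))) \<le> (\<Sum>A\<in>?J. D)"
        by (intro sum_mono)
      then have "(\<Sum>A\<in>?J. real (card (conflicts (\<lambda>A. A - V) ?J A))) \<le> D * real (card ?J)"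
        by (simp only: sum_constant mult.commute)
      moreover have "?J = {A \<in> H. card (A \<inter> V) = 1 \<and> A - V \<subseteq> R}" by (auto simp: I_def)
      then have "t \<le> real (card ?J)" using that by simp
      ultimately show ?thesis unfolding many_sparse_def using cfJ by blast
    qed
    then show "of_bool (t \<le> real (card {A \<in> H. card (A \<inter> V) = 1 \<and> A - V \<subseteq> R}))
      \<le> (of_bool (many_sparse (\<lambda>A. A - V) {A \<in> I. A - V \<subseteq> R} t D D) :: real)" by simp
  qed (use p in auto)
  also have "\<dots> \<le> ((\<Sum>A\<in>I. p ^ card (A - V)) / (t - t / 2)) ^ r"
  proof (intro prob_many_sparse_le p finI t)
    fix i assume "i < r"
    then have "real i \<le> x" by (rule r(2))
    then have "real i * (2 * D) \<le> x * (2 * D)" using D0 by (intro mult_right_mono) auto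
    also have "\<dots> = t / 2" using D0 by (simp add: x_def)
    finally show "2 * (real i * D) \<le> t" "2 * D * real i \<le> t / 2" using t by (simp_all add: mult_ac)
  next
    fix A assume "A \<in> I"
    then show "A - V \<subseteq> {1..n}" using H_sub by (auto simp: I_def)
  qed (use t in auto)
  also have "\<dots> \<le> (2 * real k * real n * v * p ^ (k - 1) / t) ^ r"
  proof (intro power_mono divide_nonneg_nonneg sum_nonneg)
    have "(\<Sum>A\<in>I. p ^ card (A - V)) = (\<Sum>A\<in>I. p ^ (k - 1))"
    proof (intro sum.cong refl)
      fix A assume "A \<in> I"
      then have A: "A \<in> H" "card (A \<inter> V) = 1" by (auto simp: I_def)
      have "card (A - V) = card A - card (A \<inter> V)" using finite_edge[OF A(1)] finV by (simp add: card_Diff_subset_Int)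
      then show "p ^ card (A - V) = p ^ (k - 1)" using A H_card by simp
    qed
    also have "\<dots> = real (card I) * p ^ (k - 1)" by simp
    also have "\<dots> \<le> (v * (real k * real n)) * p ^ (k - 1)"
    proof (intro mult_right_mono)
      have "I \<subseteq> {A \<in> H. A \<inter> V \<noteq> {}}" by (auto simp: I_def)
      then have "card I \<le> card {A \<in> H. A \<inter> V \<noteq> {}}" using finite_H by (intro card_mono) auto
      also have "\<dots> \<le> card V * (k * n)" by (rule card_meet1[OF finV])
      finally have "real (card I) \<le> real (card V * (k * n))" unfolding of_nat_le_iff .
      also have "\<dots> = real (card V) * (real k * real n)" by simp
      also have "\<dots> \<le> v * (real k * real n)" using V by (intro mult_right_mono) auto
      finally show "real (card I) \<le> v * (real k * real n)" .
    qed (use p in auto)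
    finally have s: "(\<Sum>A\<in>I. p ^ card (A - V)) \<le> (v * (real k * real n)) * p ^ (k - 1)" .
    have "(\<Sum>A\<in>I. p ^ card (A - V)) / (t - t / 2) = 2 * (\<Sum>A\<in>I. p ^ card (A - V)) / t" using t by (simp add: field_simps)
    also have "\<dots> \<le> 2 * ((v * (real k * real n)) * p ^ (k - 1)) / t" using s t by (intro divide_right_mono) auto
    finally show "(\<Sum>A\<in>I. p ^ card (A - V)) / (t - t / 2) \<le> 2 * real k * real n * v * p ^ (k - 1) / t"
      by (simp add: mult_ac)
  qed (use p t in auto)
  finally show ?thesis unfolding r_def x_def D_def by (simp only: mult.assoc)
qed

section \<open>Deleting stars\<close>

definition bounded_conflicts :: "real \<Rightarrow> real \<Rightarrow> nat set \<Rightarrow> nat set set \<Rightarrow> bool" where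
  "bounded_conflicts z D R J \<longleftrightarrow> J \<subseteq> {A \<in> H. A \<subseteq> R} \<and> z \<le> real (card J) \<and>
     (\<forall>A\<in>J. real (card (conflicts (\<lambda>A. A) J A)) \<le> D)"

text \<open>Sunflowers with \<open>m\<close> petals and a single kernel vertex. The kernel is
  recorded with the petals so that it need not be recovered from the family when m is 1.\<close>

definition stars :: "nat \<Rightarrow> (nat \<times> nat set set) set" where
  "stars m = {(v, F). v \<in> {1..n} \<and> F \<subseteq> H \<and> card F = m \<and> (\<forall>A\<in>F. v \<in> A) \<and>
     (\<forall>A\<in>F. \<forall>B\<in>F. A \<noteq> B \<longrightarrow> A \<inter> B = {v})}"

lemma finite_stars: "finite (stars m)"
  by (rule finite_subset[of _ "{1..n} \<times> Pow H"]) (auto simp: stars_def finite_H)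

lemma star_Union_sub: "s \<in> stars m \<Longrightarrow> \<Union>(snd s) \<subseteq> {1..n}"
proof (intro Union_least)
  fix A assume "s \<in> stars m" "A \<in> snd s"
  then have "A \<in> H" by (auto simp: stars_def)
  then show "A \<subseteq> {1..n}" by (rule H_sub)
qed

lemma card_stars: "card (stars m) \<le> n * (k * n choose m)"
proof -
  have "stars m \<subseteq> (SIGMA v:{1..n}. {F. F \<subseteq> {A \<in> H. v \<in> A} \<and> card F = m})"
    by (auto simp: stars_def)
  then have "card (stars m) \<le> card (SIGMA v:{1..n}. {F. F \<subseteq> {A \<in> H. v \<in> A} \<and> card F = m})"
    using finite_H by (intro card_mono finite_SigmaI) auto
  also have "\<dots> = (\<Sum>v\<in>{1..n}. card {F. F \<subseteq> {A \<in> H. v \<in> A} \<and> card F = m})"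
    using finite_H by (intro card_SigmaI) auto
  also have "\<dots> = (\<Sum>v\<in>{1..n}. card {A \<in> H. v \<in> A} choose m)"
    using finite_H by (intro sum.cong refl n_subsets) auto
  also have "\<dots> \<le> (\<Sum>v\<in>{1..n}. k * n choose m)"
    by (intro sum_mono binomial_right_mono degree)
  finally show ?thesis by simp
qed

text \<open>The petals without their common vertex are disjoint sets of k - 1 elements.\<close>

lemma card_star_ge:
  assumes "s \<in> stars m"
  shows "m * (k - 1) \<le> card (\<Union>(snd s))"
proof -
  obtain v F where s: "s = (v, F)" by (cases s)
  have F: "F \<subseteq> H" "card F = m" "\<And>A. A \<in> F \<Longrightarrow> v \<in> A" "\<And>A B. A \<in> F \<Longrightarrow> B \<in> F \<Longrightarrow> A \<noteq> B \<Longrightarrow> A \<inter> B = {v}"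
    using assms by (auto simp: stars_def s)
  have fin: "finite F" "\<And>A. A \<in> F \<Longrightarrow> finite A"
    using F(1) finite_H finite_edge finite_subset by blast+
  have "m * (k - 1) = (\<Sum>A\<in>F. card (A - {v}))"
    using F H_card fin by (simp add: subset_iff)
  also have "\<dots> = card (\<Union>A\<in>F. A - {v})"
    using fin F(4) by (intro card_UN_disjoint[symmetric]) blast+
  also have "\<dots> \<le> card (\<Union>F)" using fin by (intro card_mono) auto
  finally show ?thesis by (simp add: s)
qed

text \<open>The expected number of stars is at most n (e k n p^(k-1) / m)^m, hence at most n (e k
  w^4)^m. One power of w pays for e k and one power w^m for n. What is left is at most w^m per star,
  so q disjoint stars cost w^(m q) = p^(m q / 40).\<close>

lemma star_prob:
  assumes p: "0 < p" "p \<le> 1" "p = w ^ 40" and w: "0 < w" "w \<le> 1" "exp 1 * real k * w \<le> 1"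
    and m: "1 \<le> m" "real n * p ^ (k - 1) \<le> w ^ 4 * real m" "real n * w ^ m \<le> 1"
  shows "Ebin n p (\<lambda>R. of_bool (disjoint_tuples (\<lambda>s. \<Union>(snd s)) {s \<in> stars m. \<Union>(snd s) \<subseteq> R} q \<noteq> {})) \<le> w ^ (m * q)"
proof -
  have "Ebin n p (\<lambda>R. of_bool (disjoint_tuples (\<lambda>s. \<Union>(snd s)) {s \<in> stars m. \<Union>(snd s) \<subseteq> R} q \<noteq> {}))
    \<le> (\<Sum>s\<in>stars m. p ^ card (\<Union>(snd s))) ^ q"
    by (intro prob_disjoint_tuples_nonempty p finite_stars star_Union_sub)
  also have "\<dots> \<le> (w ^ m) ^ q"
  proof (intro power_mono)
    have "(\<Sum>s\<in>stars m. p ^ card (\<Union>(snd s))) \<le> (\<Sum>s\<in>stars m. p ^ (m * (k - 1)))"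
      using p by (intro sum_mono power_decreasing card_star_ge) auto
    also have "\<dots> = real (card (stars m)) * (p ^ (k - 1)) ^ m" by (simp add: power_mult[symmetric] mult.commute)
    also have "\<dots> \<le> (real n * real (k * n choose m)) * (p ^ (k - 1)) ^ m"
    proof (intro mult_right_mono)
      have "real (card (stars m)) \<le> real (n * (k * n choose m))" unfolding of_nat_le_iff by (rule card_stars)
      then show "real (card (stars m)) \<le> real n * real (k * n choose m)" by simp
    qed (use p in auto)
    also have "\<dots> \<le> (real n * (exp 1 * real (k * n) / real m) ^ m) * (p ^ (k - 1)) ^ m"
      using p m by (intro mult_right_mono mult_left_mono choose_le_exp_pow) auto
    also have "\<dots> = real n * (exp 1 * real k * (real n * p ^ (k - 1)) / real m) ^ m"
      by (simp add: power_divide power_mult_distrib mult_ac)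
    also have "\<dots> \<le> real n * (exp 1 * real k * (w ^ 4 * real m) / real m) ^ m"
      using p m by (intro mult_left_mono power_mono divide_right_mono) auto
    also have "\<dots> = real n * ((exp 1 * real k * w) * w ^ 3) ^ m"
      using m by (simp add: power_eq_if mult_ac)
    also have "\<dots> \<le> real n * (1 * w ^ 3) ^ m"
      using w by (intro mult_left_mono power_mono mult_right_mono) auto
    also have "\<dots> = (real n * w ^ m) * w ^ (2 * m)" by (simp add: power_mult[symmetric] power_add[symmetric])
    also have "\<dots> \<le> 1 * w ^ m" using m w by (intro mult_mono power_decreasing) auto
    finally show "(\<Sum>s\<in>stars m. p ^ card (\<Union>(snd s))) \<le> w ^ m" by simp
  qed (use p in \<open>auto intro: sum_nonneg\<close>)
  finally show ?thesis by (simp add: power_mult)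
qed

text \<open>Take a largest star at x inside R; it has fewer than m petals. Every edge at x inside R
  meets its union in an element besides x, since otherwise the star could be extended, and each of
  the at most m k elements shares at most k^2 edges with x.\<close>

lemma degree_star_free:
  assumes R: "R \<subseteq> {1..n}" and m: "1 \<le> m"
    and no: "\<And>s. s \<in> stars m \<Longrightarrow> \<not> \<Union>(snd s) \<subseteq> R"
  shows "card {A \<in> H. A \<subseteq> R \<and> x \<in> A} \<le> k ^ 3 * m"
proof (cases "{A \<in> H. A \<subseteq> R \<and> x \<in> A} = {}")
  case False
  let ?P = "\<lambda>F. F \<subseteq> {A \<in> H. A \<subseteq> R \<and> x \<in> A} \<and> (\<forall>A\<in>F. \<forall>B\<in>F. A \<noteq> B \<longrightarrow> A \<inter> B = {x})"
  have x: "x \<in> {1..n}" using False R by auto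
  have finP: "finite F" if "?P F" for F
    using that finite_H finite_subset[of F H] by auto
  have small: "card F < m" if "?P F" for F
  proof (rule ccontr)
    assume "\<not> card F < m"
    then obtain F' where F': "F' \<subseteq> F" "card F' = m"
      by (meson not_less obtain_subset_with_card_n)
    then have "(x, F') \<in> stars m" using that x unfolding stars_def by blast
    moreover have "\<Union>F' \<subseteq> R" using F' that by blast
    ultimately show False using no[of "(x, F')"] by simp
  qed
  have "\<exists>F. ?P F \<and> (\<forall>G. ?P G \<longrightarrow> card G \<le> card F)"
  proof (rule ex_has_greatest_nat)
    show "?P {}" by simp
    show "\<forall>G. ?P G \<longrightarrow> card G < m" using small by blast
  qed
  then obtain F where F: "?P F" "\<And>G. ?P G \<Longrightarrow> card G \<le> card F" by blast
  have finF: "finite F" using F finP by blast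
  have FH: "F \<subseteq> H" using F by auto
  have finU: "finite (\<Union>F)" using finF FH finite_edge by blast
  have "{A \<in> H. A \<subseteq> R \<and> x \<in> A} \<subseteq> (\<Union>y\<in>\<Union>F - {x}. {A \<in> H. x \<in> A \<and> y \<in> A})"
  proof
    fix A assume A: "A \<in> {A \<in> H. A \<subseteq> R \<and> x \<in> A}"
    have "\<exists>y\<in>\<Union>F - {x}. y \<in> A"
    proof (rule ccontr)
      assume neg: "\<not> (\<exists>y\<in>\<Union>F - {x}. y \<in> A)"
      have "card A = k" using A H_card by auto
      have "A \<notin> F"
      proof
        assume "A \<in> F"
        then have "A \<subseteq> {x}" using neg by blast
        then have "card A \<le> 1" using card_mono[of "{x}" A] by simp
        then show False using \<open>card A = k\<close> k3 by simp
      qed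
      moreover have "?P (insert A F)"
      proof -
        have "A \<inter> B = {x} \<and> B \<inter> A = {x}" if "B \<in> F" for B
        proof -
          have "x \<in> B" using that F(1) by auto
          moreover have "A \<inter> B \<subseteq> {x}" using neg that by auto
          ultimately show ?thesis using A by auto
        qed
        then show ?thesis using F(1) A by simp
      qed
      then have "card (insert A F) \<le> card F" by (rule F(2))
      ultimately show False using finF by simp
    qed
    then show "A \<in> (\<Union>y\<in>\<Union>F - {x}. {A \<in> H. x \<in> A \<and> y \<in> A})" using A by blast
  qed
  then have "card {A \<in> H. A \<subseteq> R \<and> x \<in> A} \<le> card (\<Union>y\<in>\<Union>F - {x}. {A \<in> H. x \<in> A \<and> y \<in> A})"
    using finU finite_H by (intro card_mono) auto
  also have "\<dots> \<le> (\<Sum>y\<in>\<Union>F - {x}. card {A \<in> H. x \<in> A \<and> y \<in> A})"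
    using finU by (intro card_UN_le) auto
  also have "\<dots> \<le> (\<Sum>y\<in>\<Union>F - {x}. k\<^sup>2)" by (intro sum_mono codegree) auto
  also have "\<dots> = card (\<Union>F - {x}) * k\<^sup>2" by simp
  also have "\<dots> \<le> (m * k) * k\<^sup>2"
  proof (intro mult_right_mono)
    have "card (\<Union>F - {x}) \<le> card (\<Union>F)" using finU by (intro card_mono) auto
    also have "\<dots> \<le> (\<Sum>A\<in>F. card A)" by (rule card_Union_le_sum_card)
    also have "\<dots> = card F * k" using FH H_card by (simp add: subset_iff)
    also have "\<dots> \<le> m * k" using less_imp_le[OF small[OF F(1)]] by (intro mult_right_mono) auto
    finally show "card (\<Union>F - {x}) \<le> m * k" .
  qed auto
  also have "\<dots> = k ^ 3 * m" by (simp add: power2_eq_square power3_eq_cube)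
  finally show ?thesis .
next
  case True
  show ?thesis unfolding True by simp
qed

text \<open>Let V be the union of a disjoint tuple of stars in R that cannot be prolonged. A star
  inside R - V would be disjoint from all its entries, so none is left and every degree in R - V is
  at most k^3 m.\<close>

lemma star_removal:
  assumes R: "R \<subseteq> {1..n}" and m: "1 \<le> m"
    and no: "disjoint_tuples (\<lambda>s. \<Union>(snd s)) {s \<in> stars m. \<Union>(snd s) \<subseteq> R} q0 = {}"
  shows "\<exists>V\<subseteq>{1..n}. card V \<le> k * (m * (q0 - 1)) \<and>
    (\<forall>A\<in>{A \<in> H. A \<subseteq> R - V}. card (conflicts (\<lambda>A. A) {A \<in> H. A \<subseteq> R - V} A) \<le> k ^ 4 * m)"
proof -
  let ?S = "\<lambda>s :: nat \<times> nat set set. \<Union>(snd s)"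
  let ?I = "{s \<in> stars m. ?S s \<subseteq> R}"
  have q0: "q0 \<noteq> 0"
  proof
    assume "q0 = 0"
    then show False using no by (simp add: disjoint_tuples_0)
  qed
  \<comment> \<open>The maximal length: a disjoint tuple of length \<open>q\<close> exists, but none
    of length \<open>Suc q\<close>.\<close>
  define q where "q = (LEAST q. disjoint_tuples ?S ?I (Suc q) = {})"
  have ex: "disjoint_tuples ?S ?I (Suc (q0 - 1)) = {}" using no q0 by simp
  have qE: "disjoint_tuples ?S ?I (Suc q) = {}" unfolding q_def using ex by (rule LeastI)
  have qle: "q \<le> q0 - 1" unfolding q_def using ex by (rule Least_le)
  have "disjoint_tuples ?S ?I q \<noteq> {}"
  proof (cases q)
    case (Suc q')
    then have "q' < q" by simp
    then have "\<not> disjoint_tuples ?S ?I (Suc q') = {}" unfolding q_def by (rule not_less_Least)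
    then show ?thesis by (simp only: Suc not_False_eq_True)
  qed (simp add: disjoint_tuples_0)
  then obtain xs where xs: "xs \<in> disjoint_tuples ?S ?I q" by blast
  define V where "V = (\<Union>s\<in>set xs. ?S s)"
  have xsI: "set xs \<subseteq> ?I" "length xs = q" using xs by (auto simp: disjoint_tuples_def)
  have VR: "V \<subseteq> {1..n}" using xsI R unfolding V_def by blast
  have cS: "card (?S s) \<le> k * m" if "s \<in> stars m" for s
  proof -
    have F: "snd s \<subseteq> H" "card (snd s) = m" using that by (auto simp: stars_def)
    have "card (?S s) \<le> (\<Sum>A\<in>snd s. card A)" by (rule card_Union_le_sum_card)
    also have "\<dots> = m * k" using F H_card by (simp add: subset_iff)
    finally show ?thesis by (simp add: mult.commute)
  qed
  have "card V \<le> (\<Sum>s\<in>set xs. card (?S s))" unfolding V_def by (intro card_UN_le) auto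
  also have "\<dots> \<le> (\<Sum>s\<in>set xs. k * m)" using xsI by (intro sum_mono cS) auto
  also have "\<dots> = card (set xs) * (k * m)" by simp
  also have "\<dots> \<le> q * (k * m)" using card_length[of xs] xsI by (intro mult_right_mono) auto
  also have "\<dots> \<le> (q0 - 1) * (k * m)" using qle by (intro mult_right_mono) auto
  finally have cV: "card V \<le> k * (m * (q0 - 1))" by (simp add: mult_ac)
  have noR: "\<not> ?S s \<subseteq> R - V" if s: "s \<in> stars m" for s
  proof
    assume a: "?S s \<subseteq> R - V"
    have "?S s \<inter> ?S y = {}" if "y \<in> set xs" for y
    proof -
      have "?S y \<subseteq> V" using that unfolding V_def by blast
      then show ?thesis using a by blast
    qed
    moreover have "s \<in> ?I" using s a by blast
    ultimately have "s # xs \<in> disjoint_tuples ?S ?I (Suc q)"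
      using xs unfolding disjoint_tuples_def mem_Collect_eq by simp
    then show False using qE by simp
  qed
  have "card (conflicts (\<lambda>A. A) {A \<in> H. A \<subseteq> R - V} A) \<le> k ^ 4 * m" if A: "A \<in> {A \<in> H. A \<subseteq> R - V}" for A
  proof -
    have fA: "finite A" "card A = k" using A finite_edge H_card by auto
    have "conflicts (\<lambda>A. A) {A \<in> H. A \<subseteq> R - V} A \<subseteq> (\<Union>x\<in>A. {B \<in> H. B \<subseteq> R - V \<and> x \<in> B})"
      by (auto simp: conflicts_def)
    then have "card (conflicts (\<lambda>A. A) {A \<in> H. A \<subseteq> R - V} A) \<le> card (\<Union>x\<in>A. {B \<in> H. B \<subseteq> R - V \<and> x \<in> B})"
      using fA finite_H by (intro card_mono) auto
    also have "\<dots> \<le> (\<Sum>x\<in>A. card {B \<in> H. B \<subseteq> R - V \<and> x \<in> B})" using fA by (intro card_UN_le) auto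
    also have "\<dots> \<le> (\<Sum>x\<in>A. k ^ 3 * m)"
      using R noR m by (intro sum_mono degree_star_free) auto
    also have "\<dots> = k ^ 4 * m" using fA by (simp add: power_eq_if)
    finally show ?thesis .
  qed
  then show ?thesis using VR cV by blast
qed

text \<open>Deleting the vertices \<open>V\<close> of a maximal family of disjoint stars leaves bounded degrees. The number
  \<open>\<rho> = L / (\<epsilon> n p)\<close> measures how far the expected number of progressions meeting \<open>V\<close> once lies below
  \<open>\<epsilon> \<mu>\<close>; the two upper bounds for \<open>F\<close> combine to \<open>\<rho>\<^sup>3 \<le> 2 p\<close>, so that powers of \<open>\<rho>\<close> pay both for the
  choice of \<open>V\<close> and for the required factor \<open>p\<close> per vertex.\<close>

lemma sparse_reduction:
  assumes p: "0 < p" "p = w ^ 40" and w: "0 < w" and l: "l = ln (1 / p)" "120 * real k \<le> l"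
    and e: "0 < \<epsilon>" and F: "0 < F" "F \<le> sqrt (\<epsilon> * mu p) * l" "F \<le> 2 * \<epsilon>\<^sup>2 * (real n * p)"
    and m: "80 * real k \<le> real m" "real n * p ^ (k - 1) \<le> w ^ 4 * real m"
  shows "Ebin n p (\<lambda>R. of_bool ((1 + \<epsilon>) * mu p \<le> X H R \<and>
      \<not> (\<exists>J. bounded_conflicts ((1 + \<epsilon> / 2) * mu p) (real k ^ 4 * real m) R J)))
    \<le> exp (- F / (10240 * real k ^ 4)) + exp (- F / 6)"
proof -
  \<comment> \<open>The number of elements whose simultaneous presence costs exp (-F). The clustered
    term of the rate bounds it by sqrt(\<epsilon> mu), so L^2 \<le> \<epsilon> mu.\<close>
  define L where "L = F / l"
  \<comment> \<open>With v = k c L, this makes the tuple length for edges meeting V once at least 8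
    L, keeps the choice of V affordable, and leaves at most \<epsilon> mu / 8 edges with two
    elements in V.\<close>
  define c where "c = 1 / (256 * real k ^ 4)"
  define v where "v = real k * c * L"
  define \<rho> where "\<rho> = L / (\<epsilon> * (real n * p))"
  define \<theta> where "\<theta> = ln (1 / \<rho>)"
  \<comment> \<open>Then m q0 is at least c L, so q0 disjoint stars cost w^(c L) = exp (- c F / 40),
    and 40 * 256 = 10240. Fewer stars have at most k c L elements together.\<close>
  define q0 where "q0 = nat \<lceil>c * L / real m\<rceil>"
  have n0: "0 < real n" using n1 by simp
  have lk: "360 \<le> l" using l(2) k3_real by linarith
  have m0: "1 \<le> m" using m(1) k3_real by linarith
  have L0: "0 < L" using F lk by (simp add: L_def)
  have c0: "0 < c" using k3 by (simp add: c_def)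
  have v0: "0 < v" using k3 c0 L0 by (simp add: v_def)
  have \<rho>0: "0 < \<rho>" using L0 e n0 p by (simp add: \<rho>_def)
  have mu0: "0 < mu p" using mu_pos p by simp
  have lp: "l = - ln p" using l p by (simp add: ln_div)
  have p_exp: "p = exp (- l)" using p lp by simp
  have p1: "p < 1" using p_exp lk by simp
  have lw: "l = - 40 * ln w" using lp p w by (simp add: ln_realpow)
  have w_exp: "w = exp (- l / 40)" using w lw by simp
  have w1: "w \<le> 1" using w_exp lk by simp
  have kw: "exp 1 * real k * w \<le> 1"
  proof -
    have "ln (real k) \<le> real k - 1" using k3 by (intro ln_le_minus_one) auto
    then have "1 + ln (real k) - l / 40 \<le> 0" using l(2) k3_real by linarith
    then have "exp (1 + ln (real k) - l / 40) \<le> 1" unfolding exp_le_one_iff .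
    moreover have "exp 1 * real k * w = exp (1 + ln (real k) - l / 40)"
    proof -
      have "exp (1 + ln (real k) - l / 40) = exp 1 * exp (ln (real k)) * exp (- l / 40)"
        by (simp flip: exp_add)
      then show ?thesis using k3 w_exp by simp
    qed
    ultimately show ?thesis by metis
  qed
  \<comment> \<open>Equivalent to 40 ln n \<le> m l. If l is at least ln n / (2 k), the bound m >=
    80 k suffices; otherwise n p^k is at least sqrt n, and the degree hypothesis forces m >= ln n /
    2.\<close>
  have nw: "real n * w ^ m \<le> 1"
  proof -
    have "40 * ln (real n) \<le> real m * l"
    proof (cases "ln (real n) / (2 * real k) \<le> l")
      case True
      have "40 * ln (real n) = (80 * real k) * (ln (real n) / (2 * real k))" using k3 by simp
      also have "\<dots> \<le> real m * l" using True m(1) n1 k3 by (intro mult_mono) auto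
      finally show ?thesis .
    next
      case False
      then have kl: "real k * l \<le> ln (real n) / 2" using k3 by (simp add: field_simps)
      have "ln (real n) / 2 \<le> exp (ln (real n) / 2)" using exp_ge_add_one_self[of "ln (real n) / 2"] by linarith
      also have "\<dots> \<le> exp (ln (real n) - real k * l)" using kl by simp
      also have "\<dots> = real n * p ^ k"
      proof -
        have "p ^ k = exp (real k * (- l))" unfolding exp_of_nat_mult using p_exp by simp
        then show ?thesis using n0 by (simp add: exp_diff exp_minus divide_inverse)
      qed
      also have "\<dots> \<le> real n * p ^ (k - 1)" using p p1 by (intro mult_left_mono power_decreasing) auto
      also have "\<dots> \<le> w ^ 4 * real m" by (rule m(2))
      also have "\<dots> \<le> 1 * real m" using w w1 by (intro mult_right_mono power_le_one) auto
      finally have "ln (real n) \<le> 2 * real m" by simp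
      then have "40 * ln (real n) \<le> real m * 80" by simp
      also have "\<dots> \<le> real m * l" using lk by (intro mult_left_mono) auto
      finally show ?thesis .
    qed
    then have "ln (real n) - real m * l / 40 \<le> 0" by simp
    then have "exp (ln (real n) - real m * l / 40) \<le> 1" unfolding exp_le_one_iff .
    moreover have "exp (ln (real n) - real m * l / 40) = real n * w ^ m"
    proof -
      have w: "w ^ m = exp (real m * (- l / 40))" unfolding exp_of_nat_mult using w_exp by simp
      have "ln (real n) - real m * l / 40 = ln (real n) + real m * (- l / 40)" by simp
      then have "exp (ln (real n) - real m * l / 40) = exp (ln (real n)) * exp (real m * (- l / 40))"
        by (simp only: exp_add)
      then show ?thesis using n0 by (simp only: w exp_ln)
    qed
    ultimately show ?thesis by metis
  qed
  have L_sq: "L\<^sup>2 \<le> \<epsilon> * mu p"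
  proof -
    have "L \<le> sqrt (\<epsilon> * mu p)" using F lk by (simp add: L_def pos_divide_le_eq)
    then have "L\<^sup>2 \<le> (sqrt (\<epsilon> * mu p))\<^sup>2" using L0 by (intro power_mono) auto
    then show ?thesis using e mu0 by simp
  qed
  have L_le_F: "L \<le> F" using F lk by (simp add: L_def field_simps)
  have rho1: "\<rho> \<le> 2 * \<epsilon>"
  proof -
    have "L \<le> 2 * \<epsilon> * (\<epsilon> * (real n * p))" using L_le_F F by (simp add: power2_eq_square mult_ac)
    then show ?thesis using e n0 p by (simp add: \<rho>_def pos_divide_le_eq)
  qed
  have rho2: "\<rho>\<^sup>2 * \<epsilon> \<le> p"
  proof -
    have "L\<^sup>2 \<le> \<epsilon> * ((real n)\<^sup>2 * p ^ k)" using L_sq mu_le[of p] p e by (meson mult_left_mono less_imp_le order_trans)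
    also have "\<dots> \<le> \<epsilon> * ((real n)\<^sup>2 * p ^ 3)"
      using e p p1 k3 by (intro mult_left_mono power_decreasing) auto
    finally have "L\<^sup>2 \<le> \<epsilon> * ((real n)\<^sup>2 * p ^ 3)" .
    then have "L\<^sup>2 * \<epsilon> \<le> \<epsilon> * ((real n)\<^sup>2 * p ^ 3) * \<epsilon>" using e by (intro mult_right_mono) auto
    also have "\<dots> = p * (\<epsilon> * (real n * p))\<^sup>2" by (simp add: power2_eq_square power3_eq_cube)
    finally have "L\<^sup>2 * \<epsilon> / (\<epsilon> * (real n * p))\<^sup>2 \<le> p"
      using e n0 p by (simp add: pos_divide_le_eq)
    then show ?thesis by (simp add: \<rho>_def power_divide)
  qed
  have rho3: "\<rho> ^ 3 \<le> 2 * p"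
  proof -
    have "\<rho> ^ 3 = \<rho>\<^sup>2 * \<rho>" by (simp add: power2_eq_square power3_eq_cube)
    also have "\<dots> \<le> \<rho>\<^sup>2 * (2 * \<epsilon>)" using rho1 by (intro mult_left_mono) auto
    also have "\<dots> \<le> 2 * p" using rho2 by simp
    finally show ?thesis .
  qed
  \<comment> \<open>That is, \<rho> is at most about p^(1/3); the weaker p^(1/6) leaves room for the
    factor 2.\<close>
  have lam: "l / 6 \<le> \<theta>"
  proof -
    have "ln (\<rho> ^ 3) \<le> ln (2 * p)" using rho3 \<rho>0 p by (subst ln_le_cancel_iff) auto
    then have "3 * ln \<rho> \<le> ln 2 - l" using \<rho>0 p lp by (simp add: ln_realpow ln_mult)
    moreover have "ln 2 \<le> (1::real)" using ln_le_minus_one[of "2::real"] by simp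
    moreover have "\<theta> = - ln \<rho>" using \<rho>0 by (simp add: \<theta>_def ln_div)
    ultimately show ?thesis using lk by linarith
  qed
  have lam1: "1 \<le> \<theta>" using lam lk by linarith
  have \<rho>_exp: "\<rho> = exp (- \<theta>)" using \<rho>0 by (simp add: \<theta>_def ln_div)
  have rho_le1: "\<rho> \<le> 1" using \<rho>_exp lam1 by simp
  let ?S = "\<lambda>s :: nat \<times> nat set set. \<Union>(snd s)"
  let ?starbad = "\<lambda>R. disjoint_tuples ?S {s \<in> stars m. ?S s \<subseteq> R} q0 \<noteq> {}"
  let ?VV = "{V. V \<subseteq> {1..n} \<and> real (card V) \<le> v}"
  let ?t = "\<epsilon> * mu p / 8"
  let ?ybad = "\<lambda>V R. ?t \<le> real (card {A \<in> H. card (A \<inter> V) = 1 \<and> A - V \<subseteq> R})"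
  have finVV: "finite ?VV" by (rule finite_subset[of _ "Pow {1..n}"]) auto
  have q0: "c * L / real m \<le> real q0" "real (q0 - 1) \<le> c * L / real m"
  proof -
    have "0 < c * L / real m" using c0 L0 m0 by simp
    then show "c * L / real m \<le> real q0" "real (q0 - 1) \<le> c * L / real m" unfolding q0_def by linarith+
  qed
  have star_bound: "Ebin n p (\<lambda>R. of_bool (?starbad R)) \<le> exp (- F / (10240 * real k ^ 4))"
  proof -
    have "Ebin n p (\<lambda>R. of_bool (?starbad R)) \<le> w ^ (m * q0)"
      using p p1 w w1 kw m0 m nw by (intro star_prob) auto
    also have "\<dots> = exp (real (m * q0) * (- l / 40))" unfolding exp_of_nat_mult using w_exp by simp
    also have "\<dots> \<le> exp (- F / (10240 * real k ^ 4))"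
    proof -
      have "c * L \<le> real (m * q0)" using q0(1) m0 by (simp add: field_simps)
      then have "c * L * (l / 40) \<le> real (m * q0) * (l / 40)" using lk by (intro mult_right_mono) auto
      moreover have "c * L * (l / 40) = F / (10240 * real k ^ 4)" using lk by (simp add: c_def L_def field_simps)
      ultimately show ?thesis by simp
    qed
    finally show ?thesis .
  qed
  have y_bound: "Ebin n p (\<lambda>R. of_bool (\<exists>V\<in>?VV. ?ybad V R)) \<le> exp (- F / 6)"
  proof -
    \<comment> \<open>The weight for counting candidate sets V. Since \<rho>^4 / 4 \<le> \<epsilon>
      p, it satisfies n x \<le> v, while - ln x stays below 6 \<theta>.\<close>
    define x where "x = real k * c * \<rho> ^ 5 / 4"
    have x0: "0 < x" using k3 c0 \<rho>0 by (simp add: x_def)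
    have kc: "real k * c = 1 / (256 * real k ^ 3)" using k3 by (simp add: c_def power_eq_if)
    have k27: "27 \<le> real k ^ 3" using power_mono[OF k3_real, of 3] by simp
    have kc1: "real k * c \<le> 1" unfolding kc using k27 by (simp add: divide_le_eq)
    have x1: "x \<le> 1"
    proof -
      have "real k * c * \<rho> ^ 5 \<le> 1 * 1" using kc1 rho_le1 \<rho>0 k3 c0 by (intro mult_mono power_le_one) auto
      then show ?thesis by (simp add: x_def)
    qed
    have xn: "real n * x \<le> v"
    proof -
      have "L = \<rho> * (\<epsilon> * (real n * p))" using e n0 p by (simp add: \<rho>_def)
      then have veq: "v = real n * (real k * c * (\<rho> * (\<epsilon> * p)))" by (simp add: v_def)
      have "(\<rho> / 2) * (\<rho> ^ 3 / 2) \<le> \<epsilon> * p" using rho1 rho3 \<rho>0 e by (intro mult_mono) auto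
      then have "\<rho> * ((\<rho> / 2) * (\<rho> ^ 3 / 2)) \<le> \<rho> * (\<epsilon> * p)" using \<rho>0 by (intro mult_left_mono) auto
      then have "\<rho> ^ 5 / 4 \<le> \<rho> * (\<epsilon> * p)" by (simp add: power_eq_if)
      then have "real n * (real k * c * (\<rho> ^ 5 / 4)) \<le> real n * (real k * c * (\<rho> * (\<epsilon> * p)))"
        using n0 k3 c0 by (intro mult_left_mono) auto
      then show ?thesis by (simp add: veq x_def)
    qed
    have lnx: "- ln x \<le> 6 * \<theta>"
    proof -
      have xeq: "x = (real k * c / 4) * \<rho> ^ 5" by (simp add: x_def)
      have "0 < real k * c / 4" using k3 c0 by simp
      then have "ln x = ln (real k * c / 4) + ln (\<rho> ^ 5)"
        unfolding xeq using \<rho>0 by (intro ln_mult_pos) auto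
      then have "ln x = ln (real k * c / 4) + 5 * ln \<rho>"
        using \<rho>0 by (simp add: ln_realpow)
      moreover have "ln \<rho> = - \<theta>" by (simp add: \<rho>_exp)
      moreover have "real k * c / 4 = 1 / (1024 * real k ^ 3)" by (simp add: kc)
      then have "ln (real k * c / 4) = - ln (1024 * real k ^ 3)" using k3 by (simp add: ln_div)
      moreover have "ln (1024 * real k ^ 3) \<le> \<theta>"
      proof -
        have a: "ln (1024 * real k ^ 3) = 10 * ln 2 + 3 * ln (real k)"
          using k3 ln_realpow[of 2 10] by (simp add: ln_mult ln_realpow)
        have b: "ln 2 \<le> (1::real)" using ln_le_minus_one[of "2::real"] by simp
        have d: "ln (real k) \<le> real k - 1" using k3 by (intro ln_le_minus_one) auto
        show ?thesis using a b d lam l(2) k3_real by linarith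
      qed
      ultimately show ?thesis by linarith
    qed
    \<comment> \<open>Twice the bound on the expected number of edges meeting V once is at most
      \<rho> times the threshold, so each step of the tuple count gains a factor \<rho> = exp (-
      \<theta>).\<close>
    have one: "Ebin n p (\<lambda>R. of_bool (?ybad V R)) \<le> exp (- 2 * L * \<theta>)" if V: "V \<in> ?VV" for V
    proof -
      define r where "r = nat \<lceil>?t / (4 * real k ^ 3 * v)\<rceil>"
      have "Ebin n p (\<lambda>R. of_bool (?ybad V R)) \<le> (2 * real k * real n * v * p ^ (k - 1) / ?t) ^ r"
        unfolding r_def using p p1 V v0 e mu0 by (intro single_touch_tail) auto
      also have "\<dots> \<le> \<rho> ^ r"
      proof (intro power_mono)
        have "16 * real k * real n * v * p ^ (k - 1) = L * real n * p ^ (k - 1) / (16 * real k * real k)"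
          using k3 by (simp add: v_def c_def field_simps power_eq_if)
        also have "\<dots> = \<rho> * (\<epsilon> * ((real n)\<^sup>2 * p ^ k)) / (16 * real k * real k)"
          using e n0 p(1) by (simp add: \<rho>_def p_pow_k power2_eq_square)
        also have "\<dots> \<le> \<rho> * (\<epsilon> * (16 * real k * mu p)) / (16 * real k * real k)"
          using mu_ge[of p] p e \<rho>0 by (intro divide_right_mono mult_left_mono) auto
        also have "\<dots> = \<rho> * \<epsilon> * mu p / real k" using k3 by (simp add: field_simps)
        also have "\<dots> \<le> \<rho> * \<epsilon> * mu p / 1" using k3 \<rho>0 e mu0 by (intro divide_left_mono) auto
        finally have "16 * real k * real n * v * p ^ (k - 1) \<le> \<rho> * (\<epsilon> * mu p)" by (simp add: mult_ac)
        then show "2 * real k * real n * v * p ^ (k - 1) / ?t \<le> \<rho>"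
          using e mu0 by (simp add: pos_divide_le_eq field_simps)
      qed (use v0 p e mu0 in auto)
      also have "\<dots> = exp (real r * (- \<theta>))" unfolding exp_of_nat_mult using \<rho>_exp by simp
      also have "\<dots> \<le> exp (- 2 * L * \<theta>)"
      proof -
        have "2 * L \<le> 8 * L" using L0 by simp
        also have "8 * L = L\<^sup>2 / (32 * real k ^ 3 * v)"
          using L0 k3 by (simp add: v_def c_def field_simps power2_eq_square power_eq_if)
        also have "\<dots> \<le> \<epsilon> * mu p / (32 * real k ^ 3 * v)" using L_sq v0 by (intro divide_right_mono) auto
        also have "\<dots> = ?t / (4 * real k ^ 3 * v)" by simp
        also have "\<dots> \<le> real r" unfolding r_def by linarith
        finally have "2 * L * \<theta> \<le> real r * \<theta>" using lam1 by (intro mult_right_mono) auto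
        then show ?thesis by simp
      qed
      finally show ?thesis .
    qed
    have "Ebin n p (\<lambda>R. of_bool (\<exists>V\<in>?VV. ?ybad V R)) \<le> (\<Sum>V\<in>?VV. Ebin n p (\<lambda>R. of_bool (?ybad V R)))"
      using p p1 finVV by (intro Ebin_union_bound) auto
    also have "\<dots> \<le> (\<Sum>V\<in>?VV. exp (- 2 * L * \<theta>))" using one by (intro sum_mono) auto
    also have "\<dots> = real (card ?VV) * exp (- 2 * L * \<theta>)" by simp
    also have "\<dots> \<le> (exp (real n * x) * x powr (- v)) * exp (- 2 * L * \<theta>)"
      using x0 x1 by (intro mult_right_mono card_small_subsets) auto
    also have "\<dots> = exp (real n * x + v * (- ln x) - 2 * L * \<theta>)"
      using x0 by (simp add: powr_def exp_add exp_diff exp_minus field_simps)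
    also have "\<dots> \<le> exp (- F / 6)"
    proof -
      \<comment> \<open>Choosing V costs at most v + 6 v \<theta> \<le> 7 v \<theta> \<le> L
        \<theta>. Of the gain 2 L \<theta> at least L \<theta> >= F/6 remains.\<close>
      have "v * (- ln x) \<le> v * (6 * \<theta>)" using lnx v0 by (intro mult_left_mono) auto
      moreover have "v \<le> v * \<theta>" using v0 lam1 by simp
      moreover have "v * (7 * \<theta>) \<le> L * \<theta>"
      proof -
        have "7 * (real k * c) \<le> 1" unfolding kc using k27 by (simp add: divide_le_eq)
        then have "7 * (real k * c) * (L * \<theta>) \<le> 1 * (L * \<theta>)" using L0 lam1 by (intro mult_right_mono) auto
        then show ?thesis by (simp add: v_def mult_ac)
      qed
      moreover have "F / 6 \<le> L * \<theta>"
      proof -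
        have "F / 6 = L * (l / 6)" using lk by (simp add: L_def)
        also have "\<dots> \<le> L * \<theta>" using lam L0 by (intro mult_left_mono) auto
        finally show ?thesis .
      qed
      ultimately have "real n * x + v * (- ln x) - 2 * L * \<theta> \<le> - (F / 6)"
        using xn by (simp add: algebra_simps)
      then show ?thesis by simp
    qed
    finally show ?thesis .
  qed
  have "Ebin n p (\<lambda>R. of_bool ((1 + \<epsilon>) * mu p \<le> X H R \<and>
      \<not> (\<exists>J. bounded_conflicts ((1 + \<epsilon> / 2) * mu p) (real k ^ 4 * real m) R J)))
    \<le> Ebin n p (\<lambda>R. of_bool (?starbad R)) + Ebin n p (\<lambda>R. of_bool (\<exists>V\<in>?VV. ?ybad V R))"
  proof (intro Ebin_le_add)
    fix R assume R: "R \<subseteq> {1..n}" and a: "(1 + \<epsilon>) * mu p \<le> X H R \<and>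
      \<not> (\<exists>J. bounded_conflicts ((1 + \<epsilon> / 2) * mu p) (real k ^ 4 * real m) R J)"
    show "?starbad R \<or> (\<exists>V\<in>?VV. ?ybad V R)"
    proof (rule ccontr)
      assume "\<not> (?starbad R \<or> (\<exists>V\<in>?VV. ?ybad V R))"
      then have ns: "disjoint_tuples ?S {s \<in> stars m. ?S s \<subseteq> R} q0 = {}" and ny: "\<And>V. V \<in> ?VV \<Longrightarrow> \<not> ?ybad V R" by auto
      obtain V where V: "V \<subseteq> {1..n}" "card V \<le> k * (m * (q0 - 1))"
        "\<forall>A\<in>{A \<in> H. A \<subseteq> R - V}. card (conflicts (\<lambda>A. A) {A \<in> H. A \<subseteq> R - V} A) \<le> k ^ 4 * m"
        using star_removal[OF R m0 ns] by blast
      let ?J = "{A \<in> H. A \<subseteq> R - V}"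
      have finV: "finite V" using V finite_subset by auto
      have "real (card V) \<le> real (k * (m * (q0 - 1)))" using V(2) unfolding of_nat_le_iff .
      also have "\<dots> = real k * (real m * real (q0 - 1))" by simp
      also have "\<dots> \<le> real k * (c * L)" using q0(2) m0 by (intro mult_left_mono) (auto simp: field_simps)
      finally have cV: "real (card V) \<le> v" by (simp add: v_def)
      then have VVV: "V \<in> ?VV" using V by simp
      \<comment> \<open>Edges with one element and edges with at least two elements in V number at
        most \<epsilon> mu / 8 each, so more than (1 + \<epsilon>/2) mu edges avoid V.\<close>
      have "{A \<in> H. A \<subseteq> R} \<subseteq> ?J \<union> ({A \<in> H. 2 \<le> card (A \<inter> V)} \<union> {A \<in> H. card (A \<inter> V) = 1 \<and> A - V \<subseteq> R})"
      proof
        fix A assume A: "A \<in> {A \<in> H. A \<subseteq> R}"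
        consider "card (A \<inter> V) = 0" | "card (A \<inter> V) = 1" | "2 \<le> card (A \<inter> V)" by linarith
        then show "A \<in> ?J \<union> ({A \<in> H. 2 \<le> card (A \<inter> V)} \<union> {A \<in> H. card (A \<inter> V) = 1 \<and> A - V \<subseteq> R})"
        proof cases
          case 1
          then have "A \<inter> V = {}" using finV by simp
          then show ?thesis using A by auto
        qed (use A in auto)
      qed
      then have "card {A \<in> H. A \<subseteq> R} \<le> card (?J \<union> ({A \<in> H. 2 \<le> card (A \<inter> V)} \<union> {A \<in> H. card (A \<inter> V) = 1 \<and> A - V \<subseteq> R}))"
        using finite_H by (intro card_mono) auto
      also have "\<dots> \<le> card ?J + (card {A \<in> H. 2 \<le> card (A \<inter> V)} + card {A \<in> H. card (A \<inter> V) = 1 \<and> A - V \<subseteq> R})"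
        by (meson add_left_mono card_Un_le order_trans)
      finally have "X H R \<le> real (card ?J) + real (card {A \<in> H. 2 \<le> card (A \<inter> V)})
          + real (card {A \<in> H. card (A \<inter> V) = 1 \<and> A - V \<subseteq> R})"
        unfolding X_def by linarith
      moreover have "real (card {A \<in> H. card (A \<inter> V) = 1 \<and> A - V \<subseteq> R}) \<le> \<epsilon> * mu p / 8"
        using ny[OF VVV] by simp
      moreover have "real (card {A \<in> H. 2 \<le> card (A \<inter> V)}) \<le> \<epsilon> * mu p / 8"
      proof -
        have "real (card {A \<in> H. 2 \<le> card (A \<inter> V)}) \<le> real ((card V)\<^sup>2 * k\<^sup>2)"
          using card_meet2[OF finV] unfolding of_nat_le_iff .
        also have "\<dots> = (real (card V))\<^sup>2 * (real k)\<^sup>2" by simp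
        also have "\<dots> \<le> v\<^sup>2 * (real k)\<^sup>2" using cV by (intro mult_right_mono power_mono) auto
        also have "\<dots> = (real k ^ 2 * c)\<^sup>2 * L\<^sup>2" by (simp add: v_def power2_eq_square)
        also have "\<dots> \<le> (1 / 8) * L\<^sup>2"
        proof (intro mult_right_mono)
          have kk: "1 \<le> real k ^ 2" using k3 by simp
          have "real k ^ 2 * c = 1 / (256 * real k ^ 2)" using k3 by (simp add: c_def power_eq_if)
          also have "\<dots> \<le> 1 / 256" using kk k3 by (intro divide_left_mono) auto
          finally have "(real k ^ 2 * c)\<^sup>2 \<le> (1 / 256)\<^sup>2" using c0 by (intro power_mono) auto
          also have "\<dots> \<le> 1 / 8" by (simp add: power2_eq_square)
          finally show "(real k ^ 2 * c)\<^sup>2 \<le> 1 / 8" .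
        qed auto
        also have "\<dots> \<le> \<epsilon> * mu p / 8" using L_sq by simp
        finally show ?thesis .
      qed
      ultimately have "(1 + \<epsilon> / 2) * mu p \<le> real (card ?J)"
        using a e mu0 by (simp add: algebra_simps)
      moreover have "\<forall>A\<in>?J. real (card (conflicts (\<lambda>A. A) ?J A)) \<le> real k ^ 4 * real m"
      proof
        fix A assume "A \<in> ?J"
        then have "real (card (conflicts (\<lambda>A. A) ?J A)) \<le> real (k ^ 4 * m)" unfolding of_nat_le_iff using V(3) by blast
        then show "real (card (conflicts (\<lambda>A. A) ?J A)) \<le> real k ^ 4 * real m" by simp
      qed
      moreover have "?J \<subseteq> {A \<in> H. A \<subseteq> R}" by auto
      ultimately show False using a unfolding bounded_conflicts_def by blast
    qed
  qed (use p p1 in auto)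
  then show ?thesis using star_bound y_bound by linarith
qed

section \<open>The upper tail\<close>

lemma bounded_conflicts_tail:
  assumes p: "0 < p" "p \<le> 1" and e: "0 < \<epsilon>" and D: "0 < D"
  shows "Ebin n p (\<lambda>R. of_bool (\<exists>J. bounded_conflicts ((1 + \<epsilon> / 2) * mu p) D R J))
    \<le> exp (- (phi \<epsilon> * mu p / (32 * D)))"
proof -
  have "Ebin n p (\<lambda>R. of_bool (\<exists>J. bounded_conflicts ((1 + \<epsilon> / 2) * mu p) D R J))
    \<le> Ebin n p (\<lambda>R. of_bool (many_sparse (\<lambda>A. A) {A \<in> H. A \<subseteq> R} ((1 + \<epsilon> / 2) * mu p) D D))"
  proof (intro Ebin_mono)
    fix R :: "nat set"
    have "many_sparse (\<lambda>A. A) {A \<in> H. A \<subseteq> R} ((1 + \<epsilon> / 2) * mu p) D D"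
      if J: "bounded_conflicts ((1 + \<epsilon> / 2) * mu p) D R J" for J
    proof -
      have "(\<Sum>A\<in>J. real (card (conflicts (\<lambda>A. A) J A))) \<le> (\<Sum>A\<in>J. D)"
        using J by (intro sum_mono) (auto simp: bounded_conflicts_def)
      then have "(\<Sum>A\<in>J. real (card (conflicts (\<lambda>A. A) J A))) \<le> D * real (card J)"
        by (simp only: sum_constant mult.commute)
      then show ?thesis using J unfolding many_sparse_def bounded_conflicts_def by blast
    qed
    then show "of_bool (\<exists>J. bounded_conflicts ((1 + \<epsilon> / 2) * mu p) D R J)
      \<le> (of_bool (many_sparse (\<lambda>A. A) {A \<in> H. A \<subseteq> R} ((1 + \<epsilon> / 2) * mu p) D D) :: real)"
      by auto
  qed (use p in auto)
  also have "\<dots> \<le> exp (- (phi \<epsilon> * mu p / (32 * D)))"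
    using D e by (intro sparse_tail p) (auto simp: algebra_simps)
  finally show ?thesis .
qed

text \<open>Either the average conflict degree is at most C, or it exceeds C and
  \<open>cherry_tail\<close> applies. The condition \<epsilon> D \<le> 4 C is what lets a maximal
  degree above C pass the crude step of the tuple count.\<close>

lemma bounded_conflicts_tail_avg:
  assumes p: "0 < p" "p \<le> 1" and e: "0 < \<epsilon>" and D: "0 < D" "\<epsilon> * D \<le> 4 * C"
    and C: "2 * real k ^ 4 \<le> C" "8 * (real k)\<^sup>2 * real n * p ^ (k - 1) \<le> C"
  shows "Ebin n p (\<lambda>R. of_bool (\<exists>J. bounded_conflicts ((1 + \<epsilon> / 2) * mu p) D R J))
    \<le> exp (- (phi \<epsilon> * mu p / (32 * C))) + exp (- (C * mu p / (64 * D\<^sup>2)))"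
proof -
  have C0: "0 < C"
  proof -
    have "0 < 2 * real k ^ 4" using k3 by simp
    then show ?thesis using C(1) by linarith
  qed
  let ?dense = "\<lambda>R. \<exists>J\<subseteq>{A \<in> H. A \<subseteq> R}. mu p \<le> real (card J) \<and>
      (\<forall>A\<in>J. real (card (conflicts (\<lambda>A. A) J A)) \<le> D) \<and>
      C * real (card J) < (\<Sum>A\<in>J. real (card (conflicts (\<lambda>A. A) J A)))"
  have m: "0 < mu p" using mu_pos p by simp
  have "Ebin n p (\<lambda>R. of_bool (\<exists>J. bounded_conflicts ((1 + \<epsilon> / 2) * mu p) D R J))
    \<le> Ebin n p (\<lambda>R. of_bool (many_sparse (\<lambda>A. A) {A \<in> H. A \<subseteq> R} ((1 + \<epsilon> / 2) * mu p) D C))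
      + Ebin n p (\<lambda>R. of_bool (?dense R))"
  proof (intro Ebin_le_add)
    fix R :: "nat set" assume "\<exists>J. bounded_conflicts ((1 + \<epsilon> / 2) * mu p) D R J"
    then obtain J where J: "J \<subseteq> {A \<in> H. A \<subseteq> R}" "(1 + \<epsilon> / 2) * mu p \<le> real (card J)"
      "\<forall>A\<in>J. real (card (conflicts (\<lambda>A. A) J A)) \<le> D" by (auto simp: bounded_conflicts_def)
    have "0 \<le> \<epsilon> / 2 * mu p" using m e by simp
    then have mJ: "mu p \<le> real (card J)" using J(2) by (simp add: algebra_simps)
    show "many_sparse (\<lambda>A. A) {A \<in> H. A \<subseteq> R} ((1 + \<epsilon> / 2) * mu p) D C \<or> ?dense R"
    proof (cases "(\<Sum>A\<in>J. real (card (conflicts (\<lambda>A. A) J A))) \<le> C * real (card J)")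
      case True
      then show ?thesis using J unfolding many_sparse_def by blast
    next
      case False
      then have "C * real (card J) < (\<Sum>A\<in>J. real (card (conflicts (\<lambda>A. A) J A)))" by simp
      then have "?dense R" using J mJ by blast
      then show ?thesis ..
    qed
  qed (use p in auto)
  also have "\<dots> \<le> exp (- (phi \<epsilon> * mu p / (32 * C))) + exp (- (C * mu p / (64 * D\<^sup>2)))"
  proof (intro add_mono sparse_tail cherry_tail p e C C0 D(1))
    have "4 * C * 1 \<le> 4 * C * (1 + \<epsilon> / 2)" using C0 e by (intro mult_left_mono) auto
    then show "\<epsilon> * D \<le> 4 * C * (1 + \<epsilon> / 2)" using D by simp
  qed (use D in auto)
  finally show ?thesis .
qed

text \<open>After star deletion the maximal degree is of order max(1, M / w^4), where M = n p^(k-1),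
  while the variance asks for max(1, M). The cases are: the former is bounded; \<epsilon> is at
  least w^4, and the clustered bound on F makes up for w^4; \<epsilon> is smaller, and the average
  degree takes over.\<close>

lemma upper_tail_small_p:
  assumes p: "0 < p" and l: "l = ln (1 / p)" "120 * real k \<le> l"
    and e: "0 < \<epsilon>" and F: "0 < F" "F \<le> sqrt (\<epsilon> * mu p) * l"
      "F \<le> 2 * phi \<epsilon> * mu p" "F \<le> 2 * phi \<epsilon> * (real n * p)"
  shows "Ebin n p (\<lambda>R. of_bool ((1 + \<epsilon>) * mu p \<le> X H R)) \<le> 4 * exp (- F / (163840 * real k ^ 5))"
proof -
  define w where "w = p powr (1 / 40)"
  define M where "M = real n * p ^ (k - 1)"
  define m where "m = nat \<lceil>max (80 * real k) (M / w ^ 4)\<rceil>"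
  define D where "D = real k ^ 4 * real m"
  define z where "z = (1 + \<epsilon> / 2) * mu p"
  have kp: "1 \<le> real k ^ 4" "1 \<le> real k ^ 5" using k3 by auto
  have n0: "0 < real n" using n1 by simp
  have lk: "360 \<le> l" using l(2) k3_real by linarith
  have w0: "0 < w" using p by (simp add: w_def)
  have pw: "p = w ^ 40" using p by (simp add: w_def powr_power)
  have mu0: "0 < mu p" using mu_pos p by simp
  have lp: "l = - ln p" using l p by (simp add: ln_div)
  have p_exp: "p = exp (- l)" using p lp by simp
  have p1: "p < 1" using p_exp lk by simp
  have lw: "l = - 40 * ln w" using lp pw w0 by (simp add: ln_realpow)
  have w1: "w \<le> 1" using lw lk ln_le_zero_iff[OF w0] by simp
  have M0: "0 < M" using n0 p by (simp add: M_def)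
  have m: "80 * real k \<le> real m" "M / w ^ 4 \<le> real m" "real m \<le> max (80 * real k) (M / w ^ 4) + 1"
  proof -
    have "0 \<le> max (80 * real k) (M / w ^ 4)" by simp
    then have "max (80 * real k) (M / w ^ 4) \<le> real m" "real m \<le> max (80 * real k) (M / w ^ 4) + 1"
      unfolding m_def by linarith+
    then show "80 * real k \<le> real m" "M / w ^ 4 \<le> real m" "real m \<le> max (80 * real k) (M / w ^ 4) + 1" by auto
  qed
  have D0: "0 < D" using k3 m(1) k3_real by (simp add: D_def)
  have ph: "0 < phi \<epsilon>" using phi_pos e by simp
  have nM: "real n * p \<le> 16 * real k * (mu p / M)"
  proof -
    have "(real n * p) * M = (real n)\<^sup>2 * p ^ k" by (simp add: M_def p_pow_k power2_eq_square)
    also have "\<dots> \<le> 16 * real k * mu p" using mu_ge p by simp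
    finally show ?thesis using M0 by (simp add: pos_le_divide_eq)
  qed
  have weak: "exp (- F / (10240 * real k ^ 4)) + exp (- F / 6) \<le> 2 * exp (- F / (163840 * real k ^ 5))"
  proof -
    have "10240 * real k ^ 4 \<le> 163840 * real k ^ 5"
    proof -
      have "real k ^ 4 \<le> real k ^ 5" using k3 by (intro power_increasing) auto
      then show ?thesis using kp(2) by linarith
    qed
    then have "F / (163840 * real k ^ 5) \<le> F / (10240 * real k ^ 4)" using F(1) k3 by (intro divide_left_mono) auto
    moreover have "F / (163840 * real k ^ 5) \<le> F / 6"
    proof -
      have "6 \<le> 163840 * real k ^ 5" using kp(2) by linarith
      then show ?thesis using F(1) k3 by (intro divide_left_mono) auto
    qed
    ultimately have "exp (- F / (10240 * real k ^ 4)) \<le> exp (- F / (163840 * real k ^ 5))"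
      "exp (- F / 6) \<le> exp (- F / (163840 * real k ^ 5))" by auto
    then show ?thesis by linarith
  qed
  have red: "Ebin n p (\<lambda>R. of_bool ((1 + \<epsilon>) * mu p \<le> X H R \<and> \<not> (\<exists>J. bounded_conflicts z D R J)))
      \<le> 2 * exp (- F / (163840 * real k ^ 5))"
  proof -
    have F2: "F \<le> 2 * \<epsilon>\<^sup>2 * (real n * p)"
    proof -
      have "2 * phi \<epsilon> * (real n * p) \<le> 2 * \<epsilon>\<^sup>2 * (real n * p)"
        using phi_le_sq[of \<epsilon>] e n0 p by (intro mult_right_mono) auto
      then show ?thesis using F(4) by linarith
    qed
    have mM: "real n * p ^ (k - 1) \<le> w ^ 4 * real m" using m(2) w0 by (simp add: M_def field_simps)
    show ?thesis unfolding z_def D_def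
      using sparse_reduction[OF p pw w0 l e F(1,2) F2 m(1) mM] weak by simp
  qed
  have main: "Ebin n p (\<lambda>R. of_bool (\<exists>J. bounded_conflicts z D R J)) \<le> 2 * exp (- F / (163840 * real k ^ 5))"
  proof -
    consider "M / w ^ 4 \<le> 80 * real k" | "80 * real k < M / w ^ 4" "w ^ 4 \<le> \<epsilon>" | "80 * real k < M / w ^ 4" "\<epsilon> < w ^ 4"
      by linarith
    then show ?thesis
    proof cases
      case 1
      then have "m = 80 * k" unfolding m_def by (simp add: max_absorb1) linarith
      then have Deq: "D = 80 * real k ^ 5" by (simp add: D_def power_eq_if)
      have "Ebin n p (\<lambda>R. of_bool (\<exists>J. bounded_conflicts z D R J)) \<le> exp (- (phi \<epsilon> * mu p / (32 * D)))"
        unfolding z_def using p p1 e D0 by (intro bounded_conflicts_tail) auto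
      also have "\<dots> \<le> exp (- F / (163840 * real k ^ 5))"
      proof -
        have "F / (163840 * real k ^ 5) \<le> F / (5120 * real k ^ 5)" using F(1) k3 by (intro divide_left_mono) auto
        also have "\<dots> \<le> (2 * phi \<epsilon> * mu p) / (5120 * real k ^ 5)" using F by (intro divide_right_mono) auto
        also have "\<dots> = phi \<epsilon> * mu p / (32 * D)" unfolding Deq by simp
        finally show ?thesis by simp
      qed
      also have "\<dots> \<le> 2 * exp (- F / (163840 * real k ^ 5))" by simp
      finally show ?thesis .
    next
      case 2
      have Dle: "D \<le> 2 * real k ^ 4 * M / w ^ 4"
      proof -
        have "real m \<le> 2 * (M / w ^ 4)" using m(3) 2 k3_real by linarith
        then have "D \<le> real k ^ 4 * (2 * (M / w ^ 4))" unfolding D_def by (intro mult_left_mono) auto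
        then show ?thesis by (simp add: mult_ac)
      qed
      \<comment> \<open>The right side is 160 phi(\<epsilon>) n p w^4, exactly the w^4 lost in
        \<open>D\<close>. The clustered term is at most of order sqrt(\<epsilon>) n w^60 / w,
        because p^(3/2) = w^60 and l \<le> 40 / w; the remaining w^15 turns sqrt(\<epsilon>) into
        phi(\<epsilon>) since w^4 \<le> \<epsilon>.\<close>
      have "F \<le> 160 * phi \<epsilon> * real n * w ^ 44"
      proof -
        have "mu p \<le> (real n)\<^sup>2 * p ^ k" using mu_le p by simp
        also have "\<dots> \<le> (real n)\<^sup>2 * p ^ 3" using p p1 k3 by (intro mult_left_mono power_decreasing) auto
        also have "p ^ 3 = (w ^ 60)\<^sup>2" unfolding pw by (simp flip: power_mult)
        finally have "\<epsilon> * mu p \<le> \<epsilon> * ((real n)\<^sup>2 * (w ^ 60)\<^sup>2)" using e by (intro mult_left_mono) auto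
        then have "sqrt (\<epsilon> * mu p) \<le> sqrt (\<epsilon> * ((real n)\<^sup>2 * (w ^ 60)\<^sup>2))" by simp
        also have "\<dots> = sqrt \<epsilon> * (real n * w ^ 60)"
        proof -
          have "sqrt (\<epsilon> * ((real n)\<^sup>2 * u\<^sup>2)) = sqrt \<epsilon> * (real n * u)" if "0 \<le> u" for u
            using that by (simp add: real_sqrt_mult)
          then show ?thesis using w0 by (metis zero_le_power less_imp_le)
        qed
        finally have s1: "sqrt (\<epsilon> * mu p) \<le> sqrt \<epsilon> * (real n * w ^ 60)" .
        have lw2: "l \<le> 40 / w"
        proof -
          have "ln (1 / w) \<le> 1 / w - 1" using w0 by (intro ln_le_minus_one) auto
          then show ?thesis using lw w0 by (simp add: ln_div)
        qed
        have "F \<le> sqrt (\<epsilon> * mu p) * l" by (rule F(2))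
        also have "\<dots> \<le> (sqrt \<epsilon> * (real n * w ^ 60)) * (40 / w)"
          using s1 lw2 lk e w0 by (intro mult_mono) auto
        also have "\<dots> = 40 * real n * w ^ 44 * (sqrt \<epsilon> * w ^ 15)"
          using w0 by (simp add: field_simps power_eq_if)
        also have "\<dots> \<le> 40 * real n * w ^ 44 * (4 * phi \<epsilon>)"
        proof (intro mult_left_mono)
          show "sqrt \<epsilon> * w ^ 15 \<le> 4 * phi \<epsilon>"
          proof (cases "1 \<le> \<epsilon>")
            case True
            have "sqrt \<epsilon> * w ^ 15 \<le> \<epsilon> * 1"
              using True w0 w1 by (intro mult_mono power_le_one sqrt_le_self) auto
            then show ?thesis using phi_ge_large[OF True] by simp
          next
            case False
            have "(sqrt \<epsilon> * w ^ 15)\<^sup>2 = \<epsilon> * w ^ 30" using e by (simp add: power_mult_distrib flip: power_mult)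
            also have "\<dots> \<le> \<epsilon> * w ^ 12" using e w0 w1 by (intro mult_left_mono power_decreasing) auto
            also have "w ^ 12 = (w ^ 4) ^ 3" by (simp flip: power_mult)
            also have "\<epsilon> * (w ^ 4) ^ 3 \<le> \<epsilon> * \<epsilon> ^ 3" using e 2 w0 by (intro mult_left_mono power_mono) auto
            also have "\<dots> = (\<epsilon>\<^sup>2)\<^sup>2" by (simp add: power_eq_if)
            finally have "sqrt \<epsilon> * w ^ 15 \<le> \<epsilon>\<^sup>2" by (rule power2_le_imp_le) simp
            then show ?thesis using phi_ge_small[of \<epsilon>] e False by simp
          qed
        qed (use n0 w0 in auto)
        finally show ?thesis by (simp add: mult_ac)
      qed
      then have "F / (163840 * real k ^ 5) \<le> (160 * phi \<epsilon> * real n * w ^ 44) / (163840 * real k ^ 5)"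
        by (intro divide_right_mono) auto
      also have "\<dots> = phi \<epsilon> * (real n * p) * w ^ 4 / (1024 * real k ^ 5)"
        unfolding pw by (simp flip: power_add)
      also have "\<dots> \<le> phi \<epsilon> * (16 * real k * (mu p / M)) * w ^ 4 / (1024 * real k ^ 5)"
        using nM ph w0 by (intro divide_right_mono mult_right_mono mult_left_mono) auto
      also have "\<dots> = phi \<epsilon> * mu p / (32 * (2 * real k ^ 4 * M / w ^ 4))"
        using k3 M0 w0 by (simp add: field_simps power_eq_if)
      also have "\<dots> \<le> phi \<epsilon> * mu p / (32 * D)" using Dle D0 ph mu0 by (intro divide_left_mono mult_pos_pos) auto
      finally have ex: "F / (163840 * real k ^ 5) \<le> phi \<epsilon> * mu p / (32 * D)" .
      have "Ebin n p (\<lambda>R. of_bool (\<exists>J. bounded_conflicts z D R J)) \<le> exp (- (phi \<epsilon> * mu p / (32 * D)))"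
        unfolding z_def using p p1 e D0 by (intro bounded_conflicts_tail) auto
      also have "\<dots> \<le> exp (- F / (163840 * real k ^ 5))" using ex by simp
      also have "\<dots> \<le> 2 * exp (- F / (163840 * real k ^ 5))" by simp
      finally show ?thesis .
    next
      case 3
      \<comment> \<open>The average degree that matches the variance, which is of order mu max(1,
        M). Since \<epsilon> is below w^4 and w^4 D is at most C, also \<epsilon> D \<le> C.\<close>
      define C where "C = 2 * real k ^ 4 * max 1 M"
      have C0: "0 < C" using k3 by (simp add: C_def)
      have CM: "2 * real k ^ 4 * M \<le> C" "2 * real k ^ 4 \<le> C"
      proof -
        have "2 * real k ^ 4 * M \<le> 2 * real k ^ 4 * max 1 M" by (intro mult_left_mono) auto
        moreover have "2 * real k ^ 4 * 1 \<le> 2 * real k ^ 4 * max 1 M" by (intro mult_left_mono) auto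
        ultimately show "2 * real k ^ 4 * M \<le> C" "2 * real k ^ 4 \<le> C" by (auto simp: C_def)
      qed
      have Dle: "w ^ 4 * D \<le> C"
      proof -
        have "real m \<le> 2 * (M / w ^ 4)" using m(3) 3 k3_real by linarith
        then have "w ^ 4 * real m \<le> 2 * M" using w0 by (simp add: field_simps)
        then have "real k ^ 4 * (w ^ 4 * real m) \<le> real k ^ 4 * (2 * M)" by (intro mult_left_mono) auto
        then show ?thesis using CM by (simp add: D_def mult_ac)
      qed
      have eD: "\<epsilon> * D \<le> C"
      proof -
        have "\<epsilon> * D \<le> w ^ 4 * D" using 3 D0 by (intro mult_right_mono) auto
        then show ?thesis using Dle by simp
      qed
      have C2: "8 * (real k)\<^sup>2 * real n * p ^ (k - 1) \<le> C"
      proof -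
        have "9 \<le> (real k)\<^sup>2" using power_mono[OF k3_real, of 2] by simp
        then have "9 * (real k)\<^sup>2 \<le> (real k)\<^sup>2 * (real k)\<^sup>2" by (intro mult_right_mono) auto
        then have "9 * (real k)\<^sup>2 \<le> real k ^ 4" by (simp flip: power_add)
        moreover have "0 \<le> (real k)\<^sup>2" by simp
        ultimately have "8 * (real k)\<^sup>2 \<le> 2 * real k ^ 4" by linarith
        then have "8 * (real k)\<^sup>2 * M \<le> 2 * real k ^ 4 * M" using M0 by (intro mult_right_mono) auto
        then have "8 * (real k)\<^sup>2 * M \<le> C" using CM by linarith
        then show ?thesis by (simp only: M_def mult.assoc)
      qed
      have FC: "F / (64 * real k ^ 5) \<le> phi \<epsilon> * mu p / C"
      proof -
        have "F \<le> 2 * phi \<epsilon> * (16 * real k * (mu p / max 1 M))"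
        proof (cases "M \<le> 1")
          case True
          have "2 * phi \<epsilon> * (1 * mu p) \<le> 2 * phi \<epsilon> * (16 * real k * mu p)"
            using ph mu0 k3_real by (intro mult_left_mono mult_right_mono) auto
          then show ?thesis using F(3) True by (simp add: max_absorb1)
        next
          case False
          have "2 * phi \<epsilon> * (real n * p) \<le> 2 * phi \<epsilon> * (16 * real k * (mu p / M))"
            using nM ph by (intro mult_left_mono) auto
          then show ?thesis using F(4) False by (simp add: max_absorb2)
        qed
        then have "F / (64 * real k ^ 5) \<le> 2 * phi \<epsilon> * (16 * real k * (mu p / max 1 M)) / (64 * real k ^ 5)"
          by (intro divide_right_mono) auto
        also have "\<dots> = phi \<epsilon> * mu p / C" using k3 by (simp add: C_def field_simps power_eq_if)
        finally show ?thesis .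
      qed
      have "Ebin n p (\<lambda>R. of_bool (\<exists>J. bounded_conflicts z D R J))
        \<le> exp (- (phi \<epsilon> * mu p / (32 * C))) + exp (- (C * mu p / (64 * D\<^sup>2)))"
        unfolding z_def using p p1 e D0 eD C0 CM C2 by (intro bounded_conflicts_tail_avg) auto
      also have "\<dots> \<le> exp (- F / (163840 * real k ^ 5)) + exp (- F / (163840 * real k ^ 5))"
      proof (intro add_mono)
        have "F / (163840 * real k ^ 5) \<le> F / (2048 * real k ^ 5)" using F(1) k3 by (intro divide_left_mono) auto
        also have "\<dots> \<le> phi \<epsilon> * mu p / (32 * C)" using FC by simp
        finally show "exp (- (phi \<epsilon> * mu p / (32 * C))) \<le> exp (- F / (163840 * real k ^ 5))" by simp
        have "F / (163840 * real k ^ 5) \<le> F / (4096 * real k ^ 5)" using F(1) k3 by (intro divide_left_mono) auto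
        also have "\<dots> \<le> phi \<epsilon> * mu p / C / 64" using FC by simp
        \<comment> \<open>From phi(\<epsilon>) D^2 \<le> (\<epsilon> D)^2 \<le> C^2 the bound for
          pairs of edges is no weaker than the main one, up to constants.\<close>
        also have "\<dots> \<le> C * mu p / (64 * D\<^sup>2)"
        proof -
          have "phi \<epsilon> * D\<^sup>2 \<le> \<epsilon>\<^sup>2 * D\<^sup>2" using phi_le_sq e by (intro mult_right_mono) auto
          also have "\<dots> = (\<epsilon> * D)\<^sup>2" by (simp add: power_mult_distrib)
          also have "\<dots> \<le> C\<^sup>2" using eD e D0 by (intro power_mono) auto
          finally have "phi \<epsilon> * D\<^sup>2 * mu p \<le> C\<^sup>2 * mu p" using mu0 by (intro mult_right_mono) auto
          then show ?thesis using C0 D0 by (simp add: field_simps power2_eq_square)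
        qed
        finally show "exp (- (C * mu p / (64 * D\<^sup>2))) \<le> exp (- F / (163840 * real k ^ 5))" by simp
      qed
      finally show ?thesis by simp
    qed
  qed
  have "Ebin n p (\<lambda>R. of_bool ((1 + \<epsilon>) * mu p \<le> X H R))
    \<le> Ebin n p (\<lambda>R. of_bool ((1 + \<epsilon>) * mu p \<le> X H R \<and> \<not> (\<exists>J. bounded_conflicts z D R J)))
      + Ebin n p (\<lambda>R. of_bool (\<exists>J. bounded_conflicts z D R J))"
    using p p1 by (intro Ebin_le_add) auto
  then show ?thesis using red main by linarith
qed

text \<open>Every edge meets at most k^2 n edges, which is comparable to n p^(k-1) when p is bounded
  below, so all edges in R can be kept.\<close>

lemma upper_tail_large_p:
  assumes p: "0 < p" "p \<le> 1" and e: "0 < \<epsilon>"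
  shows "Ebin n p (\<lambda>R. of_bool ((1 + \<epsilon>) * mu p \<le> X H R)) \<le> exp (- (phi \<epsilon> * mu p / (32 * ((real k)\<^sup>2 * real n))))"
proof -
  let ?D = "(real k)\<^sup>2 * real n"
  have mu0: "0 < mu p" using mu_pos p by simp
  have "Ebin n p (\<lambda>R. of_bool ((1 + \<epsilon>) * mu p \<le> X H R))
    \<le> Ebin n p (\<lambda>R. of_bool (\<exists>J. bounded_conflicts ((1 + \<epsilon> / 2) * mu p) ?D R J))"
  proof (intro Ebin_mono)
    fix R :: "nat set"
    have "bounded_conflicts ((1 + \<epsilon> / 2) * mu p) ?D R {A \<in> H. A \<subseteq> R}" if a: "(1 + \<epsilon>) * mu p \<le> X H R"
      unfolding bounded_conflicts_def
    proof (intro conjI ballI)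
      have "(1 + \<epsilon> / 2) * mu p \<le> (1 + \<epsilon>) * mu p" using mu0 e by (intro mult_right_mono) auto
      then show "(1 + \<epsilon> / 2) * mu p \<le> real (card {A \<in> H. A \<subseteq> R})" using a by (simp add: X_def)
      fix A assume A: "A \<in> {A \<in> H. A \<subseteq> R}"
      have "card (conflicts (\<lambda>A. A) {A \<in> H. A \<subseteq> R} A) \<le> card {B \<in> H. B \<inter> A \<noteq> {}}"
        using finite_H by (intro card_mono) (auto simp: conflicts_def)
      also have "\<dots> \<le> card A * (k * n)" using A finite_edge by (intro card_meet1) auto
      finally have "real (card (conflicts (\<lambda>A. A) {A \<in> H. A \<subseteq> R} A)) \<le> real (card A * (k * n))" unfolding of_nat_le_iff .
      then show "real (card (conflicts (\<lambda>A. A) {A \<in> H. A \<subseteq> R} A)) \<le> ?D"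
        using A H_card by (simp add: power2_eq_square mult_ac)
    qed auto
    then show "of_bool ((1 + \<epsilon>) * mu p \<le> X H R)
      \<le> (of_bool (\<exists>J. bounded_conflicts ((1 + \<epsilon> / 2) * mu p) ?D R J) :: real)" by auto
  qed (use p in auto)
  also have "\<dots> \<le> exp (- (phi \<epsilon> * mu p / (32 * ?D)))"
    using p e k3 n1 by (intro bounded_conflicts_tail) auto
  finally show ?thesis .
qed

section \<open>From the variance to the two lower bounds on the rate, and the complete upper
  tail\<close>

lemma vr_pos: "0 < p \<Longrightarrow> p < 1 \<Longrightarrow> 0 < vr p H"
  using vr_ge_mu[of p] mu_pos[of p] by (smt (verit) mult_pos_pos)

text \<open>Since phi(\<epsilon>) \<le> \<epsilon>^2, a Gaussian rate of at least 1 forces the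
  standard deviation below \<epsilon> mu. All second-moment arguments at distance \<epsilon> mu rest
  on this.\<close>

lemma vr_le_sq:
  assumes p: "0 < p" "p < 1" and e: "0 < \<epsilon>" and F: "1 \<le> phi \<epsilon> * (mu p)\<^sup>2 / vr p H"
  shows "vr p H \<le> (\<epsilon> * mu p)\<^sup>2"
proof -
  have "vr p H \<le> phi \<epsilon> * (mu p)\<^sup>2" using F vr_pos[OF p] by (simp add: pos_le_divide_eq)
  also have "\<dots> \<le> \<epsilon>\<^sup>2 * (mu p)\<^sup>2" using phi_le_sq e by (intro mult_right_mono) auto
  finally show ?thesis by (simp add: power_mult_distrib)
qed

lemma ratio_le:
  assumes p: "0 < p" "p < 1" and e: "0 < \<epsilon>"
  shows "(1 - p) * (phi \<epsilon> * (mu p)\<^sup>2 / vr p H) \<le> phi \<epsilon> * mu p"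
    and "(1 - p) * (phi \<epsilon> * (mu p)\<^sup>2 / vr p H) \<le> phi \<epsilon> * (real n * p)"
proof -
  have mu0: "0 < mu p" using mu_pos p by simp
  have v0: "0 < vr p H" using vr_pos p by simp
  have ph: "0 < phi \<epsilon>" using phi_pos e by simp
  have "(phi \<epsilon> * mu p) * ((1 - p) * mu p) \<le> (phi \<epsilon> * mu p) * vr p H"
    using vr_ge_mu[of p] p ph mu0 by (intro mult_left_mono) auto
  then show "(1 - p) * (phi \<epsilon> * (mu p)\<^sup>2 / vr p H) \<le> phi \<epsilon> * mu p"
    using v0 by (simp add: pos_divide_le_eq power2_eq_square mult_ac)
  have "(1 - p) * (mu p)\<^sup>2 \<le> (real n * p) * vr p H"
    using vr_ge_mu_sq[of p] p n1 by (simp add: pos_divide_le_eq mult_ac)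
  then have "phi \<epsilon> * ((1 - p) * (mu p)\<^sup>2) \<le> phi \<epsilon> * ((real n * p) * vr p H)" using ph by (intro mult_left_mono) auto
  then show "(1 - p) * (phi \<epsilon> * (mu p)\<^sup>2 / vr p H) \<le> phi \<epsilon> * (real n * p)"
    using v0 by (simp add: pos_divide_le_eq mult_ac)
qed

lemma upper_tail:
  assumes \<gamma>: "0 < \<gamma>" and p: "0 < p" "p \<le> 1 - \<gamma>" and e: "0 < \<epsilon>"
    and F: "F = min (phi \<epsilon> * (mu p)\<^sup>2 / vr p H) (sqrt (\<epsilon> * mu p) * ln (1 / p))" "1 \<le> F"
  shows "Ebin n p (\<lambda>R. of_bool ((1 + \<epsilon>) * mu p \<le> X H R))
    \<le> exp (- min (1 / (1310720 * real k ^ 5)) (\<gamma> * exp (- 120 * real k) ^ (k - 1) / (512 * real k ^ 3)) * F)"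
    (is "?P \<le> exp (- min ?c1 ?c2 * F)")
proof -
  have p1: "p < 1" using p \<gamma> by simp
  have mu0: "0 < mu p" using mu_pos p by simp
  have ph: "0 < phi \<epsilon>" using phi_pos e by simp
  have F1: "1 \<le> phi \<epsilon> * (mu p)\<^sup>2 / vr p H" using F by simp
  have Fr: "F \<le> phi \<epsilon> * (mu p)\<^sup>2 / vr p H" "F \<le> sqrt (\<epsilon> * mu p) * ln (1 / p)" using F(1) by auto
  have F0: "0 < F" using F(2) by simp
  show ?thesis
  proof (cases "120 * real k \<le> ln (1 / p)")
    case True
    have "p \<le> 1 / 2"
    proof -
      have "120 * 3 \<le> 120 * real k" using k3 by simp
      then have "ln p \<le> - 1" using True p by (simp add: ln_div)
      then have "p \<le> exp (- 1)" using p by (metis exp_le_cancel_iff exp_ln)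
      moreover have "2 \<le> exp (1 :: real)" using exp_ge_add_one_self[of 1] by simp
      then have "exp (- 1) \<le> (1 / 2 :: real)" by (simp add: exp_minus field_simps)
      ultimately show ?thesis by linarith
    qed
    then have "F / 2 \<le> (1 - p) * (phi \<epsilon> * (mu p)\<^sup>2 / vr p H)"
      using Fr(1) F0 mult_mono[of "1 / 2" "1 - p" F "phi \<epsilon> * (mu p)\<^sup>2 / vr p H"] by simp
    then have "F \<le> 2 * phi \<epsilon> * mu p" "F \<le> 2 * phi \<epsilon> * (real n * p)"
      using ratio_le[OF p(1) p1 e] by linarith+
    then have P4: "?P \<le> 4 * exp (- F / (163840 * real k ^ 5))"
      using True p e F0 Fr by (intro upper_tail_small_p) auto
    \<comment> \<open>The factor 4 in \<open>P4\<close> makes that bound useless for small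
      exponents. There the second-moment bound 1/2 is used: for y below 4 it is at most exp (- y/8),
      and for larger y the factor 4 \<le> e^2 is absorbed.\<close>
    have P2: "?P \<le> 1 / 2"
    proof -
      have "Ebin n p (\<lambda>R. of_bool (X H R \<ge> mu p + \<epsilon> * mu p)) \<le> 1 / 2"
      proof (rule Ebin_cantelli(1))
        show "Ebin n p (\<lambda>S. (X H S - mu p)\<^sup>2) \<le> (\<epsilon> * mu p)\<^sup>2"
          using Ebin_X_variance[of p H] vr_le_sq[OF p(1) p1 e F1] p p1 by (simp add: mu_def)
        show "Ebin n p (X H) = mu p" using Ebin_X[of p H] p p1 by (simp add: mu_def)
      qed (use p p1 e mu0 in auto)
      then show ?thesis by (simp add: algebra_simps)
    qed
    define y where "y = F / (163840 * real k ^ 5)"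
    have "?P \<le> exp (- (y / 8))"
    proof (cases "4 \<le> y")
      case True
      have "?P \<le> 4 * exp (- y)" using P4 by (simp add: y_def)
      also have "\<dots> \<le> exp 2 * exp (- y)"
        by (intro mult_right_mono exp_2_ge) auto
      also have "\<dots> = exp (2 - y)" by (simp flip: exp_add)
      also have "\<dots> \<le> exp (- (y / 8))" using True by simp
      finally show ?thesis .
    next
      case False
      note exp_minus_half_ge
      also have "exp (- (1 / 2)) \<le> exp (- (y / 8))" using False by simp
      finally show ?thesis using P2 by simp
    qed
    also have "\<dots> \<le> exp (- min ?c1 ?c2 * F)"
    proof -
      have "min ?c1 ?c2 * F \<le> ?c1 * F" using F0 by (intro mult_right_mono) auto
      also have "\<dots> = y / 8" by (simp add: y_def)
      finally show ?thesis by simp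
    qed
    finally show ?thesis .
  next
    case False
    then have "- 120 * real k \<le> ln p" using p by (simp add: ln_div)
    then have pe: "exp (- 120 * real k) \<le> p" using p by (metis exp_le_cancel_iff exp_ln)
    have "?P \<le> exp (- (phi \<epsilon> * mu p / (32 * ((real k)\<^sup>2 * real n))))"
      using p p1 e by (intro upper_tail_large_p) auto
    also have "\<dots> \<le> exp (- min ?c1 ?c2 * F)"
    proof -
      have "\<gamma> * F \<le> (1 - p) * (phi \<epsilon> * (mu p)\<^sup>2 / vr p H)"
        using Fr(1) p F0 \<gamma> by (intro mult_mono) auto
      then have gF: "\<gamma> * F \<le> phi \<epsilon> * (real n * p)" using ratio_le(2)[OF p(1) p1 e] by linarith
      have "min ?c1 ?c2 * F \<le> ?c2 * F" using F0 by (intro mult_right_mono) auto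
      also have "\<dots> = exp (- 120 * real k) ^ (k - 1) * (\<gamma> * F) / (512 * real k ^ 3)" by simp
      also have "\<dots> \<le> p ^ (k - 1) * (phi \<epsilon> * (real n * p)) / (512 * real k ^ 3)"
      proof -
        have "exp (- 120 * real k) ^ (k - 1) \<le> p ^ (k - 1)" using pe by (intro power_mono) auto
        from mult_mono[OF this gF] show ?thesis using p F0 \<gamma> by (intro divide_right_mono) auto
      qed
      also have "\<dots> = phi \<epsilon> * ((real n)\<^sup>2 * p ^ k) / (512 * real k ^ 3 * real n)"
        using n1 by (simp add: p_pow_k power2_eq_square)
      also have "\<dots> \<le> phi \<epsilon> * (16 * real k * mu p) / (512 * real k ^ 3 * real n)"
        using mu_ge[of p] p ph by (intro divide_right_mono mult_left_mono) auto
      also have "\<dots> = phi \<epsilon> * mu p / (32 * ((real k)\<^sup>2 * real n))"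
        using k3 by (simp add: field_simps power_eq_if)
      finally show ?thesis by simp
    qed
    finally show ?thesis .
  qed
qed

end

section \<open>Planting and tilting\<close>

lemma sum_Pow_power:
  fixes a b :: real
  shows "(\<Sum>S\<in>Pow {1..n}. a ^ card S * b ^ (n - card S)) = (a + b) ^ n"
proof -
  have "(\<Prod>i\<in>{1..n}. a + b) = (\<Sum>S\<in>Pow {1..n}. (\<Prod>i\<in>S. a) * (\<Prod>i\<in>{1..n} - S. b))"
    by (rule prod_add) simp
  also have "\<dots> = (\<Sum>S\<in>Pow {1..n}. a ^ card S * b ^ (n - card S))"
  proof (intro sum.cong refl)
    fix S assume "S \<in> Pow {1..n}"
    then have "S \<subseteq> {1..n}" "finite S" using finite_subset by auto
    then show "(\<Prod>i\<in>S. a) * (\<Prod>i\<in>{1..n} - S. b) = a ^ card S * b ^ (n - card S)"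
      by (simp add: card_Diff_subset)
  qed
  finally show ?thesis by simp
qed

text \<open>Cauchy-Schwarz for the density of the q-law against the p-law. Its second moment
  factorises over the n elements into 1 + (q - p)^2 / (p (1 - p)), one plus the chi-square distance
  of the two Bernoulli laws.\<close>

lemma tilting:
  assumes p: "0 < p" "p < 1" and q: "0 \<le> q" "q \<le> 1"
  shows "(Ebin n q (\<lambda>R. of_bool (P R)))\<^sup>2
    \<le> Ebin n p (\<lambda>R. of_bool (P R)) * exp (real n * ((q - p)\<^sup>2 / (p * (1 - p))))"
proof -
  define u where "u S = p ^ card S * (1 - p) ^ (n - card S)" for S :: "nat set"
  define v where "v S = q ^ card S * (1 - q) ^ (n - card S)" for S :: "nat set"
  have u0: "0 < u S" for S using p by (simp add: u_def)
  have "(\<Sum>S\<in>Pow {1..n}. (sqrt (u S) * of_bool (P S)) * (v S / sqrt (u S)))\<^sup>2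
    \<le> (\<Sum>S\<in>Pow {1..n}. (sqrt (u S) * of_bool (P S))\<^sup>2) * (\<Sum>S\<in>Pow {1..n}. (v S / sqrt (u S))\<^sup>2)"
    by (rule Cauchy_Schwarz_ineq_sum)
  moreover have "(\<Sum>S\<in>Pow {1..n}. (sqrt (u S) * of_bool (P S)) * (v S / sqrt (u S))) = Ebin n q (\<lambda>R. of_bool (P R))"
  proof -
    have "sqrt (u S) \<noteq> 0" for S using u0[of S] by simp
    then show ?thesis unfolding Ebin_def v_def[symmetric] by (intro sum.cong refl) (simp add: field_simps)
  qed
  moreover have "(\<Sum>S\<in>Pow {1..n}. (sqrt (u S) * of_bool (P S))\<^sup>2) = Ebin n p (\<lambda>R. of_bool (P R))"
    unfolding Ebin_def u_def[symmetric] using u0 less_imp_le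
    by (intro sum.cong refl) (auto simp: power_mult_distrib)
  moreover have "(\<Sum>S\<in>Pow {1..n}. (v S / sqrt (u S))\<^sup>2) = (q\<^sup>2 / p + (1 - q)\<^sup>2 / (1 - p)) ^ n"
  proof -
    have "(v S / sqrt (u S))\<^sup>2 = (q\<^sup>2 / p) ^ card S * ((1 - q)\<^sup>2 / (1 - p)) ^ (n - card S)" for S
    proof -
      have "(v S / sqrt (u S))\<^sup>2 = (v S)\<^sup>2 / u S" using u0[of S] by (simp add: power_divide)
      then show ?thesis unfolding u_def v_def
        by (simp add: power_mult_distrib power_divide power_mult[symmetric] mult.commute)
    qed
    then show ?thesis using sum_Pow_power by simp
  qed
  moreover have "(q\<^sup>2 / p + (1 - q)\<^sup>2 / (1 - p)) ^ n \<le> exp (real n * ((q - p)\<^sup>2 / (p * (1 - p))))"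
  proof -
    have "q\<^sup>2 / p + (1 - q)\<^sup>2 / (1 - p) = 1 + (q - p)\<^sup>2 / (p * (1 - p))"
      using p by (simp add: divide_simps) (simp add: power2_eq_square algebra_simps)
    also have "\<dots> \<le> exp ((q - p)\<^sup>2 / (p * (1 - p)))" by (rule exp_ge_add_one_self)
    finally have "(q\<^sup>2 / p + (1 - q)\<^sup>2 / (1 - p)) ^ n \<le> exp ((q - p)\<^sup>2 / (p * (1 - p))) ^ n"
      using p by (intro power_mono) auto
    then show ?thesis by (simp only: exp_of_nat_mult)
  qed
  moreover have "0 \<le> Ebin n p (\<lambda>R. of_bool (P R))" using p by (intro Ebin_nonneg) auto
  ultimately show ?thesis by (smt (verit) mult_left_mono)
qed

lemma planting:
  assumes p: "0 < p" "p \<le> 1" and V: "V \<subseteq> {1..n}"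
  shows "p ^ card V * Ebin n p (\<lambda>R. of_bool (P (R \<union> V))) \<le> Ebin n p (\<lambda>R. of_bool (P R))"
proof -
  have "p ^ card V * Ebin n p (\<lambda>R. of_bool (P (R \<union> V))) = Ebin n p (\<lambda>R. of_bool (V \<subseteq> R) * of_bool (P R))"
    by (rule Ebin_subset[OF p(1) V, symmetric])
  also have "\<dots> \<le> Ebin n p (\<lambda>R. of_bool (P R))" using p by (intro Ebin_mono) auto
  finally show ?thesis .
qed

text \<open>The same comparison for the sum of the laws with \<open>V t\<close> planted. The density
  \<open>W\<close> is a sum of p^(-|V t|) over the planted sets present, and its second moment
  involves only the overlaps of two planted sets.\<close>

lemma planting_second_moment:
  assumes p: "0 < p" "p \<le> 1" and T: "finite T" and V: "\<And>t. t \<in> T \<Longrightarrow> V t \<subseteq> {1..n}"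
  shows "(\<Sum>t\<in>T. Ebin n p (\<lambda>R. of_bool (P (R \<union> V t))))\<^sup>2
    \<le> Ebin n p (\<lambda>R. of_bool (P R)) * (\<Sum>t\<in>T. \<Sum>s\<in>T. (1 / p) ^ card (V t \<inter> V s))"
proof -
  define u where "u S = p ^ card S * (1 - p) ^ (n - card S)" for S :: "nat set"
  define W where "W S = (\<Sum>t\<in>T. (1 / p) ^ card (V t) * of_bool (V t \<subseteq> S))" for S
  have u0: "0 \<le> u S" for S using p by (simp add: u_def)
  have e1: "Ebin n p (\<lambda>R. of_bool (V t \<subseteq> R) * of_bool (P R)) = p ^ card (V t) * Ebin n p (\<lambda>R. of_bool (P (R \<union> V t)))"
    if "t \<in> T" for t using Ebin_subset[OF p(1) V[OF that]] by simp
  have "Ebin n p (\<lambda>R. W R * of_bool (P R))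
      = (\<Sum>t\<in>T. (1 / p) ^ card (V t) * Ebin n p (\<lambda>R. of_bool (V t \<subseteq> R) * of_bool (P R)))"
    unfolding W_def sum_distrib_right Ebin_sum mult.assoc Ebin_cmult ..
  also have "\<dots> = (\<Sum>t\<in>T. Ebin n p (\<lambda>R. of_bool (P (R \<union> V t))))"
    using p by (intro sum.cong refl) (simp add: e1 power_one_over)
  finally have E1: "Ebin n p (\<lambda>R. W R * of_bool (P R)) = (\<Sum>t\<in>T. Ebin n p (\<lambda>R. of_bool (P (R \<union> V t))))" .
  have WW: "W R * W R = (\<Sum>t\<in>T. \<Sum>s\<in>T. (1 / p) ^ (card (V t) + card (V s)) * of_bool (V t \<union> V s \<subseteq> R))" for R
    unfolding W_def sum_product by (intro sum.cong refl) (auto simp: power_add)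
  have E2': "Ebin n p (\<lambda>R. W R * W R) = (\<Sum>t\<in>T. \<Sum>s\<in>T. (1 / p) ^ card (V t \<inter> V s))"
    unfolding WW Ebin_sum Ebin_cmult
  proof (intro sum.cong refl)
    fix t s assume ts: "t \<in> T" "s \<in> T"
    have fin: "finite (V t)" "finite (V s)" using V ts finite_subset by blast+
    have "Ebin n p (\<lambda>S. of_bool (V t \<union> V s \<subseteq> S)) = p ^ card (V t \<union> V s)"
      using V ts by (intro Ebin_of_subset p) blast
    moreover have "card (V t) + card (V s) = card (V t \<union> V s) + card (V t \<inter> V s)" using fin by (rule card_Un_Int)
    ultimately show "(1 / p) ^ (card (V t) + card (V s)) * Ebin n p (\<lambda>S. of_bool (V t \<union> V s \<subseteq> S)) = (1 / p) ^ card (V t \<inter> V s)"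
      using p by (simp add: power_add power_one_over)
  qed
  have E2: "(\<Sum>S\<in>Pow {1..n}. (sqrt (u S) * W S)\<^sup>2) = (\<Sum>t\<in>T. \<Sum>s\<in>T. (1 / p) ^ card (V t \<inter> V s))"
  proof -
    have "(sqrt (u S) * W S)\<^sup>2 = u S * (W S * W S)" for S
      using u0[of S] unfolding power_mult_distrib by (simp add: power2_eq_square)
    then show ?thesis using E2' unfolding Ebin_def u_def[symmetric] by simp
  qed
  have E3: "(\<Sum>S\<in>Pow {1..n}. (sqrt (u S) * of_bool (P S))\<^sup>2) = Ebin n p (\<lambda>R. of_bool (P R))"
    unfolding Ebin_def u_def[symmetric] using u0 by (intro sum.cong refl) (auto simp: power_mult_distrib)
  have E4: "(\<Sum>S\<in>Pow {1..n}. (sqrt (u S) * of_bool (P S)) * (sqrt (u S) * W S)) = Ebin n p (\<lambda>R. W R * of_bool (P R))"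
    unfolding Ebin_def u_def[symmetric]
  proof (intro sum.cong refl)
    fix S
    have "(sqrt (u S) * of_bool (P S)) * (sqrt (u S) * W S) = (sqrt (u S) * sqrt (u S)) * (W S * of_bool (P S))" by simp
    then show "(sqrt (u S) * of_bool (P S)) * (sqrt (u S) * W S) = u S * (W S * of_bool (P S))" using u0[of S] by simp
  qed
  show ?thesis
    using Cauchy_Schwarz_ineq_sum[of "\<lambda>S. sqrt (u S) * of_bool (P S)" "\<lambda>S. sqrt (u S) * W S" "Pow {1..n}"]
    unfolding E4 E1 E2 E3 .
qed

text \<open>Chosen so that under the tilted law the standard deviation of X is at most this multiple
  of \<epsilon> mu; the factors come from the upper and lower variance bounds and from q \<le> 2
  p.\<close>

definition tilt_const :: "nat \<Rightarrow> real \<Rightarrow> real" where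
  "tilt_const k \<gamma> = sqrt (32 * real k ^ 5 * 4 ^ k / \<gamma>)"

section \<open>The regime of the lower bound: planted intervals, and tilting when n p^(k-1) is at
  least 1\<close>

locale tail_regime = almost_linear +
  fixes \<gamma> p \<epsilon> :: real
  assumes \<gamma>: "0 < \<gamma>" "\<gamma> < 1" and p: "0 < p" "p \<le> 1 - \<gamma>" and eps: "0 < \<epsilon>"
    and nonempty: "1 \<le> (1 + \<epsilon>) * mu p" "(1 + \<epsilon>) * mu p \<le> real (card H)"
    and gauss: "1 \<le> phi \<epsilon> * (mu p)\<^sup>2 / vr p H"
    and cluster: "1 \<le> sqrt (\<epsilon> * mu p) * ln (1 / p)"
begin

definition Psi1 :: real where "Psi1 = sqrt (\<epsilon> * mu p) * ln (1 / p)"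

definition Psi2 :: real where "Psi2 = phi \<epsilon> * (mu p)\<^sup>2 / vr p H"

definition Pr :: real where "Pr = Ebin n p (\<lambda>R. of_bool ((1 + \<epsilon>) * mu p \<le> X H R))"

lemma p_lt_1: "p < 1" "p \<le> 1"
  using p \<gamma> by auto

lemma mu_p_pos: "0 < mu p"
  using mu_pos p by simp

lemma phi_eps_pos: "0 < phi \<epsilon>"
  using phi_pos eps by simp

lemma Psi_ge1: "1 \<le> Psi1" "1 \<le> Psi2"
  using gauss cluster by (simp_all add: Psi1_def Psi2_def)

lemma vr_eps: "vr p H \<le> (\<epsilon> * mu p)\<^sup>2"
  using vr_le_sq p p_lt_1 eps gauss by simp

text \<open>Keeps \<epsilon> mu away from 0, so that rounding interval lengths and numbers of
  planted edges up to integers costs only a constant factor.\<close>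

lemma eps_mu_ge: "\<gamma> / 2 \<le> \<epsilon> * mu p"
proof (cases "\<epsilon> \<le> 1")
  case True
  have "\<gamma> * 1 \<le> (1 - p) * (phi \<epsilon> * (mu p)\<^sup>2 / vr p H)"
    using gauss p \<gamma> by (intro mult_mono) auto
  also have "\<dots> \<le> phi \<epsilon> * mu p" using ratio_le p p_lt_1 eps by simp
  also have "\<dots> \<le> \<epsilon>\<^sup>2 * mu p" using phi_le_sq eps mu_p_pos by (intro mult_right_mono) auto
  also have "\<dots> \<le> \<epsilon> * mu p" using True eps mu_p_pos by (simp add: power2_eq_square)
  finally show ?thesis using \<gamma> by simp
next
  case False
  then have "(1 + \<epsilon>) * mu p \<le> (2 * \<epsilon>) * mu p" using mu_p_pos by (intro mult_right_mono) auto
  then show ?thesis using nonempty \<gamma> by simp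
qed

lemma X_union_ge:
  assumes "finite V" "R \<subseteq> {1..n}"
  shows "real (card {A \<in> H. A \<subseteq> V}) + X {A \<in> H. \<not> A \<subseteq> V} R \<le> X H (R \<union> V)"
proof -
  have "card ({A \<in> H. A \<subseteq> V} \<union> {A \<in> {A \<in> H. \<not> A \<subseteq> V}. A \<subseteq> R}) \<le> card {A \<in> H. A \<subseteq> R \<union> V}"
    using finite_H by (intro card_mono) auto
  moreover have "card ({A \<in> H. A \<subseteq> V} \<union> {A \<in> {A \<in> H. \<not> A \<subseteq> V}. A \<subseteq> R})
    = card {A \<in> H. A \<subseteq> V} + card {A \<in> {A \<in> H. \<not> A \<subseteq> V}. A \<subseteq> R}"
    using finite_H by (intro card_Un_disjoint) auto
  ultimately show ?thesis unfolding X_def by linarith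
qed

text \<open>Planting an edge raises its expected contribution from p^k to 1, a gain of at least
  \<gamma>; altogether the mean rises by 2 \<epsilon> mu. With probability at least 1/2 the edges
  outside V fall short of their mean by less than \<epsilon> mu.\<close>

lemma planted_set_prob:
  assumes V: "V \<subseteq> {1..n}" and big: "2 * \<epsilon> * mu p \<le> \<gamma> * real (card {A \<in> H. A \<subseteq> V})"
  shows "1 / 2 \<le> Ebin n p (\<lambda>R. of_bool ((1 + \<epsilon>) * mu p \<le> X H (R \<union> V)))"
proof -
  let ?G = "{A \<in> H. \<not> A \<subseteq> V}"
  let ?I = "{A \<in> H. A \<subseteq> V}"
  let ?m = "real (card ?G) * p ^ k"
  let ?t = "\<epsilon> * mu p"
  have t0: "0 < ?t" using eps mu_p_pos by simp
  have cards: "card H = card ?I + card ?G"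
  proof -
    have "H = ?I \<union> ?G" by auto
    then have "card H = card (?I \<union> ?G)" by simp
    also have "\<dots> = card ?I + card ?G" using finite_H by (intro card_Un_disjoint) auto
    finally show ?thesis .
  qed
  have "Ebin n p (\<lambda>S. of_bool (X ?G S \<le> ?m - ?t)) \<le> 1 / 2"
  proof (rule Ebin_cantelli(2))
    have "Ebin n p (\<lambda>S. (X ?G S - ?m)\<^sup>2) = vr p ?G" using p p_lt_1 by (intro Ebin_X_variance) auto
    also have "\<dots> \<le> vr p H" using p p_lt_1 by (intro vr_mono) auto
    finally show "Ebin n p (\<lambda>S. (X ?G S - ?m)\<^sup>2) \<le> ?t\<^sup>2" using vr_eps by simp
    show "Ebin n p (X ?G) = ?m" using p p_lt_1 by (intro Ebin_X) auto
  qed (use p p_lt_1 t0 in auto)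
  then have "1 / 2 \<le> Ebin n p (\<lambda>S. of_bool (\<not> X ?G S \<le> ?m - ?t))"
    using p p_lt_1 by (subst Ebin_not) auto
  also have "\<dots> \<le> Ebin n p (\<lambda>R. of_bool ((1 + \<epsilon>) * mu p \<le> X H (R \<union> V)))"
  proof (intro Ebin_mono)
    fix R assume R: "R \<subseteq> {1..n}"
    have "(1 + \<epsilon>) * mu p \<le> X H (R \<union> V)" if "\<not> X ?G R \<le> ?m - ?t"
    proof -
      have "p ^ k \<le> p ^ 1" using p p_lt_1 k3 by (intro power_decreasing) auto
      then have "\<gamma> \<le> 1 - p ^ k" using p by simp
      then have "\<gamma> * real (card ?I) \<le> (1 - p ^ k) * real (card ?I)" by (intro mult_right_mono) auto
      moreover have "mu p = real (card ?I) * p ^ k + ?m" by (simp add: mu_def cards algebra_simps)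
      moreover have "real (card ?I) + X ?G R \<le> X H (R \<union> V)" using V R finite_subset by (intro X_union_ge) auto
      ultimately show ?thesis using that big by (simp add: algebra_simps)
    qed
    then show "of_bool (\<not> X ?G R \<le> ?m - ?t) \<le> (of_bool ((1 + \<epsilon>) * mu p \<le> X H (R \<union> V)) :: real)" by auto
  qed (use p p_lt_1 in auto)
  finally show ?thesis .
qed

lemma lower_cluster:
  assumes int: "\<And>L. 4 * k \<le> L \<Longrightarrow> L \<le> n \<Longrightarrow> (real L)\<^sup>2 \<le> 16 * real k * real (card {A \<in> H. A \<subseteq> {1..L}})"
  shows "exp (- ((sqrt (32 * real k / \<gamma>) + (1 + 4 * real k) / sqrt (\<gamma> / 2) + 1) * Psi1)) \<le> Pr"
proof -
  define s where "s = sqrt (\<epsilon> * mu p)"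
  \<comment> \<open>An interval of length L contains at least L^2 / (16 k) edges, and 2 \<epsilon>
    mu / \<gamma> of them are required.\<close>
  define K where "K = sqrt (32 * real k / \<gamma>)"
  define K' where "K' = K + (1 + 4 * real k) / sqrt (\<gamma> / 2)"
  define L where "L = nat \<lceil>K * s\<rceil> + 4 * k"
  have em: "0 < \<epsilon> * mu p" using eps mu_p_pos by simp
  have s0: "0 < s" using em by (simp add: s_def)
  have K0: "0 < K" using k3 \<gamma> by (simp add: K_def)
  have l0: "0 \<le> ln (1 / p)" using p p_lt_1 by (simp add: ln_div)
  have K2: "K\<^sup>2 = 32 * real k / \<gamma>" using k3 \<gamma> by (simp add: K_def)
  have Ks: "0 < K * s" using K0 s0 by simp
  have Lge: "K * s \<le> real L" "4 * k \<le> L" using Ks unfolding L_def by linarith+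
  have Lle: "real L \<le> K' * s"
  proof -
    have "real L \<le> K * s + (1 + 4 * real k)" using Ks unfolding L_def by linarith
    moreover have "1 + 4 * real k \<le> (1 + 4 * real k) / sqrt (\<gamma> / 2) * s"
    proof -
      have "sqrt (\<gamma> / 2) \<le> s" unfolding s_def using eps_mu_ge by simp
      then have "1 \<le> s / sqrt (\<gamma> / 2)" using \<gamma> by simp
      then have "(1 + 4 * real k) * 1 \<le> (1 + 4 * real k) * (s / sqrt (\<gamma> / 2))" by (intro mult_left_mono) auto
      then show ?thesis by simp
    qed
    ultimately show ?thesis by (simp add: K'_def algebra_simps)
  qed
  have "p ^ L / 2 \<le> Pr"
  proof (cases "L \<le> n")
    case True
    have "1 / 2 \<le> Ebin n p (\<lambda>R. of_bool ((1 + \<epsilon>) * mu p \<le> X H (R \<union> {1..L})))"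
    proof (intro planted_set_prob)
      have "32 * real k * (\<epsilon> * mu p) = \<gamma> * (K * s)\<^sup>2"
        using \<gamma> em by (simp add: power_mult_distrib K2 s_def)
      also have "\<dots> \<le> \<gamma> * (real L)\<^sup>2" using Lge Ks \<gamma> by (intro mult_left_mono power_mono) auto
      also have "\<dots> \<le> \<gamma> * (16 * real k * real (card {A \<in> H. A \<subseteq> {1..L}}))"
        using int[OF Lge(2) True] \<gamma> by (intro mult_left_mono) auto
      finally have "(16 * real k) * (2 * \<epsilon> * mu p) \<le> (16 * real k) * (\<gamma> * real (card {A \<in> H. A \<subseteq> {1..L}}))"
        by (simp add: mult_ac)
      then show "2 * \<epsilon> * mu p \<le> \<gamma> * real (card {A \<in> H. A \<subseteq> {1..L}})"
        by (rule mult_left_le_imp_le) (use k3 in simp)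
    qed (use True in auto)
    then have "p ^ L * (1 / 2) \<le> p ^ card {1..L} * Ebin n p (\<lambda>R. of_bool ((1 + \<epsilon>) * mu p \<le> X H (R \<union> {1..L})))"
      using p by (simp add: mult_left_mono)
    also have "\<dots> \<le> Pr" unfolding Pr_def using p p_lt_1 True by (intro planting) auto
    finally show ?thesis by simp
  next
    \<comment> \<open>If the interval does not fit, all of \<open>{1..n}\<close> is planted; it
      contains enough edges because the target does not exceed \<open>card H\<close>.\<close>
    case False
    have "p ^ L / 2 \<le> p ^ L" using p by simp
    also have "\<dots> \<le> p ^ n" using p p_lt_1 False by (intro power_decreasing) auto
    also have "\<dots> = p ^ card {1..n} * Ebin n p (\<lambda>R. of_bool ((1 + \<epsilon>) * mu p \<le> X H (R \<union> {1..n})))"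
    proof -
      have "Ebin n p (\<lambda>R. of_bool ((1 + \<epsilon>) * mu p \<le> X H (R \<union> {1..n}))) = Ebin n p (\<lambda>R. 1)"
      proof (intro Ebin_cong)
        fix R assume "R \<subseteq> {1..n}"
        then have "{A \<in> H. A \<subseteq> R \<union> {1..n}} = H" using H_sub by blast
        then show "of_bool ((1 + \<epsilon>) * mu p \<le> X H (R \<union> {1..n})) = (1 :: real)" using nonempty by (simp add: X_def)
      qed
      then show ?thesis using p p_lt_1 by (simp add: Ebin_const)
    qed
    also have "\<dots> \<le> Pr" unfolding Pr_def using p p_lt_1 by (intro planting) auto
    finally show ?thesis .
  qed
  moreover have "exp (- ((K' + 1) * Psi1)) \<le> p ^ L / 2"
  proof -
    have "exp (- ((K' + 1) * Psi1)) = exp (- (K' * Psi1)) * exp (- Psi1)"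
      unfolding exp_add[symmetric] by (simp add: algebra_simps)
    also have "\<dots> \<le> p ^ L * (1 / 2)"
    proof (intro mult_mono)
      have "p ^ L = exp (real L * ln p)" using p by (simp add: exp_of_nat_mult)
      moreover have "real L * ln (1 / p) \<le> (K' * s) * ln (1 / p)" using Lle l0 by (intro mult_right_mono)
      then have "- (K' * Psi1) \<le> real L * ln p" using p by (simp add: Psi1_def s_def ln_div mult.assoc)
      ultimately show "exp (- (K' * Psi1)) \<le> p ^ L" by simp
      have "exp (- Psi1) \<le> exp (- 1)" using Psi_ge1 by simp
      also have "\<dots> \<le> 1 / 2"
      proof -
        have "2 \<le> exp (1 :: real)" using exp_ge_add_one_self[of 1] by simp
        then show ?thesis by (simp add: exp_minus field_simps)
      qed
      finally show "exp (- Psi1) \<le> 1 / 2" .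
    qed (use p in auto)
    finally show ?thesis by simp
  qed
  ultimately show ?thesis unfolding K'_def K_def by linarith
qed

lemma Psi2_ge: "phi \<epsilon> * mu p \<le> real k ^ 4 * (1 + real n * p ^ (k - 1)) * Psi2"
proof -
  have v0: "0 < vr p H" using vr_pos p p_lt_1 by simp
  have "Psi2 * vr p H \<le> Psi2 * (real k ^ 4 * mu p * (1 + real n * p ^ (k - 1)))"
    using vr_le[of p] p p_lt_1 Psi_ge1 by (intro mult_left_mono) auto
  moreover have "Psi2 * vr p H = (phi \<epsilon> * mu p) * mu p" using v0 by (simp add: Psi2_def power2_eq_square)
  ultimately have "(phi \<epsilon> * mu p) * mu p \<le> (real k ^ 4 * (1 + real n * p ^ (k - 1)) * Psi2) * mu p"
    by (simp add: mult_ac)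
  then show ?thesis by (rule mult_right_le_imp_le) (rule mu_p_pos)
qed

abbreviation kap :: real where "kap \<equiv> tilt_const k \<gamma>"

text \<open>In this range the variance is at most of order mu^2 / (n p), so the tilting cost
  \<epsilon>^2 n p for small \<epsilon> is of the order of \<open>Psi2\<close>.\<close>

lemma dense_Psi2:
  assumes d: "1 \<le> real n * p ^ (k - 1)"
  shows "phi \<epsilon> * (real n * p) \<le> 32 * real k ^ 5 * Psi2"
proof -
  let ?M = "real n * p ^ (k - 1)"
  have M0: "0 < ?M" using d by simp
  have "(phi \<epsilon> * (real n * p)) * ?M = phi \<epsilon> * ((real n)\<^sup>2 * p ^ k)" by (simp add: p_pow_k power2_eq_square)
  also have "\<dots> \<le> phi \<epsilon> * (16 * real k * mu p)" using mu_ge p phi_eps_pos by (intro mult_left_mono) auto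
  also have "\<dots> = 16 * real k * (phi \<epsilon> * mu p)" by simp
  also have "\<dots> \<le> 16 * real k * (real k ^ 4 * (1 + ?M) * Psi2)" using Psi2_ge by (intro mult_left_mono) auto
  also have "\<dots> \<le> 16 * real k * (real k ^ 4 * (2 * ?M) * Psi2)"
    using d Psi_ge1 by (intro mult_left_mono mult_right_mono) auto
  also have "\<dots> = (32 * real k ^ 5 * Psi2) * ?M" by (simp add: power_eq_if mult_ac)
  finally show ?thesis by (rule mult_right_le_imp_le) (rule M0)
qed

lemma lower_dense_small:
  assumes d: "1 \<le> real n * p ^ (k - 1)" and e: "(1 + kap) * \<epsilon> \<le> \<gamma>"
  shows "exp (- ((2 + 128 * real k ^ 5 * (1 + kap)\<^sup>2 / \<gamma>) * Psi2)) \<le> Pr"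
proof -
  let ?M = "real n * p ^ (k - 1)"
  \<comment> \<open>The mean rises by at least \<delta> mu. The part \<epsilon> mu reaches the
    target, and the part kap \<epsilon> mu pays for one standard deviation under the tilted
    law.\<close>
  define \<delta> where "\<delta> = (1 + kap) * \<epsilon>"
  define q where "q = (1 + \<delta>) * p"
  have kap0: "0 < kap" using k3 \<gamma> by (simp add: tilt_const_def)
  have kap2: "kap\<^sup>2 = 32 * real k ^ 5 * 4 ^ k / \<gamma>" using \<gamma> by (simp add: tilt_const_def)
  have \<delta>: "0 < \<delta>" "\<delta> \<le> \<gamma>" "\<delta> \<le> 1" using kap0 eps e \<gamma> by (auto simp: \<delta>_def)
  have q0: "0 < q" using \<delta> p by (simp add: q_def)
  have q1: "q \<le> 1"
  proof -
    have "q \<le> (1 + \<gamma>) * (1 - \<gamma>)" unfolding q_def using \<delta> p by (intro mult_mono) auto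
    also have "\<dots> = 1 - \<gamma>\<^sup>2" by (simp add: power2_eq_square algebra_simps)
    also have "\<dots> \<le> 1" by simp
    finally show ?thesis .
  qed
  have q2: "q \<le> 2 * p" unfolding q_def using \<delta> p by (intro mult_right_mono) auto
  have muq: "mu q = (1 + \<delta>) ^ k * mu p" by (simp add: mu_def q_def power_mult_distrib mult_ac)
  have muq_ge: "(1 + \<epsilon>) * mu p + kap * \<epsilon> * mu p \<le> mu q"
  proof -
    have "1 + real k * \<delta> \<le> (1 + \<delta>) ^ k" using \<delta> by (intro Bernoulli_inequality) auto
    moreover have "1 * \<delta> \<le> real k * \<delta>" using k3 \<delta> by (intro mult_right_mono) auto
    ultimately have "1 + \<delta> \<le> (1 + \<delta>) ^ k" by linarith
    then have "(1 + \<delta>) * mu p \<le> mu q" unfolding muq using mu_p_pos by (intro mult_right_mono) auto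
    then show ?thesis by (simp add: \<delta>_def algebra_simps)
  qed
  have vrq: "vr q H \<le> (kap * (\<epsilon> * mu p))\<^sup>2"
  proof -
    have muq2: "mu q \<le> 2 ^ k * mu p" unfolding muq using \<delta> mu_p_pos by (intro mult_right_mono power_mono) auto
    have "1 + real n * q ^ (k - 1) \<le> 2 * (2 ^ k * ?M)"
    proof -
      have "q ^ (k - 1) \<le> (2 * p) ^ (k - 1)" using q2 q0 by (intro power_mono) auto
      also have "\<dots> \<le> 2 ^ k * p ^ (k - 1)" unfolding power_mult_distrib
        using p by (intro mult_right_mono power_increasing) auto
      finally have "real n * q ^ (k - 1) \<le> real n * (2 ^ k * p ^ (k - 1))" by (intro mult_left_mono) auto
      moreover have "1 * 1 \<le> 2 ^ k * ?M" using d by (intro mult_mono) auto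
      ultimately show ?thesis by (simp add: mult_ac)
    qed
    then have "vr q H \<le> real k ^ 4 * (2 ^ k * mu p) * (2 * (2 ^ k * ?M))"
      using muq2 mu_pos[OF q0] mu_p_pos q0
      by (intro order_trans[OF vr_le[OF q0 q1]] mult_mono) auto
    also have "\<dots> = 2 * real k ^ 4 * 4 ^ k * (mu p * ?M)"
    proof -
      have "(4 :: real) ^ k = 2 ^ k * 2 ^ k" by (simp flip: power_mult_distrib)
      then show ?thesis by (simp only: mult_ac)
    qed
    also have "\<dots> \<le> 2 * real k ^ 4 * 4 ^ k * (16 * real k * ((mu p)\<^sup>2 / (real n * p)))"
    proof (intro mult_left_mono)
      have "(mu p * ?M) * (real n * p) = mu p * ((real n)\<^sup>2 * p ^ k)" by (simp add: p_pow_k power2_eq_square)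
      also have "\<dots> \<le> mu p * (16 * real k * mu p)" using mu_ge p mu_p_pos by (intro mult_left_mono) auto
      finally have "(mu p * ?M) * (real n * p) \<le> 16 * real k * (mu p)\<^sup>2" by (simp add: power2_eq_square mult_ac)
      then show "mu p * ?M \<le> 16 * real k * ((mu p)\<^sup>2 / (real n * p))" using n1 p by (simp add: pos_le_divide_eq)
    qed auto
    also have "\<dots> = kap\<^sup>2 * (\<gamma> * (mu p)\<^sup>2 / (real n * p))"
    proof -
      have "real k ^ 5 = real k ^ 4 * real k" by (simp flip: power_Suc2)
      then show ?thesis using \<gamma> by (simp add: kap2)
    qed
    also have "\<dots> \<le> kap\<^sup>2 * vr p H"
    proof (intro mult_left_mono)
      have "\<gamma> * ((mu p)\<^sup>2 / (real n * p)) \<le> (1 - p) * ((mu p)\<^sup>2 / (real n * p))"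
        using p n1 by (intro mult_right_mono) auto
      then show "\<gamma> * (mu p)\<^sup>2 / (real n * p) \<le> vr p H" using vr_ge_mu_sq[of p] p p_lt_1 by simp
    qed auto
    also have "\<dots> \<le> kap\<^sup>2 * (\<epsilon> * mu p)\<^sup>2" using vr_eps by (intro mult_left_mono) auto
    finally show ?thesis by (simp add: power_mult_distrib)
  qed
  have "Ebin n q (\<lambda>S. of_bool (X H S \<le> mu q - kap * (\<epsilon> * mu p))) \<le> 1 / 2"
  proof (rule Ebin_cantelli(2))
    show "Ebin n q (\<lambda>S. (X H S - mu q)\<^sup>2) \<le> (kap * (\<epsilon> * mu p))\<^sup>2"
      using Ebin_X_variance[of q H] vrq q0 q1 by (simp add: mu_def)
    show "Ebin n q (X H) = mu q" using Ebin_X[of q H] q0 q1 by (simp add: mu_def)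
  qed (use q0 q1 kap0 eps mu_p_pos in auto)
  then have "1 / 2 \<le> Ebin n q (\<lambda>S. of_bool (\<not> X H S \<le> mu q - kap * (\<epsilon> * mu p)))"
    using q0 q1 by (subst Ebin_not) auto
  also have "\<dots> \<le> Ebin n q (\<lambda>R. of_bool ((1 + \<epsilon>) * mu p \<le> X H R))"
    using q0 q1 muq_ge by (intro Ebin_mono) (auto simp: algebra_simps)
  finally have "(1 / 2)\<^sup>2 \<le> (Ebin n q (\<lambda>R. of_bool ((1 + \<epsilon>) * mu p \<le> X H R)))\<^sup>2" by (intro power_mono) auto
  also have "\<dots> \<le> Pr * exp (real n * ((q - p)\<^sup>2 / (p * (1 - p))))"
    unfolding Pr_def using p p_lt_1 q0 q1 by (intro tilting) auto
  also have "\<dots> \<le> Pr * exp (128 * real k ^ 5 * (1 + kap)\<^sup>2 / \<gamma> * Psi2)"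
  proof (intro mult_left_mono)
    have qp: "q - p = \<delta> * p" by (simp add: q_def algebra_simps)
    have "real n * ((q - p)\<^sup>2 / (p * (1 - p))) = \<delta>\<^sup>2 * (real n * p) / (1 - p)"
      using p by (simp add: qp power2_eq_square)
    also have "\<dots> \<le> \<delta>\<^sup>2 * (real n * p) / \<gamma>" using p \<gamma> n1 by (intro divide_left_mono) auto
    also have "\<dots> = (1 + kap)\<^sup>2 / \<gamma> * (\<epsilon>\<^sup>2 * (real n * p))" by (simp add: \<delta>_def power_mult_distrib)
    also have "\<dots> \<le> (1 + kap)\<^sup>2 / \<gamma> * (128 * real k ^ 5 * Psi2)"
    proof (intro mult_left_mono)
      have "1 * \<epsilon> \<le> (1 + kap) * \<epsilon>" using kap0 eps by (intro mult_right_mono) auto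
      then have "\<epsilon> \<le> 1" using e \<gamma> by linarith
      then have "\<epsilon>\<^sup>2 * (real n * p) \<le> (4 * phi \<epsilon>) * (real n * p)"
        using phi_ge_small[of \<epsilon>] eps p by (intro mult_right_mono) auto
      then show "\<epsilon>\<^sup>2 * (real n * p) \<le> 128 * real k ^ 5 * Psi2" using dense_Psi2[OF d] by simp
    qed (use \<gamma> in auto)
    finally show "exp (real n * ((q - p)\<^sup>2 / (p * (1 - p)))) \<le> exp (128 * real k ^ 5 * (1 + kap)\<^sup>2 / \<gamma> * Psi2)"
      by (simp add: mult_ac)
    show "0 \<le> Pr" unfolding Pr_def using p p_lt_1 by (intro Ebin_nonneg) auto
  qed
  finally have fin: "1 / 4 \<le> Pr * exp (128 * real k ^ 5 * (1 + kap)\<^sup>2 / \<gamma> * Psi2)" by (simp add: power2_eq_square)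
  have "exp (- ((2 + 128 * real k ^ 5 * (1 + kap)\<^sup>2 / \<gamma>) * Psi2))
    = exp (- 2 * Psi2) * exp (- (128 * real k ^ 5 * (1 + kap)\<^sup>2 / \<gamma> * Psi2))"
    unfolding exp_add[symmetric] by (simp add: algebra_simps)
  also have "\<dots> \<le> (1 / 4) * exp (- (128 * real k ^ 5 * (1 + kap)\<^sup>2 / \<gamma> * Psi2))"
  proof (intro mult_right_mono)
    note exp_2_ge
    also have "exp 2 \<le> exp (2 * Psi2)" using Psi_ge1 by simp
    finally show "exp (- 2 * Psi2) \<le> 1 / 4" by (simp add: exp_minus field_simps)
  qed auto
  also have "\<dots> \<le> (Pr * exp (128 * real k ^ 5 * (1 + kap)\<^sup>2 / \<gamma> * Psi2)) * exp (- (128 * real k ^ 5 * (1 + kap)\<^sup>2 / \<gamma> * Psi2))"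
    using fin by (intro mult_right_mono) auto
  also have "\<dots> = Pr" by (simp add: mult.assoc flip: exp_add)
  finally show ?thesis .
qed

text \<open>Since mu \<le> (n p)^2 p and sqrt(p) ln (1/p) \<le> 2, the clustered rate is at most of
  order sqrt(\<epsilon>) n p. For \<epsilon> bounded below this is at most of order phi(\<epsilon>)
  n p, so planting an interval already suffices.\<close>

lemma dense_large:
  assumes d: "1 \<le> real n * p ^ (k - 1)" and e0: "0 < e0" "e0 \<le> 1" "e0 \<le> \<epsilon>"
  shows "Psi1 \<le> 256 * real k ^ 5 / e0\<^sup>2 * Psi2"
proof -
  have "mu p \<le> (real n)\<^sup>2 * p ^ k" using mu_le p by simp
  also have "\<dots> \<le> (real n)\<^sup>2 * p ^ 3" using p p_lt_1 k3 by (intro mult_left_mono power_decreasing) auto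
  also have "\<dots> = (real n * p)\<^sup>2 * p" by (simp add: power2_eq_square power3_eq_cube)
  finally have "\<epsilon> * mu p \<le> \<epsilon> * ((real n * p)\<^sup>2 * p)" using eps by (intro mult_left_mono) auto
  then have "sqrt (\<epsilon> * mu p) \<le> sqrt (\<epsilon> * ((real n * p)\<^sup>2 * p))" by simp
  also have "\<dots> = sqrt \<epsilon> * ((real n * p) * sqrt p)" using p by (simp add: real_sqrt_mult)
  finally have s1: "sqrt (\<epsilon> * mu p) \<le> sqrt \<epsilon> * ((real n * p) * sqrt p)" .
  have l: "sqrt p * ln (1 / p) \<le> 2"
  proof -
    have sp: "0 < sqrt p" using p by simp
    have "ln (1 / sqrt p) \<le> 1 / sqrt p - 1" using sp by (intro ln_le_minus_one) auto
    moreover have "ln (1 / sqrt p) = ln (1 / p) / 2" using p by (simp add: ln_div ln_sqrt)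
    ultimately have "ln (1 / p) \<le> 2 / sqrt p" by simp
    then show ?thesis using sp by (simp add: field_simps)
  qed
  have l0: "0 \<le> ln (1 / p)" using p p_lt_1 by (simp add: ln_div)
  have "Psi1 \<le> (sqrt \<epsilon> * ((real n * p) * sqrt p)) * ln (1 / p)" unfolding Psi1_def using s1 l0 by (intro mult_right_mono) auto
  also have "\<dots> = sqrt \<epsilon> * (real n * p) * (sqrt p * ln (1 / p))" by simp
  also have "\<dots> \<le> sqrt \<epsilon> * (real n * p) * 2" using l p eps by (intro mult_left_mono) auto
  also have "\<dots> \<le> (4 / e0\<^sup>2 * phi \<epsilon>) * (real n * p) * 2"
  proof (intro mult_right_mono)
    show "sqrt \<epsilon> \<le> 4 / e0\<^sup>2 * phi \<epsilon>"
    proof (cases "1 \<le> \<epsilon>")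
      case True
      have "sqrt \<epsilon> \<le> 4 * phi \<epsilon>" using phi_ge_large[OF True] sqrt_le_self[OF True] by simp
      also have "\<dots> \<le> 4 / e0\<^sup>2 * phi \<epsilon>"
        using e0 phi_eps_pos power_le_one[of e0 2] by (intro mult_right_mono) (auto simp: field_simps)
      finally show ?thesis .
    next
      case False
      have "e0\<^sup>2 \<le> \<epsilon>\<^sup>2" using e0 by (intro power_mono) auto
      also have "\<dots> \<le> 4 * phi \<epsilon>" using phi_ge_small[of \<epsilon>] eps False by simp
      finally have "1 \<le> 4 / e0\<^sup>2 * phi \<epsilon>" using e0 by (simp add: field_simps)
      moreover have "sqrt \<epsilon> \<le> 1" using False by simp
      ultimately show ?thesis by linarith
    qed
  qed (use p in auto)
  also have "\<dots> = 8 / e0\<^sup>2 * (phi \<epsilon> * (real n * p))" by simp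
  also have "\<dots> \<le> 8 / e0\<^sup>2 * (32 * real k ^ 5 * Psi2)" using dense_Psi2[OF d] by (intro mult_left_mono) auto
  also have "\<dots> = 256 * real k ^ 5 / e0\<^sup>2 * Psi2" by simp
  finally show ?thesis .
qed

end

section \<open>Planting random edges\<close>

lemma card_PiE_coord:
  assumes "finite H" "B \<subseteq> H" "i < (M::nat)"
  shows "card {T \<in> {..<M} \<rightarrow>\<^sub>E H. T i \<in> B} = card B * card H ^ (M - 1)"
proof -
  have "{T \<in> {..<M} \<rightarrow>\<^sub>E H. T i \<in> B} = (\<Pi>\<^sub>E j\<in>{..<M}. if j = i then B else H)"
    using assms by (auto simp: PiE_iff extensional_def subset_iff split: if_splits)
  then have "card {T \<in> {..<M} \<rightarrow>\<^sub>E H. T i \<in> B} = (\<Prod>j<M. card (if j = i then B else H))"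
    by (simp add: card_PiE)
  also have "\<dots> = card B * (\<Prod>j\<in>{..<M} - {i}. card H)"
    using assms by (subst prod.remove[of _ i]) (auto intro!: prod.cong)
  finally show ?thesis using assms by simp
qed

lemma card_PiE_coord_eq:
  assumes "finite H" "i < (M::nat)" "j < M" "i \<noteq> j"
  shows "card {T \<in> {..<M} \<rightarrow>\<^sub>E H. T i = T j} \<le> card H ^ (M - 1)"
proof -
  let ?S = "{T \<in> {..<M} \<rightarrow>\<^sub>E H. T i = T j}"
  let ?r = "\<lambda>T. restrict T ({..<M} - {i})"
  have "inj_on ?r ?S"
  proof (intro inj_onI)
    fix T T' assume T: "T \<in> ?S" "T' \<in> ?S" "?r T = ?r T'"
    have eq: "T l = T' l" if "l < M" "l \<noteq> i" for l using fun_cong[OF T(3), of l] that by simp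
    have "T i = T' i" using T(1,2) eq[of j] assms by simp
    then have all: "T l = T' l" if "l < M" for l using eq[of l] that by (cases "l = i") auto
    have m: "T \<in> {..<M} \<rightarrow>\<^sub>E H" "T' \<in> {..<M} \<rightarrow>\<^sub>E H" using T(1,2) by simp_all
    show "T = T'" by (rule PiE_ext[OF m]) (simp add: all)
  qed
  then have "card ?S = card (?r ` ?S)" by (simp add: card_image)
  also have "\<dots> \<le> card (({..<M} - {i}) \<rightarrow>\<^sub>E H)"
  proof (intro card_mono)
    show "finite (({..<M} - {i}) \<rightarrow>\<^sub>E H)" using assms(1) by (intro finite_PiE) auto
    show "?r ` ?S \<subseteq> ({..<M} - {i}) \<rightarrow>\<^sub>E H"
    proof
      fix f assume "f \<in> ?r ` ?S"
      then obtain T where T: "T \<in> {..<M} \<rightarrow>\<^sub>E H" "f = ?r T" by blast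
      show "f \<in> ({..<M} - {i}) \<rightarrow>\<^sub>E H" unfolding T(2) using T(1) by (intro restrict_PiE_iff[THEN iffD2] ballI PiE_mem[OF T(1)]) simp
    qed
  qed
  also have "\<dots> = card H ^ (M - 1)" using assms by (simp add: card_PiE)
  finally show ?thesis .
qed

context almost_linear
begin

text \<open>If some T i shares two or more elements with A, the summand is bounded by p^(-k), and a
  union bound over i counts these tuples. Otherwise the summand is a product over i of factors 1 or
  1/p, whose sum factorises; at most k^2 n edges give the factor 1/p.\<close>

lemma overlap_sum_le:
  assumes p: "0 < p" "p \<le> 1" and A: "A \<in> H"
  shows "(\<Sum>T\<in>{..<M} \<rightarrow>\<^sub>E H. (1 / p) ^ card ((\<Union>i<M. T i) \<inter> A))
    \<le> (1 / p) ^ k * (real M * (real k ^ 4 * real (card H) ^ (M - 1))) + (real (card H) + (real k)\<^sup>2 * real n / p) ^ M"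
proof -
  let ?T = "{..<M} \<rightarrow>\<^sub>E H"
  define g where "g B = (if B \<inter> A = {} then 1 else 1 / p)" for B :: "nat set"
  have fA: "finite A" "card A = k" using A finite_edge H_card by auto
  have q1: "1 \<le> 1 / p" using p by simp
  have finT: "finite ?T" using finite_H by (intro finite_PiE) auto
  have "(\<Sum>T\<in>?T. (1 / p) ^ card ((\<Union>i<M. T i) \<inter> A))
    \<le> (\<Sum>T\<in>?T. (1 / p) ^ k * (\<Sum>i<M. of_bool (2 \<le> card (T i \<inter> A))) + (\<Prod>i<M. g (T i)))"
  proof (intro sum_mono)
    fix T assume T: "T \<in> ?T"
    show "(1 / p) ^ card ((\<Union>i<M. T i) \<inter> A) \<le> (1 / p) ^ k * (\<Sum>i<M. of_bool (2 \<le> card (T i \<inter> A))) + (\<Prod>i<M. g (T i))"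
    proof (cases "\<exists>i<M. 2 \<le> card (T i \<inter> A)")
      case True
      then obtain i where i: "i < M" "2 \<le> card (T i \<inter> A)" by blast
      have "card ((\<Union>i<M. T i) \<inter> A) \<le> k" using fA card_mono[of A "(\<Union>i<M. T i) \<inter> A"] by auto
      then have "(1 / p) ^ card ((\<Union>i<M. T i) \<inter> A) \<le> (1 / p) ^ k * 1" using q1 by (simp add: power_increasing)
      also have "\<dots> \<le> (1 / p) ^ k * (\<Sum>i<M. of_bool (2 \<le> card (T i \<inter> A)))"
      proof (intro mult_left_mono)
        have "(1 :: real) = (\<Sum>i\<in>{i}. of_bool (2 \<le> card (T i \<inter> A)))" using i by simp
        also have "\<dots> \<le> (\<Sum>i<M. of_bool (2 \<le> card (T i \<inter> A)))" using i by (intro sum_mono2) auto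
        finally show "(1 :: real) \<le> (\<Sum>i<M. of_bool (2 \<le> card (T i \<inter> A)))" .
      qed (use p in auto)
      also have "\<dots> \<le> (1 / p) ^ k * (\<Sum>i<M. of_bool (2 \<le> card (T i \<inter> A))) + (\<Prod>i<M. g (T i))"
        using p by (simp add: g_def prod_nonneg)
      finally show ?thesis .
    next
      case False
      have "(\<Union>i<M. T i) \<inter> A = (\<Union>i<M. T i \<inter> A)" by auto
      then have "card ((\<Union>i<M. T i) \<inter> A) \<le> (\<Sum>i<M. card (T i \<inter> A))"
        using card_UN_le[of "{..<M}" "\<lambda>i. T i \<inter> A"] by simp
      then have "(1 / p) ^ card ((\<Union>i<M. T i) \<inter> A) \<le> (1 / p) ^ (\<Sum>i<M. card (T i \<inter> A))"
        using q1 by (intro power_increasing) auto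
      also have "\<dots> = (\<Prod>i<M. (1 / p) ^ card (T i \<inter> A))" by (rule power_sum)
      also have "\<dots> = (\<Prod>i<M. g (T i))"
      proof (intro prod.cong refl)
        fix i assume "i \<in> {..<M}"
        then have "card (T i \<inter> A) = 0 \<or> card (T i \<inter> A) = 1" using False by force
        then show "(1 / p) ^ card (T i \<inter> A) = g (T i)" using fA by (auto simp: g_def)
      qed
      also have "\<dots> \<le> (1 / p) ^ k * (\<Sum>i<M. of_bool (2 \<le> card (T i \<inter> A))) + (\<Prod>i<M. g (T i))"
        using p by (simp add: sum_nonneg)
      finally show ?thesis .
    qed
  qed
  also have "\<dots> = (1 / p) ^ k * (\<Sum>T\<in>?T. \<Sum>i<M. of_bool (2 \<le> card (T i \<inter> A))) + (\<Sum>T\<in>?T. \<Prod>i<M. g (T i))"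
    by (simp add: sum.distrib sum_distrib_left)
  also have "\<dots> \<le> (1 / p) ^ k * (real M * (real k ^ 4 * real (card H) ^ (M - 1))) + (real (card H) + (real k)\<^sup>2 * real n / p) ^ M"
  proof (intro add_mono mult_left_mono)
    have "(\<Sum>T\<in>?T. \<Sum>i<M. of_bool (2 \<le> card (T i \<inter> A))) = (\<Sum>i<M. \<Sum>T\<in>?T. of_bool (2 \<le> card (T i \<inter> A)) :: real)"
      by (rule sum.swap)
    also have "\<dots> \<le> (\<Sum>i<M. real k ^ 4 * real (card H) ^ (M - 1))"
    proof (intro sum_mono)
      fix i assume i: "i \<in> {..<M}"
      let ?B = "{B \<in> H. 2 \<le> card (B \<inter> A)}"
      have "(\<Sum>T\<in>?T. of_bool (2 \<le> card (T i \<inter> A)) :: real) = real (card (?T \<inter> {T. 2 \<le> card (T i \<inter> A)}))"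
        using finT by (simp add: of_bool_def sum.If_cases)
      also have "?T \<inter> {T. 2 \<le> card (T i \<inter> A)} = {T \<in> ?T. T i \<in> ?B}" using i by (auto intro: PiE_mem)
      also have "card \<dots> = card ?B * card H ^ (M - 1)" using i finite_H by (intro card_PiE_coord) auto
      also have "card ?B \<le> k\<^sup>2 * k\<^sup>2" using card_meet2[OF fA(1)] fA(2) by simp
      also have "k\<^sup>2 * k\<^sup>2 = k ^ 4" by (simp flip: power_add)
      finally have "(\<Sum>T\<in>?T. of_bool (2 \<le> card (T i \<inter> A)) :: real) \<le> real (k ^ 4 * card H ^ (M - 1))"
        by (simp add: mult_right_mono del: of_nat_mult of_nat_power)
      then show "(\<Sum>T\<in>?T. of_bool (2 \<le> card (T i \<inter> A)) :: real) \<le> real k ^ 4 * real (card H) ^ (M - 1)"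
        by (simp only: of_nat_mult of_nat_power)
    qed
    finally show "(\<Sum>T\<in>?T. \<Sum>i<M. of_bool (2 \<le> card (T i \<inter> A)) :: real) \<le> real M * (real k ^ 4 * real (card H) ^ (M - 1))"
      by simp
    have "(\<Sum>T\<in>?T. \<Prod>i<M. g (T i)) = (\<Prod>i<M. \<Sum>B\<in>H. g B)"
      using finite_H by (subst prod_sum_PiE) auto
    also have "\<dots> = (\<Sum>B\<in>H. g B) ^ M" by simp
    also have "\<dots> \<le> (real (card H) + (real k)\<^sup>2 * real n / p) ^ M"
    proof (intro power_mono sum_nonneg)
      have "(\<Sum>B\<in>H. g B) \<le> (\<Sum>B\<in>H. 1 + 1 / p * of_bool (B \<inter> A \<noteq> {}))"
        using p by (intro sum_mono) (auto simp: g_def)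
      also have "\<dots> = real (card H) + 1 / p * real (card {B \<in> H. B \<inter> A \<noteq> {}})"
        using finite_H by (simp add: sum.distrib sum_distrib_left[symmetric] of_bool_def sum.If_cases Collect_conj_eq sum_divide_distrib[symmetric])
      also have "\<dots> \<le> real (card H) + 1 / p * ((real k)\<^sup>2 * real n)"
      proof (intro add_left_mono mult_left_mono)
        have "real (card {B \<in> H. B \<inter> A \<noteq> {}}) \<le> real (card A * (k * n))"
          unfolding of_nat_le_iff by (rule card_meet1[OF fA(1)])
        then show "real (card {B \<in> H. B \<inter> A \<noteq> {}}) \<le> (real k)\<^sup>2 * real n"
          using fA(2) by (simp add: power2_eq_square mult_ac)
      qed (use p in auto)
      finally show "(\<Sum>B\<in>H. g B) \<le> real (card H) + (real k)\<^sup>2 * real n / p" by simp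
    qed (use p in \<open>auto simp: g_def\<close>)
    finally show "(\<Sum>T\<in>?T. \<Prod>i<M. g (T i)) \<le> (real (card H) + (real k)\<^sup>2 * real n / p) ^ M" .
  qed (use p in auto)
  finally show ?thesis .
qed

text \<open>Planting \<open>M\<close> uniformly random edges costs \<open>(1 + O(M / \<mu>))\<^sup>M\<close> in the second moment once the
  atypical edge tuples, whose union already spans many near-complete edges, are discarded.\<close>

lemma planted_edges:
  fixes M :: nat and P :: "nat set \<Rightarrow> bool"
  assumes p: "0 < p" "p \<le> 1" and sp: "real n * p ^ (k - 1) \<le> 1" and M: "1 \<le> M" "real M \<le> c * (real n * p)"
    and avg: "real (card H) ^ M / 2 \<le> (\<Sum>T\<in>{..<M} \<rightarrow>\<^sub>E H. Ebin n p (\<lambda>R. of_bool (P (R \<union> (\<Union>i<M. T i)))))"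
  shows "1 / 16 \<le> Ebin n p (\<lambda>R. of_bool (P R)) *
    (1 + 4 * (real k ^ 4 + (real k)\<^sup>2 * exp (16 * real k ^ 3 * c)) * real M / mu p) ^ M"
proof -
  let ?T = "{..<M} \<rightarrow>\<^sub>E H"
  let ?V = "\<lambda>T :: nat \<Rightarrow> nat set. (\<Union>i<M. T i)"
  define N where "N = real (card H)"
  define K where "K = real k ^ 4 + (real k)\<^sup>2 * exp (16 * real k ^ 3 * c)"
  define S where "S T = (\<Sum>A\<in>H. (1 / p) ^ card (?V T \<inter> A) - 1)" for T
  \<comment> \<open>Four times the bound for the average of \<open>S\<close>, so that Markov
    discards at most a quarter of the tuples. As the planted events have average probability at
    least 1/2, a quarter of the total remains.\<close>
  define B where "B = 4 * K * real M / p ^ k"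
  have N0: "0 < N" using card_H_pos by (simp add: N_def)
  have n0: "0 < real n" using n1 by simp
  have K0: "0 < K" using k3 by (simp add: K_def add_pos_pos)
  have B0: "0 < B" using K0 M p by (simp add: B_def)
  have q1: "1 \<le> 1 / p" using p by simp
  have finT: "finite ?T" using finite_H by (intro finite_PiE) auto
  have cT: "real (card ?T) = N ^ M" by (simp add: card_PiE N_def)
  have V_sub: "?V T \<subseteq> {1..n}" if "T \<in> ?T" for T
  proof (intro UN_least)
    fix i assume "i \<in> {..<M}"
    then have "T i \<in> H" using PiE_mem[OF that] by simp
    then show "T i \<subseteq> {1..n}" by (rule H_sub)
  qed
  define x where "x = real M * ((real k)\<^sup>2 * real n / (p * N))"
  have x0: "0 \<le> x" using p N0 by (simp add: x_def)
  have x_le: "x \<le> 16 * real k ^ 3 * c"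
  proof -
    have "real n / N \<le> 16 * real k / real n"
    proof -
      have "real n * real n \<le> 16 * real k * N" using H_lower by (simp add: N_def power2_eq_square)
      then show ?thesis using n0 N0 by (simp add: field_simps)
    qed
    have "x = real M * ((real k)\<^sup>2 / p) * (real n / N)" by (simp add: x_def)
    also have "\<dots> \<le> real M * ((real k)\<^sup>2 / p) * (16 * real k / real n)"
      using \<open>real n / N \<le> 16 * real k / real n\<close> p by (intro mult_left_mono) auto
    also have "\<dots> = (16 * real k ^ 3) * (real M / (real n * p))" by (simp add: power2_eq_square power3_eq_cube mult_ac)
    also have "\<dots> \<le> (16 * real k ^ 3) * c" using M(2) n0 p by (intro mult_left_mono) (auto simp: pos_divide_le_eq)
    finally show ?thesis .
  qed
  have sumS: "(\<Sum>T\<in>?T. S T) \<le> N ^ M * (K * real M / p ^ k)"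
  proof -
    have one: "(\<Sum>T\<in>?T. (1 / p) ^ card (?V T \<inter> A) - 1) \<le> N ^ M * (real M * real k ^ 4 / (N * p ^ k) + x * exp (16 * real k ^ 3 * c))"
      if A: "A \<in> H" for A
    proof -
      have "(\<Sum>T\<in>?T. (1 / p) ^ card (?V T \<inter> A) - 1) = (\<Sum>T\<in>?T. (1 / p) ^ card (?V T \<inter> A)) - N ^ M"
        by (simp add: sum_subtractf cT)
      also have "\<dots> \<le> (1 / p) ^ k * (real M * (real k ^ 4 * N ^ (M - 1))) + (N + (real k)\<^sup>2 * real n / p) ^ M - N ^ M"
        using overlap_sum_le[OF p A, of M] by (simp add: N_def)
      also have "(1 / p) ^ k * (real M * (real k ^ 4 * N ^ (M - 1))) = N ^ M * (real M * real k ^ 4 / (N * p ^ k))"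
      proof -
        have "N ^ M = N * N ^ (M - 1)" using M(1) by (simp flip: power_Suc)
        then show ?thesis using N0 by (simp add: power_one_over)
      qed
      also have "(N + (real k)\<^sup>2 * real n / p) ^ M \<le> N ^ M * (1 + x * exp (16 * real k ^ 3 * c))"
      proof -
        have "N + (real k)\<^sup>2 * real n / p = N * (1 + (real k)\<^sup>2 * real n / (p * N))"
          using N0 by (simp add: algebra_simps)
        then have "(N + (real k)\<^sup>2 * real n / p) ^ M = N ^ M * (1 + (real k)\<^sup>2 * real n / (p * N)) ^ M"
          by (simp add: power_mult_distrib)
        also have "\<dots> \<le> N ^ M * exp ((real k)\<^sup>2 * real n / (p * N)) ^ M"
          using p N0 by (intro mult_left_mono power_mono exp_ge_add_one_self) auto
        also have "\<dots> = N ^ M * exp x" unfolding x_def by (simp only: exp_of_nat_mult)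
        \<comment> \<open>Linearising e^x on the bounded range of x keeps a factor proportional to
          M. This is why each planted edge costs 1 + O(M / mu) and not merely a constant.\<close>
        also have "\<dots> \<le> N ^ M * (1 + x * exp (16 * real k ^ 3 * c))"
        proof (intro mult_left_mono)
          have "(1 - x) * exp x \<le> exp (- x) * exp x" using exp_ge_add_one_self[of "- x"] by (intro mult_right_mono) auto
          then have "exp x \<le> 1 + x * exp x" by (simp add: algebra_simps flip: exp_add)
          also have "x * exp x \<le> x * exp (16 * real k ^ 3 * c)" using x_le x0 by (intro mult_left_mono) auto
          finally show "exp x \<le> 1 + x * exp (16 * real k ^ 3 * c)" by simp
        qed (use N0 in auto)
        finally show ?thesis .
      qed
      finally show ?thesis by (simp add: algebra_simps)
    qed
    have "(\<Sum>T\<in>?T. S T) = (\<Sum>A\<in>H. \<Sum>T\<in>?T. (1 / p) ^ card (?V T \<inter> A) - 1)"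
      unfolding S_def by (rule sum.swap)
    also have "\<dots> \<le> (\<Sum>A\<in>H. N ^ M * (real M * real k ^ 4 / (N * p ^ k) + x * exp (16 * real k ^ 3 * c)))"
      using one by (intro sum_mono)
    also have "\<dots> = N ^ M * (N * (real M * real k ^ 4 / (N * p ^ k)) + N * x * exp (16 * real k ^ 3 * c))"
      by (simp add: N_def algebra_simps)
    also have "\<dots> \<le> N ^ M * (real M * real k ^ 4 / p ^ k + (real M * (real k)\<^sup>2 / p ^ k) * exp (16 * real k ^ 3 * c))"
    proof (intro mult_left_mono add_mono mult_right_mono)
      show "N * (real M * real k ^ 4 / (N * p ^ k)) \<le> real M * real k ^ 4 / p ^ k" using N0 by simp
      have "N * x = real M * (real k)\<^sup>2 * (real n / p)" using N0 by (simp add: x_def)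
      also have "\<dots> \<le> real M * (real k)\<^sup>2 * (1 / p ^ k)"
      proof (intro mult_left_mono)
        show "real n / p \<le> 1 / p ^ k" using sp p by (simp add: p_pow_k field_simps)
      qed auto
      finally show "N * x \<le> real M * (real k)\<^sup>2 / p ^ k" by simp
    qed (use N0 in auto)
    also have "\<dots> = N ^ M * (K * real M / p ^ k)" by (simp add: K_def add_divide_distrib algebra_simps)
    finally show ?thesis .
  qed
  have S0: "0 \<le> S T" for T unfolding S_def using q1 by (intro sum_nonneg) (simp add: one_le_power)
  define G where "G = {T \<in> ?T. S T \<le> B}"
  have finG: "finite G" using finT by (simp add: G_def)
  have bad: "real (card (?T - G)) \<le> N ^ M / 4"
  proof -
    have "real (card (?T - G)) * B = (\<Sum>T\<in>?T - G. B)" by simp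
    also have "\<dots> \<le> (\<Sum>T\<in>?T - G. S T)" by (intro sum_mono) (auto simp: G_def)
    also have "\<dots> \<le> (\<Sum>T\<in>?T. S T)" using finT S0 by (intro sum_mono2) auto
    also have "\<dots> \<le> (N ^ M / 4) * B" using sumS by (simp add: B_def)
    finally show ?thesis using B0 by (rule mult_right_le_imp_le)
  qed
  let ?E = "\<lambda>T. Ebin n p (\<lambda>R. of_bool (P (R \<union> ?V T)))"
  have E1: "?E T \<le> 1" for T using p by (intro Ebin_of_bool_le_1) auto
  have sumG: "N ^ M / 4 \<le> (\<Sum>T\<in>G. ?E T)"
  proof -
    have "(\<Sum>T\<in>?T. ?E T) = (\<Sum>T\<in>G. ?E T) + (\<Sum>T\<in>?T - G. ?E T)"
      using finT by (subst sum.subset_diff[of G ?T]) (auto simp: G_def)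
    moreover have "(\<Sum>T\<in>?T - G. ?E T) \<le> (\<Sum>T\<in>?T - G. 1)" using E1 by (intro sum_mono)
    ultimately show ?thesis using avg bad by (simp add: N_def)
  qed
  have second: "(\<Sum>T\<in>G. \<Sum>T'\<in>G. (1 / p) ^ card (?V T \<inter> ?V T')) \<le> N ^ M * (N ^ M * (1 + 4 * K * real M / mu p) ^ M)"
  proof -
    have "(\<Sum>T'\<in>G. (1 / p) ^ card (?V T \<inter> ?V T')) \<le> N ^ M * (1 + 4 * K * real M / mu p) ^ M" if T: "T \<in> G" for T
    proof -
      have "(\<Sum>T'\<in>G. (1 / p) ^ card (?V T \<inter> ?V T')) \<le> (\<Sum>T'\<in>?T. (1 / p) ^ card (?V T \<inter> ?V T'))"
        using finT p by (intro sum_mono2) (auto simp: G_def)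
      \<comment> \<open>With T fixed, bounding the overlap by the sum of the overlaps with the
        single edges T' i makes the sum over T' factorise into the M-th power of N + S T, and S T is
        at most \<open>B\<close> on \<open>G\<close>.\<close>
      also have "\<dots> \<le> (\<Sum>T'\<in>?T. \<Prod>i<M. (1 / p) ^ card (?V T \<inter> T' i))"
      proof (intro sum_mono)
        fix T'
        have "?V T \<inter> ?V T' = (\<Union>i<M. ?V T \<inter> T' i)" by auto
        then have "card (?V T \<inter> ?V T') \<le> (\<Sum>i<M. card (?V T \<inter> T' i))"
          using card_UN_le[of "{..<M}" "\<lambda>i. ?V T \<inter> T' i"] by simp
        then show "(1 / p) ^ card (?V T \<inter> ?V T') \<le> (\<Prod>i<M. (1 / p) ^ card (?V T \<inter> T' i))"
          unfolding power_sum[symmetric] using q1 by (intro power_increasing) auto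
      qed
      also have "\<dots> = (\<Prod>i<M. \<Sum>A\<in>H. (1 / p) ^ card (?V T \<inter> A))"
        using finite_H by (subst prod_sum_PiE) auto
      also have "\<dots> = (\<Sum>A\<in>H. (1 / p) ^ card (?V T \<inter> A)) ^ M" by simp
      also have "\<dots> = (N + S T) ^ M" by (simp add: S_def N_def sum_subtractf)
      also have "\<dots> \<le> (N + B) ^ M" using T S0 N0 by (intro power_mono) (auto simp: G_def)
      also have "N + B = N * (1 + 4 * K * real M / mu p)"
        using N0 by (simp add: B_def mu_def N_def[symmetric] algebra_simps)
      finally show ?thesis by (simp add: power_mult_distrib)
    qed
    then have "(\<Sum>T\<in>G. \<Sum>T'\<in>G. (1 / p) ^ card (?V T \<inter> ?V T')) \<le> (\<Sum>T\<in>G. N ^ M * (1 + 4 * K * real M / mu p) ^ M)"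
      by (intro sum_mono)
    also have "\<dots> = real (card G) * (N ^ M * (1 + 4 * K * real M / mu p) ^ M)" by simp
    also have "\<dots> \<le> N ^ M * (N ^ M * (1 + 4 * K * real M / mu p) ^ M)"
    proof (intro mult_right_mono)
      have "real (card G) \<le> real (card ?T)" using finT by (intro of_nat_mono card_mono) (auto simp: G_def)
      then show "real (card G) \<le> N ^ M" by (simp add: cT)
    qed (use N0 K0 mu_pos[of p] p in auto)
    finally show ?thesis .
  qed
  let ?Y = "(1 + 4 * K * real M / mu p) ^ M"
  have "(N ^ M / 4)\<^sup>2 \<le> (\<Sum>T\<in>G. ?E T)\<^sup>2" using sumG N0 by (intro power_mono) auto
  also have "\<dots> \<le> Ebin n p (\<lambda>R. of_bool (P R)) * (\<Sum>T\<in>G. \<Sum>T'\<in>G. (1 / p) ^ card (?V T \<inter> ?V T'))"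
    using p finG V_sub by (intro planting_second_moment) (auto simp: G_def)
  also have "\<dots> \<le> Ebin n p (\<lambda>R. of_bool (P R)) * (N ^ M * (N ^ M * ?Y))"
    using second p by (intro mult_left_mono Ebin_nonneg) auto
  finally have "(1 / 16) * (N ^ M * N ^ M) \<le> (Ebin n p (\<lambda>R. of_bool (P R)) * ?Y) * (N ^ M * N ^ M)"
    by (simp add: power2_eq_square mult_ac)
  then have "1 / 16 \<le> Ebin n p (\<lambda>R. of_bool (P R)) * ?Y"
    by (rule mult_right_le_imp_le) (use N0 in simp)
  then show ?thesis by (simp only: K_def)
qed

text \<open>An index is wasted if its edge is already present or repeats an earlier one; the other
  indices give distinct new edges.\<close>

lemma X_planted_ge:
  assumes T: "T \<in> {..<M} \<rightarrow>\<^sub>E H"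
  shows "X H R + (real M - real (card {i \<in> {..<M}. T i \<subseteq> R \<or> (\<exists>j<i. T j = T i)})) \<le> X H (R \<union> (\<Union>i<M. T i))"
proof -
  let ?b = "{i \<in> {..<M}. T i \<subseteq> R \<or> (\<exists>j<i. T j = T i)}"
  let ?g = "{..<M} - ?b"
  have inj: "inj_on T ?g"
  proof (intro inj_onI)
    fix i j assume "i \<in> ?g" "j \<in> ?g" "T i = T j"
    then show "i = j" by (metis (mono_tags, lifting) Diff_iff mem_Collect_eq nat_neq_iff)
  qed
  have TH: "T i \<in> H" if "i < M" for i using T that by (auto simp: PiE_iff)
  have "card ({A \<in> H. A \<subseteq> R} \<union> T ` ?g) \<le> card {A \<in> H. A \<subseteq> R \<union> (\<Union>i<M. T i)}"
  proof (intro card_mono)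
    show "{A \<in> H. A \<subseteq> R} \<union> T ` ?g \<subseteq> {A \<in> H. A \<subseteq> R \<union> (\<Union>i<M. T i)}" using TH by blast
  qed (use finite_H in auto)
  moreover have "card ({A \<in> H. A \<subseteq> R} \<union> T ` ?g) = card {A \<in> H. A \<subseteq> R} + card (T ` ?g)"
    using finite_H by (intro card_Un_disjoint) auto
  moreover have "card (T ` ?g) = card ?g" using inj by (rule card_image)
  moreover have "card ?g = M - card ?b" by (subst card_Diff_subset) auto
  moreover have "card ?b \<le> M" using card_mono[of "{..<M}" ?b] by auto
  ultimately show ?thesis unfolding X_def by linarith
qed

lemma sum_repeats_le:
  assumes "i < M"
  shows "real (card {T \<in> {..<M} \<rightarrow>\<^sub>E H. \<exists>j<i. T j = T i}) \<le> real M * real (card H) ^ (M - 1)"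
proof -
  let ?T = "{..<M} \<rightarrow>\<^sub>E H"
  have "{T \<in> ?T. \<exists>j<i. T j = T i} = (\<Union>j<i. {T \<in> ?T. T j = T i})" by auto
  then have "card {T \<in> ?T. \<exists>j<i. T j = T i} \<le> (\<Sum>j<i. card {T \<in> ?T. T j = T i})"
    using card_UN_le[of "{..<i}" "\<lambda>j. {T \<in> ?T. T j = T i}"] by simp
  also have "\<dots> \<le> (\<Sum>j<i. card H ^ (M - 1))"
    using assms finite_H by (intro sum_mono card_PiE_coord_eq) auto
  also have "\<dots> = i * card H ^ (M - 1)" by simp
  also have "\<dots> \<le> M * card H ^ (M - 1)" using assms by (intro mult_right_mono) auto
  finally have "real (card {T \<in> ?T. \<exists>j<i. T j = T i}) \<le> real (M * card H ^ (M - 1))" unfolding of_nat_le_iff .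
  then show ?thesis by simp
qed

end

section \<open>The lower bound\<close>

context tail_regime
begin

lemma sparse_Psi2:
  assumes sp: "real n * p ^ (k - 1) \<le> 1"
  shows "phi \<epsilon> * mu p \<le> 2 * real k ^ 4 * Psi2"
proof -
  have "real k ^ 4 * (1 + real n * p ^ (k - 1)) * Psi2 \<le> real k ^ 4 * (1 + 1) * Psi2"
    using sp Psi_ge1 by (intro mult_right_mono mult_left_mono) auto
  then show ?thesis using Psi2_ge by simp
qed

text \<open>Since e^4 >= 16 and \<open>Psi2\<close> is at least 1, the constant 1/16 costs only 4
  \<open>Psi2\<close> in the exponent.\<close>

lemma Pr_ge_of_cost:
  assumes "1 / 16 \<le> Pr * Z" "Z \<le> exp (Y * Psi2)"
  shows "exp (- ((4 + Y) * Psi2)) \<le> Pr"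
proof -
  have Pr0: "0 \<le> Pr" unfolding Pr_def using p p_lt_1 by (intro Ebin_nonneg) auto
  have "1 / 16 \<le> Pr * exp (Y * Psi2)"
    using assms mult_left_mono[OF assms(2) Pr0] by linarith
  then have "1 / 16 * exp (- (Y * Psi2)) \<le> (Pr * exp (Y * Psi2)) * exp (- (Y * Psi2))"
    by (intro mult_right_mono) auto
  also have "\<dots> = Pr" by (simp add: mult.assoc flip: exp_add)
  finally have a: "1 / 16 * exp (- (Y * Psi2)) \<le> Pr" .
  have "(1 + 1 :: real) ^ 4 \<le> exp 1 ^ 4" using exp_ge_add_one_self[of 1] by (intro power_mono) auto
  then have "16 \<le> exp (4 :: real)" by (simp flip: exp_of_nat_mult)
  also have "\<dots> \<le> exp (4 * Psi2)" using Psi_ge1 by simp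
  finally have "exp (- (4 * Psi2)) \<le> 1 / 16" by (simp add: exp_minus field_simps)
  then have "exp (- (4 * Psi2)) * exp (- (Y * Psi2)) \<le> 1 / 16 * exp (- (Y * Psi2))" by (intro mult_right_mono) auto
  moreover have "exp (- (4 * Psi2)) * exp (- (Y * Psi2)) = exp (- ((4 + Y) * Psi2))"
    by (simp add: algebra_simps flip: exp_add)
  ultimately show ?thesis using a by linarith
qed

text \<open>Plant about 6 \<epsilon> mu random edges. If X lies above mu - 2 \<epsilon> mu and at
  most half of the planted edges are wasted, the gain 3 \<epsilon> mu reaches the target. The cost
  is exp (O(M^2 / mu)), of order \<epsilon>^2 mu in the exponent.\<close>

lemma lower_sparse_small:
  assumes sp: "real n * p ^ (k - 1) \<le> 1" and n: "100 * k \<le> n" and e1: "\<epsilon> \<le> 1" and c: "c = 6 + 2 / \<gamma>"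
  shows "exp (- ((4 + 32 * (real k ^ 4 + (real k)\<^sup>2 * exp (16 * real k ^ 3 * c)) * c\<^sup>2 * real k ^ 4) * Psi2)) \<le> Pr"
proof -
  define M where "M = nat \<lceil>6 * (\<epsilon> * mu p)\<rceil>"
  define N where "N = real (card H)"
  define K where "K = real k ^ 4 + (real k)\<^sup>2 * exp (16 * real k ^ 3 * c)"
  let ?T = "{..<M} \<rightarrow>\<^sub>E H"
  let ?V = "\<lambda>T :: nat \<Rightarrow> nat set. (\<Union>i<M. T i)"
  let ?b = "\<lambda>T R. {i \<in> {..<M}. T i \<subseteq> R \<or> (\<exists>j<i. T j = T i)}"
  have pp: "0 < p" "p \<le> 1" using p p_lt_1 by auto
  have em: "0 < \<epsilon> * mu p" using eps mu_p_pos by simp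
  have N0: "0 < N" using card_H_pos by (simp add: N_def)
  have K0: "0 < K" using k3 by (simp add: K_def add_pos_pos)
  have c0: "0 < c" using \<gamma> by (simp add: c add_pos_pos)
  have n': "100 * real k \<le> real n" using n by (metis of_nat_le_iff of_nat_mult of_nat_numeral)
  have n300: "300 \<le> real n" using n' k3_real by linarith
  have M6: "6 * (\<epsilon> * mu p) \<le> real M" "real M \<le> 6 * (\<epsilon> * mu p) + 1" using em unfolding M_def by linarith+
  have M1: "1 \<le> M" using M6 em unfolding M_def by linarith
  \<comment> \<open>The summand 2 / \<gamma> in c pays for rounding up M, because \<epsilon> mu is
    at least \<gamma> / 2.\<close>
  have Mc: "real M \<le> c * (\<epsilon> * mu p)"
  proof -
    have "1 \<le> 2 / \<gamma> * (\<epsilon> * mu p)" using eps_mu_ge \<gamma> by (simp add: field_simps)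
    then show ?thesis using M6 by (simp add: c algebra_simps)
  qed
  have pk1: "p ^ (k - 1) \<le> 1 / real n" using sp n300 by (simp add: field_simps)
  have pk2: "p ^ k \<le> 1 / real n"
  proof -
    have "p * p ^ (k - 1) \<le> 1 * p ^ (k - 1)" using pp by (intro mult_right_mono) auto
    then show ?thesis using pk1 p_pow_k[of p] by linarith
  qed
  have Mnp: "real M \<le> c * (real n * p)"
  proof -
    have "\<epsilon> * mu p \<le> 1 * mu p" using e1 mu_p_pos by (intro mult_right_mono) auto
    also have "\<dots> \<le> (real n)\<^sup>2 * p ^ k" using mu_le pp by simp
    also have "\<dots> = (real n * p) * (real n * p ^ (k - 1))" by (simp add: p_pow_k power2_eq_square)
    also have "\<dots> \<le> (real n * p) * 1" using sp pp by (intro mult_left_mono) auto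
    finally have "\<epsilon> * mu p \<le> real n * p" by simp
    then have "c * (\<epsilon> * mu p) \<le> c * (real n * p)" using c0 by (intro mult_left_mono) auto
    then show ?thesis using Mc by linarith
  qed
  have MN: "p ^ k + real M / N \<le> 1 / 8"
  proof -
    have "real M \<le> 6 * mu p + 1"
    proof -
      have "\<epsilon> * mu p \<le> 1 * mu p" using e1 mu_p_pos by (intro mult_right_mono) auto
      then show ?thesis using M6 by simp
    qed
    then have "real M / N \<le> (6 * mu p + 1) / N" using N0 by (intro divide_right_mono) auto
    also have "\<dots> = 6 * p ^ k + 1 / N" using N0 by (simp add: mu_def N_def add_divide_distrib)
    finally have "p ^ k + real M / N \<le> 7 * p ^ k + 1 / N" by simp
    moreover have "1 / N \<le> 1 / real n"
    proof -
      have "(16 * real k) * real n \<le> (100 * real k) * real n" by (intro mult_right_mono) auto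
      also have "\<dots> \<le> real n * real n" using n' by (intro mult_right_mono) auto
      also have "\<dots> \<le> (16 * real k) * N" using H_lower by (simp add: N_def power2_eq_square)
      finally have "real n \<le> N" by (rule mult_left_le_imp_le) (use k3 in simp)
      then show ?thesis using n300 by (intro divide_left_mono) auto
    qed
    moreover have "8 * (1 / real n) \<le> 1 / 8" using n300 by (simp add: field_simps)
    ultimately show ?thesis using pk2 by linarith
  qed
  have finT: "finite ?T" using finite_H by (intro finite_PiE) auto
  have cT: "real (card ?T) = N ^ M" by (simp add: card_PiE N_def)
  \<comment> \<open>Distance 2 \<epsilon> mu leaves failure probability 1/4. The other 1/4 is spent
    by Markov on the wasted indices, whose average number is at most M / 8.\<close>
  have cheb: "Ebin n p (\<lambda>R. of_bool (X H R \<le> mu p - 2 * (\<epsilon> * mu p))) \<le> 1 / 4"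
  proof -
    have "Ebin n p (\<lambda>R. of_bool (X H R \<le> mu p - 2 * (\<epsilon> * mu p)))
      \<le> Ebin n p (\<lambda>R. (X H R - mu p)\<^sup>2) / (2 * (\<epsilon> * mu p))\<^sup>2"
    proof (intro Ebin_markov)
      fix R assume "X H R \<le> mu p - 2 * (\<epsilon> * mu p)"
      then have "(2 * (\<epsilon> * mu p))\<^sup>2 \<le> (mu p - X H R)\<^sup>2" using em by (intro power_mono) auto
      then show "(2 * (\<epsilon> * mu p))\<^sup>2 \<le> (X H R - mu p)\<^sup>2" by (simp add: power2_commute)
    qed (use pp eps mu_p_pos in auto)
    also have "Ebin n p (\<lambda>R. (X H R - mu p)\<^sup>2) = vr p H"
      using Ebin_X_variance[of p H] pp by (simp add: mu_def)
    also have "vr p H / (2 * (\<epsilon> * mu p))\<^sup>2 \<le> (\<epsilon> * mu p)\<^sup>2 / (2 * (\<epsilon> * mu p))\<^sup>2"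
      using vr_eps by (intro divide_right_mono) auto
    also have "\<dots> = 1 / 4" using eps mu_p_pos by (simp add: power_mult_distrib)
    finally show ?thesis .
  qed
  have sum_b: "(\<Sum>T\<in>?T. Ebin n p (\<lambda>R. real (card (?b T R)))) \<le> N ^ M * (real M / 8)"
  proof -
    have pt: "real (card (?b T R)) \<le> (\<Sum>i<M. of_bool (T i \<subseteq> R) + of_bool (\<exists>j<i. T j = T i))" for T R
    proof -
      have "real (card (?b T R)) = (\<Sum>i<M. of_bool (T i \<subseteq> R \<or> (\<exists>j<i. T j = T i)))"
        by (simp add: of_bool_def sum.If_cases Collect_conj_eq lessThan_def)
      also have "\<dots> \<le> (\<Sum>i<M. of_bool (T i \<subseteq> R) + of_bool (\<exists>j<i. T j = T i))"
        by (intro sum_mono) auto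
      finally show ?thesis .
    qed
    have "(\<Sum>T\<in>?T. Ebin n p (\<lambda>R. real (card (?b T R))))
      \<le> (\<Sum>T\<in>?T. Ebin n p (\<lambda>R. \<Sum>i<M. of_bool (T i \<subseteq> R) + of_bool (\<exists>j<i. T j = T i)))"
      using pt pp by (intro sum_mono Ebin_mono) auto
    also have "\<dots> = (\<Sum>T\<in>?T. \<Sum>i<M. p ^ k + of_bool (\<exists>j<i. T j = T i))"
    proof (intro sum.cong refl)
      fix T assume T: "T \<in> ?T"
      have "Ebin n p (\<lambda>R. of_bool (T i \<subseteq> R)) = p ^ k" if "i < M" for i
      proof -
        have "T i \<in> H" using PiE_mem[OF T] that by simp
        then show ?thesis using Ebin_of_subset[of p "T i" n] pp H_sub H_card by simp
      qed
      then show "Ebin n p (\<lambda>R. \<Sum>i<M. of_bool (T i \<subseteq> R) + of_bool (\<exists>j<i. T j = T i))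
        = (\<Sum>i<M. p ^ k + of_bool (\<exists>j<i. T j = T i))"
        unfolding Ebin_sum Ebin_add Ebin_const[OF less_imp_le[OF pp(1)] pp(2)] by simp
    qed
    also have "\<dots> = (\<Sum>i<M. \<Sum>T\<in>?T. p ^ k + of_bool (\<exists>j<i. T j = T i))" by (rule sum.swap)
    also have "\<dots> \<le> (\<Sum>i<M. N ^ M * p ^ k + real M * N ^ (M - 1))"
    proof (intro sum_mono)
      fix i assume i: "i \<in> {..<M}"
      have "(\<Sum>T\<in>?T. p ^ k + of_bool (\<exists>j<i. T j = T i)) = N ^ M * p ^ k + (\<Sum>T\<in>?T. of_bool (\<exists>j<i. T j = T i))"
        by (simp add: sum.distrib cT)
      also have "(\<Sum>T\<in>?T. of_bool (\<exists>j<i. T j = T i) :: real) = real (card {T \<in> ?T. \<exists>j<i. T j = T i})"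
        using finT by (simp add: of_bool_def sum.If_cases Collect_conj_eq)
      also have "\<dots> \<le> real M * N ^ (M - 1)" using sum_repeats_le[of i M] i by (simp add: N_def)
      finally show "(\<Sum>T\<in>?T. p ^ k + of_bool (\<exists>j<i. T j = T i)) \<le> N ^ M * p ^ k + real M * N ^ (M - 1)" by simp
    qed
    also have "\<dots> = N ^ M * (real M * (p ^ k + real M / N))"
    proof -
      have "N ^ M = N * N ^ (M - 1)" using M1 by (simp flip: power_Suc)
      then show ?thesis using N0 by (simp add: algebra_simps)
    qed
    also have "\<dots> \<le> N ^ M * (real M * (1 / 8))" using MN N0 by (intro mult_left_mono) auto
    finally show ?thesis by simp
  qed
  have fail: "Ebin n p (\<lambda>R. of_bool (\<not> (1 + \<epsilon>) * mu p \<le> X H (R \<union> ?V T)))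
      \<le> 1 / 4 + 2 / real M * Ebin n p (\<lambda>R. real (card (?b T R)))" if T: "T \<in> ?T" for T
  proof -
    have "Ebin n p (\<lambda>R. of_bool (\<not> (1 + \<epsilon>) * mu p \<le> X H (R \<union> ?V T)))
      \<le> Ebin n p (\<lambda>R. of_bool (X H R \<le> mu p - 2 * (\<epsilon> * mu p)) + 2 / real M * real (card (?b T R)))"
    proof (intro Ebin_mono)
      fix R assume "R \<subseteq> {1..n}"
      show "of_bool (\<not> (1 + \<epsilon>) * mu p \<le> X H (R \<union> ?V T))
        \<le> of_bool (X H R \<le> mu p - 2 * (\<epsilon> * mu p)) + 2 / real M * real (card (?b T R))"
      proof (cases "X H R \<le> mu p - 2 * (\<epsilon> * mu p) \<or> (1 + \<epsilon>) * mu p \<le> X H (R \<union> ?V T)")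
        case False
        then have "real M < 2 * real (card (?b T R))"
          using X_planted_ge[OF T, of R] M6 by (simp add: algebra_simps)
        then have "1 \<le> 2 / real M * real (card (?b T R))" using M1 by (simp add: field_simps)
        then show ?thesis by (simp add: add_increasing)
      qed (auto simp: add_increasing2)
    qed (use pp in auto)
    also have "\<dots> = Ebin n p (\<lambda>R. of_bool (X H R \<le> mu p - 2 * (\<epsilon> * mu p))) + 2 / real M * Ebin n p (\<lambda>R. real (card (?b T R)))"
      by (simp only: Ebin_add Ebin_cmult)
    finally show ?thesis using cheb by linarith
  qed
  have avg: "N ^ M / 2 \<le> (\<Sum>T\<in>?T. Ebin n p (\<lambda>R. of_bool ((1 + \<epsilon>) * mu p \<le> X H (R \<union> ?V T))))"
  proof -
    have "(\<Sum>T\<in>?T. Ebin n p (\<lambda>R. of_bool (\<not> (1 + \<epsilon>) * mu p \<le> X H (R \<union> ?V T))))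
      \<le> (\<Sum>T\<in>?T. 1 / 4 + 2 / real M * Ebin n p (\<lambda>R. real (card (?b T R))))"
      using fail by (intro sum_mono)
    also have "\<dots> = N ^ M / 4 + 2 / real M * (\<Sum>T\<in>?T. Ebin n p (\<lambda>R. real (card (?b T R))))"
      by (simp add: sum.distrib cT sum_distrib_left)
    also have "\<dots> \<le> N ^ M / 4 + 2 / real M * (N ^ M * (real M / 8))"
      using sum_b by (intro add_left_mono mult_left_mono) auto
    also have "\<dots> = N ^ M / 2" using M1 by simp
    finally have "(\<Sum>T\<in>?T. Ebin n p (\<lambda>R. of_bool (\<not> (1 + \<epsilon>) * mu p \<le> X H (R \<union> ?V T)))) \<le> N ^ M / 2" .
    then have "(\<Sum>T\<in>?T. 1 - Ebin n p (\<lambda>R. of_bool ((1 + \<epsilon>) * mu p \<le> X H (R \<union> ?V T)))) \<le> N ^ M / 2"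
      using pp by (simp only: Ebin_not less_imp_le)
    then show ?thesis by (simp add: sum_subtractf cT)
  qed
  have "1 / 16 \<le> Pr * (1 + 4 * K * real M / mu p) ^ M"
    unfolding Pr_def K_def using avg M1 Mnp sp pp by (intro planted_edges) (auto simp: N_def)
  then show ?thesis unfolding K_def[symmetric]
  proof (rule Pr_ge_of_cost)
    have "(1 + 4 * K * real M / mu p) ^ M \<le> exp (4 * K * real M / mu p) ^ M"
      using K0 mu_p_pos by (intro power_mono exp_ge_add_one_self) auto
    also have "\<dots> = exp (real M * (4 * K * real M / mu p))" by (simp only: exp_of_nat_mult)
    also have "\<dots> \<le> exp (32 * K * c\<^sup>2 * real k ^ 4 * Psi2)"
    proof -
      have "real M * (4 * K * real M / mu p) = 4 * K * (real M)\<^sup>2 / mu p" by (simp add: power2_eq_square)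
      also have "\<dots> \<le> 4 * K * (c * (\<epsilon> * mu p))\<^sup>2 / mu p"
        using Mc K0 mu_p_pos by (intro divide_right_mono mult_left_mono power_mono) auto
      also have "\<dots> = 4 * K * c\<^sup>2 * (\<epsilon>\<^sup>2 * mu p)" using mu_p_pos by (simp add: power2_eq_square)
      also have "\<dots> \<le> 4 * K * c\<^sup>2 * ((4 * phi \<epsilon>) * mu p)"
        using phi_ge_small[of \<epsilon>] eps e1 K0 mu_p_pos by (intro mult_left_mono mult_right_mono) auto
      also have "\<dots> = 16 * K * c\<^sup>2 * (phi \<epsilon> * mu p)" by simp
      also have "\<dots> \<le> 16 * K * c\<^sup>2 * (2 * real k ^ 4 * Psi2)"
        using sparse_Psi2[OF sp] K0 by (intro mult_left_mono) auto
      finally show ?thesis by (simp add: mult_ac)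
    qed
    finally show "(1 + 4 * K * real M / mu p) ^ M \<le> exp (32 * K * c\<^sup>2 * real k ^ 4 * Psi2)" .
  qed
qed

text \<open>Three cases. If p < n^(-3/4), then mu \<le> p^(1/3); as (1 + \<epsilon>) mu >= 1, this
  makes log (1 + \<epsilon>) at least l / 3, and the clustered rate is of order at most
  phi(\<epsilon>) mu. If (1 + \<epsilon>) mu exceeds n^(1/4) / 2, then sqrt(\<epsilon> mu) beats the
  logarithm l. Otherwise (1 + \<epsilon>) mu random edges are planted.\<close>

lemma lower_sparse_large:
  assumes sp: "real n * p ^ (k - 1) \<le> 1" and n: "100 * k \<le> n" and e1: "1 \<le> \<epsilon>"
    and K: "K = real k ^ 4 + (real k)\<^sup>2 * exp (16 * real k ^ 3)"
  shows "Psi1 \<le> 128 * real k ^ 4 * Psi2 \<or> exp (- ((4 + 20 * real k ^ 4 * (2 * ln (9 * K) + 1)) * Psi2)) \<le> Pr"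
proof -
  \<comment> \<open>An eighth root lets both thresholds be integer powers: n^(1/4) = r^2 and n^(3/4)
    = r^6.\<close>
  define r where "r = real n powr (1 / 8)"
  define l where "l = ln (1 / p)"
  have pp: "0 < p" "p \<le> 1" using p p_lt_1 by auto
  have n': "100 * real k \<le> real n" using n by (metis of_nat_le_iff of_nat_mult of_nat_numeral)
  have n300: "300 \<le> real n" using n' k3_real by linarith
  have r8: "r ^ 8 = real n" using n300 by (simp add: r_def powr_power)
  have r1: "1 \<le> r" using n300 by (simp add: r_def ge_one_powr_ge_zero)
  have lnr: "ln (real n) = 8 * ln r" using r8 r1 by (metis ln_realpow of_nat_numeral less_le_trans zero_less_one)
  have lp: "l = - ln p" using pp by (simp add: l_def ln_div)
  have l0: "0 \<le> l" using pp by (simp add: lp)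
  have em: "(1 + \<epsilon>) * mu p / 2 \<le> \<epsilon> * mu p"
  proof -
    have "(1 + \<epsilon>) * mu p \<le> (2 * \<epsilon>) * mu p" using e1 mu_p_pos by (intro mult_right_mono) auto
    then show ?thesis by simp
  qed
  have em0: "1 / 2 \<le> \<epsilon> * mu p" using em nonempty by linarith
  have l1e: "(1 + \<epsilon>) * ln (1 + \<epsilon>) \<le> 5 * phi \<epsilon>"
    using phi_ge_large[OF e1] by (simp add: phi_def)
  have ph4: "\<epsilon> \<le> 4 * phi \<epsilon>" using phi_ge_large[OF e1] by simp
  consider "3 / 4 * ln (real n) < l" | "r\<^sup>2 / 2 < (1 + \<epsilon>) * mu p" "l \<le> 3 / 4 * ln (real n)"
    | "(1 + \<epsilon>) * mu p \<le> r\<^sup>2 / 2" "l \<le> 3 / 4 * ln (real n)" by linarith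
  then show ?thesis
  proof cases
    case 1
    have "mu p \<le> (real n)\<^sup>2 * p ^ k" using mu_le pp by simp
    also have "\<dots> \<le> (real n)\<^sup>2 * p ^ 3" using pp k3 by (intro mult_left_mono power_decreasing) auto
    finally have "ln (mu p) \<le> ln ((real n)\<^sup>2 * p ^ 3)" using mu_p_pos pp n300 by (subst ln_le_cancel_iff) auto
    also have "\<dots> = 2 * ln (real n) - 3 * l" using pp n300 by (simp add: ln_mult ln_realpow lp)
    finally have lm: "ln (mu p) \<le> - l / 3" using 1 by linarith
    have "0 \<le> ln ((1 + \<epsilon>) * mu p)" using nonempty by simp
    also have "\<dots> = ln (1 + \<epsilon>) + ln (mu p)" using eps mu_p_pos by (intro ln_mult_pos) auto
    finally have l3: "l / 3 \<le> ln (1 + \<epsilon>)" using lm by linarith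
    have "\<epsilon> * (l / 3) \<le> (1 + \<epsilon>) * ln (1 + \<epsilon>)" using l3 l0 eps by (intro mult_mono) auto
    then have "\<epsilon> * l \<le> 15 * phi \<epsilon>" using l1e by simp
    then have b: "\<epsilon> * l * mu p \<le> 15 * phi \<epsilon> * mu p" using mu_p_pos by (intro mult_right_mono) auto
    have "sqrt (\<epsilon> * mu p) \<le> 2 * (\<epsilon> * mu p)"
    proof (intro real_le_lsqrt)
      have "(\<epsilon> * mu p) * 1 \<le> (\<epsilon> * mu p) * (4 * (\<epsilon> * mu p))" using em0 by (intro mult_left_mono) auto
      then show "\<epsilon> * mu p \<le> (2 * (\<epsilon> * mu p))\<^sup>2" by (simp add: power2_eq_square)
    qed (use em0 in auto)
    then have "Psi1 \<le> 2 * (\<epsilon> * mu p) * l" unfolding Psi1_def l_def[symmetric] using l0 by (intro mult_right_mono)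
    also have "\<dots> \<le> 30 * (phi \<epsilon> * mu p)" using b by (simp add: mult_ac)
    also have "\<dots> \<le> 30 * (2 * real k ^ 4 * Psi2)" using sparse_Psi2[OF sp] by (intro mult_left_mono) auto
    also have "\<dots> \<le> 128 * real k ^ 4 * Psi2" using Psi_ge1 by (simp add: mult_right_mono)
    finally show ?thesis by simp
  next
    case 2
    have em4: "r\<^sup>2 / 4 \<le> \<epsilon> * mu p" using 2 em by linarith
    have "ln r \<le> r" using ln_le_minus_one[of r] r1 by linarith
    then have "l \<le> 8 * r" using 2 lnr r1 by linarith
    moreover have "r / 2 \<le> sqrt (\<epsilon> * mu p)"
    proof (rule real_le_rsqrt)
      show "(r / 2)\<^sup>2 \<le> \<epsilon> * mu p" using em4 by (simp add: power_divide)
    qed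
    ultimately have "l \<le> 16 * sqrt (\<epsilon> * mu p)" by linarith
    then have "Psi1 \<le> sqrt (\<epsilon> * mu p) * (16 * sqrt (\<epsilon> * mu p))"
      unfolding Psi1_def l_def[symmetric] using em0 by (intro mult_left_mono) auto
    also have "\<dots> = 16 * (\<epsilon> * mu p)" using em0 by simp
    also have "\<dots> \<le> 16 * ((4 * phi \<epsilon>) * mu p)" using ph4 mu_p_pos by (intro mult_left_mono mult_right_mono) auto
    also have "\<dots> = 64 * (phi \<epsilon> * mu p)" by simp
    also have "\<dots> \<le> 64 * (2 * real k ^ 4 * Psi2)" using sparse_Psi2[OF sp] by (intro mult_left_mono) auto
    finally show ?thesis by simp
  next
    case 3
    define M where "M = nat \<lceil>(1 + \<epsilon>) * mu p\<rceil>"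
    define N where "N = real (card H)"
    let ?T = "{..<M} \<rightarrow>\<^sub>E H"
    let ?V = "\<lambda>T :: nat \<Rightarrow> nat set. (\<Union>i<M. T i)"
    have N0: "0 < N" using card_H_pos by (simp add: N_def)
    have Mge: "(1 + \<epsilon>) * mu p \<le> real M" "real M \<le> (1 + \<epsilon>) * mu p + 1" using nonempty unfolding M_def by linarith+
    have M1: "1 \<le> M" using Mge nonempty by linarith
    have M2: "real M \<le> 2 * ((1 + \<epsilon>) * mu p)" using Mge nonempty by linarith
    have Mr: "real M \<le> r\<^sup>2" using M2 3 by linarith
    have Mnp: "real M \<le> 1 * (real n * p)"
    proof -
      have "- 6 * ln r \<le> ln p" using 3 lp lnr by linarith
      then have "exp (- 6 * ln r) \<le> p" using pp by (metis exp_le_cancel_iff exp_ln)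
      moreover have "exp (- 6 * ln r) = 1 / r ^ 6"
      proof -
        have "exp (6 * ln r) = r ^ 6" using r1 exp_of_nat_mult[of 6 "ln r"] by simp
        then show ?thesis by (simp add: exp_minus divide_inverse)
      qed
      ultimately have "r ^ 8 * (1 / r ^ 6) \<le> real n * p" unfolding r8[symmetric] using r1 by (intro mult_left_mono) auto
      moreover have "r ^ 8 * (1 / r ^ 6) = r\<^sup>2" using r1 by (simp add: field_simps flip: power_add)
      ultimately show ?thesis using Mr by linarith
    qed
    \<comment> \<open>A birthday bound: so few edges are drawn that at least half of all tuples have
      no repetition.\<close>
    have MN: "(real M)\<^sup>2 \<le> N / 2"
    proof -
      have "(real M)\<^sup>2 \<le> (r\<^sup>2)\<^sup>2" using Mr by (intro power_mono) auto
      also have "\<dots> = r ^ 4" by (simp flip: power_mult)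
      finally have a: "(real M)\<^sup>2 \<le> r ^ 4" .
      have "100 * real k \<le> r ^ 8" using n' r8 by simp
      also have "\<dots> \<le> r ^ 12" using r1 by (intro power_increasing) auto
      finally have "32 * real k \<le> r ^ 12" using k3_real by linarith
      then have "32 * real k * r ^ 4 \<le> r ^ 12 * r ^ 4" using r1 by (intro mult_right_mono) auto
      also have "\<dots> = (real n)\<^sup>2" by (simp add: r8[symmetric] flip: power_add power_mult)
      also have "\<dots> \<le> 16 * real k * N" using H_lower by (simp add: N_def)
      finally have "(16 * real k) * (2 * r ^ 4) \<le> (16 * real k) * N" by simp
      then have "2 * r ^ 4 \<le> N" by (rule mult_left_le_imp_le) (use k3 in simp)
      then show ?thesis using a by linarith
    qed
    have finT: "finite ?T" using finite_H by (intro finite_PiE) auto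
    have cT: "real (card ?T) = N ^ M" by (simp add: card_PiE N_def)
    define D where "D = {T \<in> ?T. \<forall>i<M. \<not> (\<exists>j<i. T j = T i)}"
    have cD: "N ^ M / 2 \<le> real (card D)"
    proof -
      have "?T - D \<subseteq> (\<Union>i<M. {T \<in> ?T. \<exists>j<i. T j = T i})" by (auto simp: D_def)
      then have "card (?T - D) \<le> card (\<Union>i<M. {T \<in> ?T. \<exists>j<i. T j = T i})" using finT by (intro card_mono) auto
      also have "\<dots> \<le> (\<Sum>i<M. card {T \<in> ?T. \<exists>j<i. T j = T i})" by (intro card_UN_le) auto
      finally have "real (card (?T - D)) \<le> (\<Sum>i<M. real (card {T \<in> ?T. \<exists>j<i. T j = T i}))"
        unfolding of_nat_sum[symmetric] of_nat_le_iff .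
      also have "\<dots> \<le> (\<Sum>i<M. real M * N ^ (M - 1))" unfolding N_def by (intro sum_mono sum_repeats_le) auto
      also have "\<dots> = (real M)\<^sup>2 * N ^ (M - 1)" by (simp add: power2_eq_square)
      also have "\<dots> \<le> (N / 2) * N ^ (M - 1)" using MN N0 by (intro mult_right_mono) auto
      also have "\<dots> = N ^ M / 2" using M1 by (simp flip: power_Suc)
      finally have "real (card (?T - D)) \<le> N ^ M / 2" .
      moreover have "card ?T = card D + card (?T - D)"
        using finT card_mono[of ?T D] by (subst card_Diff_subset) (auto simp: D_def intro: finite_subset)
      ultimately show ?thesis using cT by simp
    qed
    \<comment> \<open>Distinct planted edges alone number M >= (1 + \<epsilon>) mu, whatever R
      is.\<close>
    have full: "Ebin n p (\<lambda>R. of_bool ((1 + \<epsilon>) * mu p \<le> X H (R \<union> ?V T))) = 1" if T: "T \<in> D" for T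
    proof -
      have TT: "T \<in> ?T" using T by (simp add: D_def)
      have e: "{i \<in> {..<M}. T i \<subseteq> {} \<or> (\<exists>j<i. T j = T i)} = {}"
      proof -
        have "T i \<noteq> {}" if "i < M" for i
        proof -
          have "T i \<in> H" using PiE_mem[OF TT] that by simp
          then show ?thesis using H_card[of "T i"] k3 by auto
        qed
        then show ?thesis using T by (auto simp: D_def)
      qed
      have "real M \<le> X H ({} \<union> ?V T)" using X_planted_ge[OF TT, of "{}"] unfolding e by (simp add: X_def)
      also have "\<dots> \<le> X H (R \<union> ?V T)" for R unfolding X_def using finite_H by (intro of_nat_mono card_mono) auto
      finally have "(1 + \<epsilon>) * mu p \<le> X H (R \<union> ?V T)" for R using Mge(1) by (meson order_trans)
      then show ?thesis using pp by (simp add: Ebin_const)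
    qed
    have avg: "N ^ M / 2 \<le> (\<Sum>T\<in>?T. Ebin n p (\<lambda>R. of_bool ((1 + \<epsilon>) * mu p \<le> X H (R \<union> ?V T))))"
    proof -
      have "real (card D) = (\<Sum>T\<in>D. Ebin n p (\<lambda>R. of_bool ((1 + \<epsilon>) * mu p \<le> X H (R \<union> ?V T))))" using full by simp
      also have "\<dots> \<le> (\<Sum>T\<in>?T. Ebin n p (\<lambda>R. of_bool ((1 + \<epsilon>) * mu p \<le> X H (R \<union> ?V T))))"
        using finT pp by (intro sum_mono2 Ebin_nonneg) (auto simp: D_def)
      finally show ?thesis using cD by linarith
    qed
    have Keq: "K = real k ^ 4 + (real k)\<^sup>2 * exp (16 * real k ^ 3 * 1)" by (simp add: K)
    have K1: "1 \<le> K"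
    proof -
      have "1 \<le> real k ^ 4" using k3 by simp
      moreover have "0 \<le> (real k)\<^sup>2 * exp (16 * real k ^ 3)" by simp
      ultimately show ?thesis unfolding K by linarith
    qed
    have "1 / 16 \<le> Pr * (1 + 4 * K * real M / mu p) ^ M"
      unfolding Pr_def Keq using avg M1 Mnp sp pp by (intro planted_edges) (auto simp: N_def)
    then have "exp (- ((4 + 20 * real k ^ 4 * (2 * ln (9 * K) + 1)) * Psi2)) \<le> Pr"
    proof (rule Pr_ge_of_cost)
      have "1 + 4 * K * real M / mu p \<le> 9 * K * (1 + \<epsilon>)"
      proof -
        have "4 * K * real M / mu p \<le> 4 * K * (2 * ((1 + \<epsilon>) * mu p)) / mu p"
          using M2 K1 mu_p_pos by (intro divide_right_mono mult_left_mono) auto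
        also have "\<dots> = 8 * (K * (1 + \<epsilon>))" using mu_p_pos by simp
        finally have "4 * K * real M / mu p \<le> 8 * (K * (1 + \<epsilon>))" .
        moreover have "1 * 1 \<le> K * (1 + \<epsilon>)" using K1 eps by (intro mult_mono) auto
        ultimately show ?thesis by linarith
      qed
      then have "(1 + 4 * K * real M / mu p) ^ M \<le> (9 * K * (1 + \<epsilon>)) ^ M"
        using K1 mu_p_pos by (intro power_mono) auto
      also have "\<dots> = exp (real M * ln (9 * K * (1 + \<epsilon>)))" unfolding exp_of_nat_mult using K1 eps by simp
      also have "\<dots> \<le> exp (20 * real k ^ 4 * (2 * ln (9 * K) + 1) * Psi2)"
      proof -
        have ln9: "0 \<le> ln (9 * K)" using K1 by simp
        \<comment> \<open>This absorbs the constant ln (9 K) into a multiple of ln (1 + \<epsilon>),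
          so that M times the logarithm is at most of order phi(\<epsilon>) mu.\<close>
        have half: "1 / 2 \<le> ln (1 + \<epsilon>)"
        proof -
          have "exp (1 / 2) \<le> 1 + \<epsilon>" using exp_bound_half[of "1/2 :: real"] e1 by simp
          then show ?thesis using eps by (subst ln_ge_iff) auto
        qed
        have "ln (9 * K * (1 + \<epsilon>)) = ln (9 * K) + ln (1 + \<epsilon>)" using K1 eps by (intro ln_mult_pos) auto
        also have "\<dots> \<le> (2 * ln (9 * K) + 1) * ln (1 + \<epsilon>)"
        proof -
          have "ln (9 * K) * (1 / 2) \<le> ln (9 * K) * ln (1 + \<epsilon>)" using ln9 half by (intro mult_left_mono) auto
          then show ?thesis by (simp add: algebra_simps)
        qed
        finally have "real M * ln (9 * K * (1 + \<epsilon>)) \<le> (2 * ((1 + \<epsilon>) * mu p)) * ((2 * ln (9 * K) + 1) * ln (1 + \<epsilon>))"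
        proof (intro mult_mono M2)
          have "1 * 1 \<le> (9 * K) * (1 + \<epsilon>)" using K1 eps by (intro mult_mono) auto
          then show "0 \<le> ln (9 * K * (1 + \<epsilon>))" by simp
        qed (use eps mu_p_pos in auto)
        also have "\<dots> = 2 * (2 * ln (9 * K) + 1) * (((1 + \<epsilon>) * ln (1 + \<epsilon>)) * mu p)" by simp
        also have "\<dots> \<le> 2 * (2 * ln (9 * K) + 1) * ((5 * phi \<epsilon>) * mu p)"
          using l1e ln9 mu_p_pos by (intro mult_left_mono mult_right_mono) auto
        also have "\<dots> = 10 * (2 * ln (9 * K) + 1) * (phi \<epsilon> * mu p)" by simp
        also have "\<dots> \<le> 10 * (2 * ln (9 * K) + 1) * (2 * real k ^ 4 * Psi2)"
          using sparse_Psi2[OF sp] ln9 by (intro mult_left_mono) auto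
        also have "\<dots> = 20 * real k ^ 4 * (2 * ln (9 * K) + 1) * Psi2" by (simp add: algebra_simps)
        finally show ?thesis unfolding exp_le_cancel_iff .
      qed
      finally show "(1 + 4 * K * real M / mu p) ^ M \<le> exp (20 * real k ^ 4 * (2 * ln (9 * K) + 1) * Psi2)" .
    qed
    then show ?thesis ..
  qed
qed

end

text \<open>\<open>C\<close> must be fixed before n, H, p and \<epsilon>, so the statement leaves
  the locale and uses its exported constants. The last premise supplies the edges inside an initial
  interval that cluster planting needs.\<close>

lemma lower_tail:
  fixes k :: nat and \<gamma> :: real
  assumes k: "3 \<le> k" and g: "0 < \<gamma>" "\<gamma> < 1"
  obtains C where "0 < C" "\<And>n H p \<epsilon>. tail_regime n k H \<gamma> p \<epsilon> \<Longrightarrow> 100 * k \<le> n \<Longrightarrow>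
      (\<And>L. 4 * k \<le> L \<Longrightarrow> L \<le> n \<Longrightarrow> (real L)\<^sup>2 \<le> 16 * real k * real (card {A \<in> H. A \<subseteq> {1..L}})) \<Longrightarrow>
      exp (- C * min (phi \<epsilon> * (almost_linear.mu k H p)\<^sup>2 / almost_linear.vr k p H)
        (sqrt (\<epsilon> * almost_linear.mu k H p) * ln (1 / p)))
      \<le> Ebin n p (\<lambda>R. of_bool ((1 + \<epsilon>) * almost_linear.mu k H p \<le> almost_linear.X H R))"
proof -
  define e0 where "e0 = \<gamma> / (1 + tilt_const k \<gamma>)"
  define c where "c = 6 + 2 / \<gamma>"
  define K where "K = real k ^ 4 + (real k)\<^sup>2 * exp (16 * real k ^ 3)"
  define C1 where "C1 = sqrt (32 * real k / \<gamma>) + (1 + 4 * real k) / sqrt (\<gamma> / 2) + 1"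
  define C2 where "C2 = 2 + 128 * real k ^ 5 * (1 + tilt_const k \<gamma>)\<^sup>2 / \<gamma>"
  define C3 where "C3 = 4 + 32 * (real k ^ 4 + (real k)\<^sup>2 * exp (16 * real k ^ 3 * c)) * c\<^sup>2 * real k ^ 4"
  define C4 where "C4 = 4 + 20 * real k ^ 4 * (2 * ln (9 * K) + 1)"
  define C5 where "C5 = max (256 * real k ^ 5 / e0\<^sup>2) (128 * real k ^ 4)"
  define C where "C = max C1 (max (C1 * C5) (max C2 (max C3 C4)))"
  have t0: "0 < tilt_const k \<gamma>" using k g by (simp add: tilt_const_def)
  have e0: "0 < e0" "e0 \<le> 1" using t0 g by (auto simp: e0_def)
  have C10: "0 < C1" using g by (simp add: C1_def add_nonneg_pos)
  have C_ge: "C1 \<le> C" "C1 * C5 \<le> C" "C2 \<le> C" "C3 \<le> C" "C4 \<le> C" by (auto simp: C_def)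
  have C0: "0 < C" using C10 C_ge by linarith
  show thesis
  proof (rule that[OF C0])
    fix n H p \<epsilon>
    assume tr: "tail_regime n k H \<gamma> p \<epsilon>" and n: "100 * k \<le> n"
      and int: "\<And>L. 4 * k \<le> L \<Longrightarrow> L \<le> n \<Longrightarrow> (real L)\<^sup>2 \<le> 16 * real k * real (card {A \<in> H. A \<subseteq> {1..L}})"
    interpret tail_regime n k H \<gamma> p \<epsilon> by (rule tr)
    have cl: "exp (- (C1 * Psi1)) \<le> Pr" unfolding C1_def using int by (rule lower_cluster)
    \<comment> \<open>The cluster bound always holds in terms of \<open>Psi1\<close>. It covers the
      minimum if \<open>Psi1\<close> is at most a multiple of \<open>Psi2\<close>; otherwise a
      second bound in terms of \<open>Psi2\<close> is at hand, and the smaller rate is always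
      served.\<close>
    have "(Psi1 \<le> C5 * Psi2) \<or> (\<exists>C'\<le>C. exp (- (C' * Psi2)) \<le> Pr)"
    proof (cases "1 \<le> real n * p ^ (k - 1)")
      case d: True
      show ?thesis
      proof (cases "(1 + kap) * \<epsilon> \<le> \<gamma>")
        case True
        then show ?thesis using lower_dense_small[OF d True] C_ge(3) unfolding C2_def by blast
      next
        case False
        then have "e0 \<le> \<epsilon>" using t0 by (simp add: e0_def field_simps)
        then have "Psi1 \<le> 256 * real k ^ 5 / e0\<^sup>2 * Psi2" using dense_large[OF d e0] by simp
        also have "\<dots> \<le> C5 * Psi2" using Psi_ge1 by (intro mult_right_mono) (auto simp: C5_def)
        finally show ?thesis by simp
      qed
    next
      case False
      then have sp: "real n * p ^ (k - 1) \<le> 1" by simp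
      show ?thesis
      proof (cases "\<epsilon> \<le> 1")
        case True
        then show ?thesis using lower_sparse_small[OF sp n True c_def] C_ge(4) unfolding C3_def by blast
      next
        case False
        then have "Psi1 \<le> 128 * real k ^ 4 * Psi2 \<or> exp (- (C4 * Psi2)) \<le> Pr"
          unfolding C4_def using lower_sparse_large[OF sp n _ K_def] by simp
        moreover have "128 * real k ^ 4 * Psi2 \<le> C5 * Psi2" using Psi_ge1 by (intro mult_right_mono) (auto simp: C5_def)
        ultimately show ?thesis using C_ge(5) by (meson order_trans)
      qed
    qed
    then have "exp (- (C * min Psi2 Psi1)) \<le> Pr"
    proof
      assume a: "Psi1 \<le> C5 * Psi2"
      have "C1 * Psi1 \<le> C * min Psi2 Psi1"
      proof (cases "Psi1 \<le> Psi2")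
        case True
        then show ?thesis using C_ge(1) Psi_ge1 by (simp add: min_def mult_right_mono)
      next
        case False
        have "C1 * Psi1 \<le> C1 * (C5 * Psi2)" using a C10 by (intro mult_left_mono) auto
        also have "\<dots> = (C1 * C5) * Psi2" by simp
        also have "\<dots> \<le> C * Psi2" using C_ge(2) Psi_ge1 by (intro mult_right_mono) auto
        finally show ?thesis using False by (simp add: min_def)
      qed
      then have "exp (- (C * min Psi2 Psi1)) \<le> exp (- (C1 * Psi1))" by simp
      then show ?thesis using cl by linarith
    next
      assume "\<exists>C'\<le>C. exp (- (C' * Psi2)) \<le> Pr"
      then obtain C' where C': "C' \<le> C" "exp (- (C' * Psi2)) \<le> Pr" by blast
      show ?thesis
      proof (cases "Psi1 \<le> Psi2")
        case True
        have "C1 * Psi1 \<le> C * Psi1" using C_ge(1) Psi_ge1 by (intro mult_right_mono) auto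
        then have "exp (- (C * min Psi2 Psi1)) \<le> exp (- (C1 * Psi1))" using True by (simp add: min_def)
        then show ?thesis using cl by linarith
      next
        case False
        have "C' * Psi2 \<le> C * Psi2" using C'(1) Psi_ge1 by (intro mult_right_mono) auto
        then have "exp (- (C * min Psi2 Psi1)) \<le> exp (- (C' * Psi2))" using False by (simp add: min_def)
        then show ?thesis using C'(2) by linarith
      qed
    qed
    then show "exp (- C * min (phi \<epsilon> * (mu p)\<^sup>2 / vr p H) (sqrt (\<epsilon> * mu p) * ln (1 / p)))
      \<le> Ebin n p (\<lambda>R. of_bool ((1 + \<epsilon>) * mu p \<le> X H R))"
      by (simp add: Psi1_def Psi2_def Pr_def)
  qed
qed

section \<open>Transfer to arithmetic progressions in the binomial random subset\<close>

theorem theorem1p2: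
  fixes k :: nat
  assumes "k \<ge> 3"
  shows "\<exists>(n\<^sub>0::nat) (\<alpha>::real). n\<^sub>0 > 0 \<and> \<alpha> > 1 / (6 * real k) \<and>
    (\<forall>\<gamma>::real. 0 < \<gamma> \<and> \<gamma> < 1 \<longrightarrow>
      (\<exists>(c::real) (C::real). c > 0 \<and> C > 0 \<and>
        (\<forall>(n::nat) (p::real) (\<epsilon>::real).
          n \<ge> n\<^sub>0 \<and> 0 < p \<and> p \<le> 1 - \<gamma> \<and> \<epsilon> \<ge> real n powr (- \<alpha>) \<and> Phi k n p \<epsilon> \<ge> 1 \<longrightarrow>
            of_bool (1 \<le> (1 + \<epsilon>) * mu_AP k n p \<and> (1 + \<epsilon>) * mu_AP k n p \<le> num_AP k {1..n})
                * exp (- C * Phi k n p \<epsilon>)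
              \<le> measure_pmf.prob (random_subset n p) {S. num_AP k S \<ge> (1 + \<epsilon>) * mu_AP k n p} \<and>
            measure_pmf.prob (random_subset n p) {S. num_AP k S \<ge> (1 + \<epsilon>) * mu_AP k n p}
              \<le> exp (- c * Phi k n p \<epsilon>))))"
\<comment> \<open>The bound 100 k is the size condition of the sparse lower bounds and exceeds the 4
  k required for counting progressions; the exponent 1 lies above 1 / (6 k).\<close>
proof (rule exI[of _ "100 * k"], rule exI[of _ "1 :: real"], intro conjI allI impI)
  show "0 < 100 * k" using assms by simp
  show "1 / (6 * real k) < 1" using assms by simp
next
  fix \<gamma> :: real assume g: "0 < \<gamma> \<and> \<gamma> < 1"
  define c where "c = min (1 / (1310720 * real k ^ 5)) (\<gamma> * exp (- 120 * real k) ^ (k - 1) / (512 * real k ^ 3))"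
  have c0: "0 < c" using assms g by (simp add: c_def)
  obtain C where C0: "0 < C" and C: "\<And>n H p \<epsilon>. tail_regime n k H \<gamma> p \<epsilon> \<Longrightarrow> 100 * k \<le> n \<Longrightarrow>
    (\<And>L. 4 * k \<le> L \<Longrightarrow> L \<le> n \<Longrightarrow> (real L)\<^sup>2 \<le> 16 * real k * real (card {A \<in> H. A \<subseteq> {1..L}})) \<Longrightarrow>
    exp (- C * min (phi \<epsilon> * (almost_linear.mu k H p)\<^sup>2 / almost_linear.vr k p H)
      (sqrt (\<epsilon> * almost_linear.mu k H p) * ln (1 / p)))
    \<le> Ebin n p (\<lambda>R. of_bool ((1 + \<epsilon>) * almost_linear.mu k H p \<le> almost_linear.X H R))"
    using lower_tail[OF assms, of \<gamma>] g by blast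
  show "\<exists>c C. 0 < c \<and> 0 < C \<and> (\<forall>n p \<epsilon>. 100 * k \<le> n \<and> 0 < p \<and> p \<le> 1 - \<gamma> \<and> real n powr - 1 \<le> \<epsilon> \<and> 1 \<le> Phi k n p \<epsilon> \<longrightarrow>
      of_bool (1 \<le> (1 + \<epsilon>) * mu_AP k n p \<and> (1 + \<epsilon>) * mu_AP k n p \<le> num_AP k {1..n}) * exp (- C * Phi k n p \<epsilon>)
        \<le> measure_pmf.prob (random_subset n p) {S. (1 + \<epsilon>) * mu_AP k n p \<le> num_AP k S} \<and>
      measure_pmf.prob (random_subset n p) {S. (1 + \<epsilon>) * mu_AP k n p \<le> num_AP k S} \<le> exp (- c * Phi k n p \<epsilon>))"
  proof (rule exI[of _ c], rule exI[of _ C], intro conjI[OF c0] conjI[OF C0] allI impI)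
    fix n :: nat and p \<epsilon> :: real
    assume h: "100 * k \<le> n \<and> 0 < p \<and> p \<le> 1 - \<gamma> \<and> real n powr - 1 \<le> \<epsilon> \<and> 1 \<le> Phi k n p \<epsilon>"
    have n: "100 * k \<le> n" and p: "0 < p" "p \<le> 1 - \<gamma>" "p \<le> 1" "p < 1" using h g by auto
    have "0 < real n powr - 1" using n assms by simp
    then have e: "0 < \<epsilon>" using h by linarith
    define H where "H = arith_progs k {1..n}"
    interpret almost_linear n k H
      unfolding H_def using assms n by (intro almost_linear_arith_progs) auto
    \<comment> \<open>Progressions in S are exactly the progressions in \<open>{1..n}\<close>
      contained in S, so X on the hypergraph is the original random variable.\<close>
    have sub: "{A \<in> H. A \<subseteq> S} = arith_progs k S" if "S \<subseteq> {1..n}" for S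
      using that by (auto simp: H_def arith_progs_def)
    have XH: "num_AP k S = X H S" if "S \<subseteq> {1..n}" for S
      using sub[OF that] by (simp add: num_AP_def X_def)
    have mu: "mu_AP k n p = mu p"
    proof -
      have "mu_AP k n p = Ebin n p (num_AP k)" unfolding mu_AP_def using p by (intro expectation_random_subset) auto
      also have "\<dots> = Ebin n p (X H)" using XH by (intro Ebin_cong)
      finally show ?thesis using Ebin_X[of p H] p by (simp add: mu_def)
    qed
    have vr: "var_AP k n p = vr p H"
    proof -
      have "var_AP k n p = measure_pmf.expectation (random_subset n p) (\<lambda>S. (num_AP k S - mu_AP k n p)\<^sup>2)"
        by (simp add: var_AP_def mu_AP_def)
      also have "\<dots> = Ebin n p (\<lambda>S. (num_AP k S - mu p)\<^sup>2)"
        unfolding mu using p by (intro expectation_random_subset) auto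
      also have "\<dots> = Ebin n p (\<lambda>S. (X H S - mu p)\<^sup>2)" using XH by (intro Ebin_cong) simp
      finally show ?thesis using Ebin_X_variance[of p H] p by (simp add: mu_def)
    qed
    have Phi: "Phi k n p \<epsilon> = min (phi \<epsilon> * (mu p)\<^sup>2 / vr p H) (sqrt (\<epsilon> * mu p) * ln (1 / p))"
      by (simp add: Phi_def mu vr)
    have pr: "measure_pmf.prob (random_subset n p) {S. (1 + \<epsilon>) * mu_AP k n p \<le> num_AP k S}
      = Ebin n p (\<lambda>R. of_bool ((1 + \<epsilon>) * mu p \<le> X H R))"
    proof -
      have "measure_pmf.prob (random_subset n p) {S. (1 + \<epsilon>) * mu_AP k n p \<le> num_AP k S}
        = Ebin n p (\<lambda>R. of_bool ((1 + \<epsilon>) * mu_AP k n p \<le> num_AP k R))"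
        using p by (intro prob_random_subset) auto
      also have "\<dots> = Ebin n p (\<lambda>R. of_bool ((1 + \<epsilon>) * mu p \<le> X H R))"
        unfolding mu using XH by (intro Ebin_cong) simp
      finally show ?thesis .
    qed
    have cH: "num_AP k {1..n} = real (card H)" by (simp add: num_AP_def H_def)
    have up: "Ebin n p (\<lambda>R. of_bool ((1 + \<epsilon>) * mu p \<le> X H R)) \<le> exp (- c * Phi k n p \<epsilon>)"
      unfolding c_def using g p e h by (intro upper_tail Phi) auto
    have low: "of_bool (1 \<le> (1 + \<epsilon>) * mu p \<and> (1 + \<epsilon>) * mu p \<le> real (card H)) * exp (- C * Phi k n p \<epsilon>)
      \<le> Ebin n p (\<lambda>R. of_bool ((1 + \<epsilon>) * mu p \<le> X H R))"
    proof (cases "1 \<le> (1 + \<epsilon>) * mu p \<and> (1 + \<epsilon>) * mu p \<le> real (card H)")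
      case True
      have "tail_regime n k H \<gamma> p \<epsilon>"
        using True g p e h by unfold_locales (auto simp: Phi)
      moreover have "(real L)\<^sup>2 \<le> 16 * real k * real (card {A \<in> H. A \<subseteq> {1..L}})" if "4 * k \<le> L" "L \<le> n" for L
        using card_arith_progs_ge[of k L] sub[of "{1..L}"] assms that by simp
      ultimately show ?thesis using C[of n H p \<epsilon>] n True by (simp add: Phi)
    next
      case False
      then show ?thesis using p by (auto intro!: Ebin_nonneg)
    qed
    show "of_bool (1 \<le> (1 + \<epsilon>) * mu_AP k n p \<and> (1 + \<epsilon>) * mu_AP k n p \<le> num_AP k {1..n}) * exp (- C * Phi k n p \<epsilon>)
        \<le> measure_pmf.prob (random_subset n p) {S. (1 + \<epsilon>) * mu_AP k n p \<le> num_AP k S} \<and>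
      measure_pmf.prob (random_subset n p) {S. (1 + \<epsilon>) * mu_AP k n p \<le> num_AP k S} \<le> exp (- c * Phi k n p \<epsilon>)"
      unfolding pr cH unfolding mu using low up by simp
  qed
qed

end
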